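(* Let $\alpha>0$, and let $\varphi$ and $\psi$ be nonconstant linear fractional self-maps of $\mathbb D$. Then $$\|C_\psi^*C_\varphi\|_{e,\mathcal D_\alpha}^2=\max_{\substack{\lambda\in\mathbb T\\ |\varphi(\lambda)|=|\psi(\lambda)|=1}}\bigl(|\varphi'(\lambda)|\,|\psi'(\lambda)|\bigr)^{-\alpha},$$ where the maximum is understood to be zero when $\varphi^{-1}(\mathbb T)\cap\psi^{-1}(\mathbb T)\cap\mathbb T=\varnothing$.
   Context: $\mathbb D$ is the open unit disk in $\mathbb C$, $\mathbb T$ is the unit circle, and $dA$ is the normalized area measure on $\mathbb D$. For $\alpha>-1$, $dA_\alpha(z)=(1+\alpha)(1-|z|^2)^\alpha\,dA(z)$. The weighted Dirichlet space $\mathcal D_\alpha$ is the Hilbert space of analytic functions $f$ on $\mathbb D$ with $\|f\|_{\mathcal D_\alpha}^2=|f(0)|^2+\int_{\mathbb D}|f'(z)|^2\,dA_\alpha(z)<\infty$, with the associated inner product. A nonconstant linear fractional self-map of $\mathbb D$ is a map $\varphi(z)=\frac{az+b}{cz+d}$ with $ad-bc\neq0$ and $\varphi(\mathbb D)\subset\mathbb D$; it extends analytically to a neighborhood of $\overline{\mathbb D}$, and values and derivatives on $\mathbb T$ are those of this extension. Thus $\varphi^{-1}(\mathbb T)\cap\psi^{-1}(\mathbb T)\cap\mathbb T=\{\lambda\in\mathbb T:|\varphi(\lambda)|=|\psi(\lambda)|=1\}$. The composition operator is $C_\varphi f=f\circ\varphi$; for such $\varphi$ it is bounded on $\mathcal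 D_\alpha$. $C_\psi^*$ is the Hilbert space adjoint of $C_\psi$ on $\mathcal D_\alpha$. For a bounded operator $T$ on a Hilbert space $\mathcal H$, the essential norm is $\|T\|_{e,\mathcal H}=\inf\{\|T-K\|:K\text{ compact on }\mathcal H\}$. *)

theory Defs
  imports "HOL-Complex_Analysis.Complex_Analysis"
begin

text \<open>Hilbert spaces of complex functions are represented by an explicit carrier \<open>H\<close> (with the
  pointwise vector space operations) and an inner product \<open>ip\<close>, linear in the first argument.
  Operators on \<open>H\<close> are only meaningful on elements of \<open>H\<close>.\<close>

definition hnorm :: "(('x \<Rightarrow> complex) \<Rightarrow> ('x \<Rightarrow> complex) \<Rightarrow> complex) \<Rightarrow> ('x \<Rightarrow> complex) \<Rightarrow> real" where
  "hnorm ip f = sqrt (Re (ip f f))"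

definition linear_op :: "('x \<Rightarrow> complex) set \<Rightarrow> (('x \<Rightarrow> complex) \<Rightarrow> ('x \<Rightarrow> complex)) \<Rightarrow> bool" where
  "linear_op H T \<longleftrightarrow> T ` H \<subseteq> H \<and>
     (\<forall>f\<in>H. \<forall>g\<in>H. \<forall>a b. T (\<lambda>x. a * f x + b * g x) = (\<lambda>x. a * T f x + b * T g x))"

definition op_norm ::
  "('x \<Rightarrow> complex) set \<Rightarrow> (('x \<Rightarrow> complex) \<Rightarrow> ('x \<Rightarrow> complex) \<Rightarrow> complex) \<Rightarrow>
   (('x \<Rightarrow> complex) \<Rightarrow> ('x \<Rightarrow> complex)) \<Rightarrow> real" where
  "op_norm H ip T = (SUP f \<in> {f \<in> H. hnorm ip f \<le> 1}. hnorm ip (T f))"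

definition norm_topology ::
  "('x \<Rightarrow> complex) set \<Rightarrow> (('x \<Rightarrow> complex) \<Rightarrow> ('x \<Rightarrow> complex) \<Rightarrow> complex) \<Rightarrow>
   ('x \<Rightarrow> complex) topology" where
  "norm_topology H ip = Metric_space.mtopology H (\<lambda>f g. hnorm ip (\<lambda>x. f x - g x))"

definition compact_op ::
  "('x \<Rightarrow> complex) set \<Rightarrow> (('x \<Rightarrow> complex) \<Rightarrow> ('x \<Rightarrow> complex) \<Rightarrow> complex) \<Rightarrow>
   (('x \<Rightarrow> complex) \<Rightarrow> ('x \<Rightarrow> complex)) \<Rightarrow> bool" where
  "compact_op H ip K \<longleftrightarrow> linear_op H K \<and>
     compactin (norm_topology H ip)
       (norm_topology H ip closure_of (K ` {f \<in> H. hnorm ip f \<le> 1}))"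

definition ess_norm ::
  "('x \<Rightarrow> complex) set \<Rightarrow> (('x \<Rightarrow> complex) \<Rightarrow> ('x \<Rightarrow> complex) \<Rightarrow> complex) \<Rightarrow>
   (('x \<Rightarrow> complex) \<Rightarrow> ('x \<Rightarrow> complex)) \<Rightarrow> real" where
  "ess_norm H ip T = (INF K \<in> {K. compact_op H ip K}. op_norm H ip (\<lambda>f x. T f x - K f x))"

definition hilbert_adjoint ::
  "('x \<Rightarrow> complex) set \<Rightarrow> (('x \<Rightarrow> complex) \<Rightarrow> ('x \<Rightarrow> complex) \<Rightarrow> complex) \<Rightarrow>
   (('x \<Rightarrow> complex) \<Rightarrow> ('x \<Rightarrow> complex)) \<Rightarrow> ('x \<Rightarrow> complex) \<Rightarrow> ('x \<Rightarrow> complex)" where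
  "hilbert_adjoint H ip T g = (THE h. h \<in> H \<and> (\<forall>f\<in>H. ip (T f) g = ip f h))"

definition area_measure :: "complex measure" where
  "area_measure = scale_measure (ennreal (1 / pi)) (restrict_space lborel (ball 0 1))"

definition weighted_area :: "real \<Rightarrow> complex measure" where
  "weighted_area \<alpha> =
     density area_measure (\<lambda>z. ennreal ((1 + \<alpha>) * (1 - (cmod z)\<^sup>2) powr \<alpha>))"

text \<open>A function on the disk is represented by its extension by zero to the whole plane, so that
  equality of elements is equality on the disk.\<close>

definition dirichlet_space :: "real \<Rightarrow> (complex \<Rightarrow> complex) set" where
  "dirichlet_space \<alpha> = {f. f holomorphic_on ball 0 1 \<and> (\<forall>z. z \<notin> ball 0 1 \<longrightarrow> f z = 0) \<and>
     integrable (weighted_area \<alpha>) (\<lambda>z. (cmod (deriv f z))\<^sup>2)}"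

definition dirichlet_inner ::
  "real \<Rightarrow> (complex \<Rightarrow> complex) \<Rightarrow> (complex \<Rightarrow> complex) \<Rightarrow> complex" where
  "dirichlet_inner \<alpha> f g =
     f 0 * cnj (g 0) + (LINT z|weighted_area \<alpha>. deriv f z * cnj (deriv g z))"

lemma hnorm_dirichlet_inner:
  "(hnorm (dirichlet_inner \<alpha>) f)\<^sup>2 =
     (cmod (f 0))\<^sup>2 + (LINT z|weighted_area \<alpha>. (cmod (deriv f z))\<^sup>2)"
proof -
  have "dirichlet_inner \<alpha> f f =
      complex_of_real ((cmod (f 0))\<^sup>2 + (LINT z|weighted_area \<alpha>. (cmod (deriv f z))\<^sup>2))"
    unfolding dirichlet_inner_def complex_norm_square[symmetric]
    by (simp only: integral_complex_of_real of_real_add)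
  moreover have "0 \<le> (cmod (f 0))\<^sup>2 + (LINT z|weighted_area \<alpha>. (cmod (deriv f z))\<^sup>2)"
    by simp
  ultimately show ?thesis
    unfolding hnorm_def by simp
qed

definition comp_op :: "(complex \<Rightarrow> complex) \<Rightarrow> (complex \<Rightarrow> complex) \<Rightarrow> (complex \<Rightarrow> complex)" where
  "comp_op \<phi> f = (\<lambda>z. if z \<in> ball 0 1 then f (\<phi> z) else 0)"

text \<open>The formula is required on the whole plane, so that values and derivatives of \<open>\<phi>\<close> on the
  unit circle are those of the analytic extension. The pole (if any) is excluded from the disk
  explicitly because of the convention \<open>x / 0 = 0\<close>; it cannot lie on the circle
  either, since \<open>\<phi>\<close> is bounded on the disk.\<close>

definition lft_self_map :: "(complex \<Rightarrow> complex) \<Rightarrow> bool" where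
  "lft_self_map \<phi> \<longleftrightarrow> (\<exists>a b c d. a * d - b * c \<noteq> 0 \<and>
     (\<forall>z\<in>ball 0 1. c * z + d \<noteq> 0) \<and>
     (\<forall>z. \<phi> z = (a * z + b) / (c * z + d)) \<and>
     \<phi> ` ball 0 1 \<subseteq> ball 0 1)"

definition common_contact :: "(complex \<Rightarrow> complex) \<Rightarrow> (complex \<Rightarrow> complex) \<Rightarrow> complex set" where
  "common_contact \<phi> \<psi> = {\<zeta> \<in> sphere 0 1. cmod (\<phi> \<zeta>) = 1 \<and> cmod (\<psi> \<zeta>) = 1}"

end

theory Submission
  imports Defs
begin

text \<open>Write \<open>T\<close> for the operator in question. It is determined by the sesquilinear form
  \<open>\<langle>T f, g\<rangle> = \<langle>f \<circ> \<phi>, g \<circ> \<psi>\<rangle>\<close>, and apart from a product of two point values this form is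
  the integral of \<open>(f \<circ> \<phi>)' cnj (g \<circ> \<psi>)'\<close> against the weight
  \<open>w(z) = (1 + \<alpha>) (1 - |z|\<^sup>2)\<^sup>\<alpha> / \<pi>\<close>.

  Upper bound. Let \<open>\<rho>\<^sub>\<phi>(z) = (1 - |z|\<^sup>2) / (1 - |\<phi>(z)|\<^sup>2)\<close>. Since \<open>w = \<rho>\<^sub>\<phi>\<^sup>\<alpha> (w \<circ> \<phi>)\<close> and likewise for \<open>\<psi>\<close>,
  the weight is \<open>(\<rho>\<^sub>\<phi> \<rho>\<^sub>\<psi>)\<^sup>\<alpha>\<^sup>/\<^sup>2\<close> times the geometric mean of \<open>w \<circ> \<phi>\<close> and \<open>w \<circ> \<psi>\<close>. The maps are injective,
  so by a change of variables the integral of \<open>|(f \<circ> \<phi>)'|\<^sup>2 (w \<circ> \<phi>)\<close> is at most the squared norm of \<open>f\<close>.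
  Hence the part of the form living on an annulus \<open>r < |z| < 1\<close> is bounded by the supremum of
  \<open>(\<rho>\<^sub>\<phi> \<rho>\<^sub>\<psi>)\<^sup>\<alpha>\<^sup>/\<^sup>2\<close> over this annulus. The part on \<open>|z| \<le> r\<close> can be made arbitrarily small by replacing \<open>f\<close> with a
  Taylor remainder of high order, and this replacement changes \<open>T\<close> by an operator of finite rank
  (\<open>taylor_remainder_small\<close>, \<open>comp_op_inner_bound\<close>). It remains to let \<open>r\<close> tend to 1: by Julia's inequality
  (\<open>lft_julia\<close>) the upper limit of \<open>\<rho>\<^sub>\<phi>\<close> at a boundary point \<open>\<xi>\<close> is at most
  \<open>1 / |\<phi>'(\<xi>)|\<close> if \<open>|\<phi>(\<xi>)| = 1\<close>, and it is 0 otherwise.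

  Lower bound. At a common contact point \<open>\<xi>\<close> put \<open>s = |\<phi>'(\<xi>)|\<close>, \<open>t = |\<psi>'(\<xi>)|\<close> and take functions whose
  derivatives are \<open>(1 + (1 - cnj \<mu> z) / \<delta>)\<^sup>-\<^sup>m\<close>: for \<open>f\<close> with \<open>\<mu> = \<phi>(\<xi>)\<close> and \<open>\<delta> = s \<epsilon>\<close>, for \<open>g\<close> with
  \<open>\<mu> = \<psi>(\<xi>)\<close> and \<open>\<delta> = t \<epsilon>\<close>. In the coordinate \<open>z = \<xi> (1 - \<epsilon> w)\<close> the disk becomes the right half-plane as \<open>\<epsilon>\<close>
  tends to 0, both maps become dilations, and the derivatives of \<open>f \<circ> \<phi>\<close> and \<open>g \<circ> \<psi>\<close> become constant multiples
  of the same function \<open>(1 + w)\<^sup>-\<^sup>m\<close>. So the Cauchy-Schwarz inequality is asymptotically an equality, the norms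
  and the form can be compared by one limit (\<open>peak_scaling_limit\<close>), and the quotient
  \<open>|\<langle>T f, g\<rangle>| / (\<parallel>f\<parallel> \<parallel>g\<parallel>)\<close> tends to \<open>(s t)\<^sup>-\<^sup>\<alpha>\<^sup>/\<^sup>2\<close>. After normalisation the functions \<open>g\<close> tend
  weakly to 0, so no compact perturbation of \<open>T\<close> can lower this value (\<open>ess_norm_ge\<close>).\<close>

section \<open>Hilbert spaces of functions\<close>

text \<open>Non-negativity of the norm and its invariance under negation are demanded of all functions, not only
  of the members of the space: the distance that defines \<open>norm_topology\<close> is a total function, and
  a metric has to be non-negative and symmetric everywhere.\<close>

locale function_hilbert_space =
  fixes H :: "('x \<Rightarrow> complex) set" and ip :: "('x \<Rightarrow> complex) \<Rightarrow> ('x \<Rightarrow> complex) \<Rightarrow> complex"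
  assumes zero_mem: "(\<lambda>_. 0) \<in> H"
    and lin_mem: "f \<in> H \<Longrightarrow> g \<in> H \<Longrightarrow> (\<lambda>x. a * f x + b * g x) \<in> H"
    and ip_lin: "f \<in> H \<Longrightarrow> g \<in> H \<Longrightarrow> h \<in> H \<Longrightarrow> ip (\<lambda>x. a * f x + b * g x) h = a * ip f h + b * ip g h"
    and ip_cnj: "f \<in> H \<Longrightarrow> g \<in> H \<Longrightarrow> ip g f = cnj (ip f g)"
    and ip_nonneg: "0 \<le> Re (ip f f)"
    and hnorm_uminus: "hnorm ip (\<lambda>x. - f x) = hnorm ip f"
    and ip_definite: "f \<in> H \<Longrightarrow> Re (ip f f) = 0 \<Longrightarrow> f = (\<lambda>_. 0)"
    and complete: "\<And>F. (\<And>n. F n \<in> H) \<Longrightarrow>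
        (\<And>e. e > 0 \<Longrightarrow> \<exists>N. \<forall>m\<ge>N. \<forall>n\<ge>N. hnorm ip (\<lambda>x. F m x - F n x) < e) \<Longrightarrow>
        \<exists>f\<in>H. (\<lambda>n. hnorm ip (\<lambda>x. F n x - f x)) \<longlonglongrightarrow> 0"
begin

lemma add_mem: "f \<in> H \<Longrightarrow> g \<in> H \<Longrightarrow> (\<lambda>x. f x + g x) \<in> H"
  using lin_mem[of f g 1 1] by simp

lemma diff_mem: "f \<in> H \<Longrightarrow> g \<in> H \<Longrightarrow> (\<lambda>x. f x - g x) \<in> H"
  using lin_mem[of f g 1 "-1"] by simp

lemma scale_mem: "f \<in> H \<Longrightarrow> (\<lambda>x. a * f x) \<in> H"
  using lin_mem[of f f a 0] by simp

lemma ip_add_left: "f \<in> H \<Longrightarrow> g \<in> H \<Longrightarrow> h \<in> H \<Longrightarrow> ip (\<lambda>x. f x + g x) h = ip f h + ip g h"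
  using ip_lin[of f g h 1 1] by simp

lemma ip_diff_left: "f \<in> H \<Longrightarrow> g \<in> H \<Longrightarrow> h \<in> H \<Longrightarrow> ip (\<lambda>x. f x - g x) h = ip f h - ip g h"
  using ip_lin[of f g h 1 "-1"] by simp

lemma ip_scale_left: "f \<in> H \<Longrightarrow> h \<in> H \<Longrightarrow> ip (\<lambda>x. a * f x) h = a * ip f h"
  using ip_lin[of f f h a 0] by simp

lemma ip_add_right: "f \<in> H \<Longrightarrow> g \<in> H \<Longrightarrow> h \<in> H \<Longrightarrow> ip h (\<lambda>x. f x + g x) = ip h f + ip h g"
  using ip_cnj[of "\<lambda>x. f x + g x" h] ip_cnj[of f h] ip_cnj[of g h]
  by (simp add: add_mem ip_add_left)

lemma ip_diff_right: "f \<in> H \<Longrightarrow> g \<in> H \<Longrightarrow> h \<in> H \<Longrightarrow> ip h (\<lambda>x. f x - g x) = ip h f - ip h g"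
  using ip_cnj[of "\<lambda>x. f x - g x" h] ip_cnj[of f h] ip_cnj[of g h]
  by (simp add: diff_mem ip_diff_left)

lemma ip_scale_right: "f \<in> H \<Longrightarrow> h \<in> H \<Longrightarrow> ip h (\<lambda>x. a * f x) = cnj a * ip h f"
  using ip_cnj[of "\<lambda>x. a * f x" h] ip_cnj[of f h]
  by (simp add: scale_mem ip_scale_left)

lemmas ip_simps = ip_add_left ip_diff_left ip_scale_left ip_add_right ip_diff_right ip_scale_right
  add_mem diff_mem scale_mem

lemma hnorm_nonneg: "0 \<le> hnorm ip f"
  by (simp add: hnorm_def ip_nonneg)

lemma hnorm_power2: "(hnorm ip f)\<^sup>2 = Re (ip f f)"
  by (simp add: hnorm_def ip_nonneg)

lemma ip_self: "f \<in> H \<Longrightarrow> ip f f = complex_of_real ((hnorm ip f)\<^sup>2)"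
  using ip_cnj[of f f] by (simp add: hnorm_power2 complex_eq_iff)

lemma hnorm_zero: "hnorm ip (\<lambda>_. 0) = 0"
  using ip_scale_left[OF zero_mem zero_mem, of 0] by (simp add: hnorm_def)

lemma hnorm_eq_0: "f \<in> H \<Longrightarrow> hnorm ip f = 0 \<longleftrightarrow> f = (\<lambda>_. 0)"
  using ip_definite[of f] hnorm_power2[of f] hnorm_zero by auto

lemma hnorm_scale: "f \<in> H \<Longrightarrow> hnorm ip (\<lambda>x. a * f x) = cmod a * hnorm ip f"
proof -
  assume f: "f \<in> H"
  have "(hnorm ip (\<lambda>x. a * f x))\<^sup>2 = (cmod a * hnorm ip f)\<^sup>2"
    using f ip_cnj[OF f f]
    by (simp add: hnorm_power2 ip_simps power_mult_distrib cmod_power2 complex_eq_iff)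
       (simp add: power2_eq_square algebra_simps)
  then show ?thesis
    using f by (simp add: hnorm_nonneg scale_mem)
qed

lemma hnorm_add_scaled_power2:
  assumes f: "f \<in> H" and g: "g \<in> H"
  shows "(hnorm ip (\<lambda>x. f x + a * g x))\<^sup>2 =
    (hnorm ip f)\<^sup>2 + 2 * Re (cnj a * ip f g) + (cmod a)\<^sup>2 * (hnorm ip g)\<^sup>2"
proof -
  have "Re (a * (cnj a * ip g g)) = (cmod a)\<^sup>2 * (hnorm ip g)\<^sup>2"
    using ip_self[OF g] by (simp add: cmod_power2) (simp add: power2_eq_square algebra_simps)
  moreover have "Re (a * ip g f) = Re (cnj a * ip f g)"
    using ip_cnj[OF f g] by simp
  ultimately show ?thesis
    using f g by (simp add: hnorm_power2 ip_simps algebra_simps)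
qed

lemma cauchy_schwarz:
  assumes f: "f \<in> H" and g: "g \<in> H"
  shows "cmod (ip f g) \<le> hnorm ip f * hnorm ip g"
proof (cases "hnorm ip g = 0")
  case True
  then have "g = (\<lambda>_. 0)" using hnorm_eq_0[OF g] by simp
  then show ?thesis
    using ip_scale_right[OF zero_mem f, of 0] True by simp
next
  case False
  define G where "G = (hnorm ip g)\<^sup>2"
  have G: "G > 0" using False by (simp add: G_def)
  define a where "a = - ip f g / of_real G"
  have "0 \<le> (hnorm ip f)\<^sup>2 + 2 * Re (cnj a * ip f g) + (cmod a)\<^sup>2 * (hnorm ip g)\<^sup>2"
    using hnorm_add_scaled_power2[OF f g, of a] by (metis zero_le_power2)
  also have "Re (cnj a * ip f g) = - (cmod (ip f g))\<^sup>2 / G"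
    by (simp add: a_def cmod_power2) (simp add: power2_eq_square diff_divide_distrib add_divide_distrib)
  also have "(cmod a)\<^sup>2 * (hnorm ip g)\<^sup>2 = (cmod (ip f g))\<^sup>2 / G"
    using G by (simp add: a_def norm_divide power_divide flip: G_def) (simp add: power2_eq_square)
  finally have "(cmod (ip f g))\<^sup>2 / G \<le> (hnorm ip f)\<^sup>2" by simp
  then have "(cmod (ip f g))\<^sup>2 \<le> (hnorm ip f * hnorm ip g)\<^sup>2"
    using G by (simp add: pos_divide_le_eq power_mult_distrib flip: G_def)
  then show ?thesis
    by (rule power2_le_imp_le) (simp add: hnorm_nonneg f g)
qed

lemma hnorm_triangle:
  assumes f: "f \<in> H" and g: "g \<in> H"
  shows "hnorm ip (\<lambda>x. f x + g x) \<le> hnorm ip f + hnorm ip g"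
proof -
  have "(hnorm ip (\<lambda>x. f x + g x))\<^sup>2 = (hnorm ip f)\<^sup>2 + 2 * Re (ip f g) + (hnorm ip g)\<^sup>2"
    using hnorm_add_scaled_power2[OF f g, of 1] by simp
  also have "\<dots> \<le> (hnorm ip f + hnorm ip g)\<^sup>2"
    using cauchy_schwarz[OF f g] complex_Re_le_cmod[of "ip f g"] by (simp add: power2_sum)
  finally show ?thesis
    by (rule power2_le_imp_le) (simp add: hnorm_nonneg f g)
qed

lemma hnorm_diff_commute: "hnorm ip (\<lambda>x. f x - g x) = hnorm ip (\<lambda>x. g x - f x)"
  using hnorm_uminus[of "\<lambda>x. f x - g x"] by simp

lemma hnorm_triangle_sub:
  "f \<in> H \<Longrightarrow> g \<in> H \<Longrightarrow> hnorm ip f \<le> hnorm ip g + hnorm ip (\<lambda>x. f x - g x)"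
  using hnorm_triangle[of g "\<lambda>x. f x - g x"] by (simp add: diff_mem)

lemma abs_hnorm_diff_le:
  "f \<in> H \<Longrightarrow> g \<in> H \<Longrightarrow> \<bar>hnorm ip f - hnorm ip g\<bar> \<le> hnorm ip (\<lambda>x. f x - g x)"
  using hnorm_triangle_sub[of f g] hnorm_triangle_sub[of g f] hnorm_diff_commute[of f g] by simp

lemma ip_eqI:
  assumes h: "h \<in> H" and k: "k \<in> H" and eq: "\<And>f. f \<in> H \<Longrightarrow> ip f h = ip f k"
  shows "h = k"
proof -
  have "ip (\<lambda>x. h x - k x) (\<lambda>x. h x - k x) = 0"
    using h k eq[OF diff_mem[OF h k]] by (simp add: ip_diff_right diff_mem)
  then have "(\<lambda>x. h x - k x) = (\<lambda>_. 0)"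
    using ip_definite[OF diff_mem[OF h k]] by simp
  then show ?thesis
    by (simp add: fun_eq_iff)
qed

text \<open>A representing vector is a minimiser of \<open>\<parallel>f\<parallel>\<^sup>2 - 2 Re (L f)\<close>. The parallelogram law turns every minimising
  sequence into a Cauchy sequence, and the first variation at the minimiser is the representation formula.\<close>

lemma riesz_representation:
  assumes lin: "\<And>f g a b. f \<in> H \<Longrightarrow> g \<in> H \<Longrightarrow> L (\<lambda>x. a * f x + b * g x) = a * L f + b * (L g :: complex)"
    and bound: "\<And>f. f \<in> H \<Longrightarrow> cmod (L f) \<le> C * hnorm ip f"
  shows "\<exists>h\<in>H. \<forall>f\<in>H. L f = ip f h"
proof -
  define J where "J f = (hnorm ip f)\<^sup>2 - 2 * Re (L f)" for f
  have L_add: "L (\<lambda>x. f x + a * g x) = L f + a * L g" if "f \<in> H" "g \<in> H" for f g a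
    using lin[OF that, of 1 a] by simp
  have J_lower: "- C\<^sup>2 \<le> J f" if f: "f \<in> H" for f
  proof -
    have "2 * Re (L f) \<le> 2 * (C * hnorm ip f)"
      using bound[OF f] complex_Re_le_cmod[of "L f"] by linarith
    moreover have "0 \<le> (hnorm ip f - C)\<^sup>2" by simp
    ultimately show ?thesis unfolding J_def by (simp add: power2_diff algebra_simps)
  qed
  define m where "m = Inf (J ` H)"
  have bdd: "bdd_below (J ` H)" using J_lower by (auto simp: bdd_below_def)
  have m_le: "m \<le> J f" if "f \<in> H" for f
    unfolding m_def using bdd that by (auto intro: cInf_lower)
  \<comment> \<open>Parallelogram law, applied at the midpoint of \<open>f\<close> and \<open>g\<close>.\<close>
  have J_mid: "(hnorm ip (\<lambda>x. f x - g x))\<^sup>2 \<le> 2 * J f + 2 * J g - 4 * m" if f: "f \<in> H" and g: "g \<in> H" for f g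
  proof -
    have p: "(\<lambda>x. f x + g x) \<in> H" by (rule add_mem[OF f g])
    have "(hnorm ip (\<lambda>x. f x + g x))\<^sup>2 = (hnorm ip f)\<^sup>2 + 2 * Re (ip f g) + (hnorm ip g)\<^sup>2"
      using hnorm_add_scaled_power2[OF f g, of 1] by simp
    moreover have "(hnorm ip (\<lambda>x. f x - g x))\<^sup>2 = (hnorm ip f)\<^sup>2 - 2 * Re (ip f g) + (hnorm ip g)\<^sup>2"
      using hnorm_add_scaled_power2[OF f g, of "-1"] by simp
    moreover have "m \<le> J (\<lambda>x. (1/2) * (f x + g x))"
      by (intro m_le scale_mem p)
    moreover have "J (\<lambda>x. (1/2) * (f x + g x)) = (hnorm ip (\<lambda>x. f x + g x))\<^sup>2 / 4 - Re (L f) - Re (L g)"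
    proof -
      have "hnorm ip (\<lambda>x. (1/2) * (f x + g x)) = hnorm ip (\<lambda>x. f x + g x) / 2"
        using hnorm_scale[OF p, of "1/2"] by simp
      moreover have "L (\<lambda>x. (1/2) * (f x + g x)) = (1/2) * L f + (1/2) * L g"
        using lin[OF f g, of "1/2" "1/2"] by (simp only: distrib_left)
      ultimately show ?thesis
        by (simp only: J_def) (simp add: power_divide)
    qed
    ultimately have *: "m \<le> ((hnorm ip f)\<^sup>2 + 2 * Re (ip f g) + (hnorm ip g)\<^sup>2) / 4 - Re (L f) - Re (L g)"
      and **: "(hnorm ip (\<lambda>x. f x - g x))\<^sup>2 = (hnorm ip f)\<^sup>2 - 2 * Re (ip f g) + (hnorm ip g)\<^sup>2"
      by simp_all
    from * have "4 * m \<le> (hnorm ip f)\<^sup>2 + 2 * Re (ip f g) + (hnorm ip g)\<^sup>2 - 4 * Re (L f) - 4 * Re (L g)"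
      by (simp add: field_simps)
    with ** show ?thesis unfolding J_def by (simp add: algebra_simps)
  qed
  have "\<exists>f\<in>H. J f < m + 1 / real (Suc n)" for n
    using cInf_lessD[of "J ` H" "m + 1 / real (Suc n)"] zero_mem by (auto simp: m_def)
  then obtain F where F: "\<And>n. F n \<in> H" and JF: "\<And>n. J (F n) < m + 1 / real (Suc n)"
    by metis
  have "\<exists>N. \<forall>i\<ge>N. \<forall>n\<ge>N. hnorm ip (\<lambda>x. F i x - F n x) < e" if e: "e > 0" for e
  proof -
    obtain N where N: "1 / real (Suc N) < e\<^sup>2 / 4"
      using reals_Archimedean[of "e\<^sup>2 / 4"] e by (auto simp: divide_simps)
    have "hnorm ip (\<lambda>x. F i x - F n x) < e" if "i \<ge> N" "n \<ge> N" for i n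
    proof -
      have "J (F k) < m + e\<^sup>2 / 4" if "k \<ge> N" for k
      proof -
        have "1 / real (Suc k) \<le> 1 / real (Suc N)" using that by (simp add: frac_le)
        then show ?thesis using JF[of k] N by linarith
      qed
      from this[of i] this[of n] that have "(hnorm ip (\<lambda>x. F i x - F n x))\<^sup>2 < e\<^sup>2"
        using J_mid[OF F F, of i n] by auto
      then show ?thesis using e by (metis power2_less_imp_less less_imp_le)
    qed
    then show ?thesis by blast
  qed
  from complete[OF F this] obtain h where h: "h \<in> H" and lim: "(\<lambda>n. hnorm ip (\<lambda>x. F n x - h x)) \<longlonglongrightarrow> 0"
    by blast
  have "(\<lambda>n. hnorm ip (F n) - hnorm ip h) \<longlonglongrightarrow> 0"
    using lim by (rule Lim_null_comparison[rotated]) (simp add: abs_hnorm_diff_le F h)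
  then have n_lim: "(\<lambda>n. hnorm ip (F n)) \<longlonglongrightarrow> hnorm ip h" by (simp add: LIM_zero_iff)
  have "(\<lambda>n. L (F n) - L h) \<longlonglongrightarrow> 0"
  proof (rule Lim_null_comparison)
    show "\<forall>\<^sub>F n in sequentially. norm (L (F n) - L h) \<le> C * hnorm ip (\<lambda>x. F n x - h x)"
      using bound[OF diff_mem[OF F h]] L_add[OF F h, where a="-1"] by simp
    show "(\<lambda>n. C * hnorm ip (\<lambda>x. F n x - h x)) \<longlonglongrightarrow> 0"
      using tendsto_mult_right_zero[OF lim] by simp
  qed
  then have l_lim: "(\<lambda>n. L (F n)) \<longlonglongrightarrow> L h" by (simp add: LIM_zero_iff)
  have "(\<lambda>n. J (F n)) \<longlonglongrightarrow> J h"
    unfolding J_def by (intro tendsto_intros n_lim l_lim)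
  moreover have "(\<lambda>n. m + 1 / real (Suc n)) \<longlonglongrightarrow> m"
    using LIMSEQ_inverse_real_of_nat_add[of m] by (simp add: inverse_eq_divide)
  ultimately have Jh: "J h \<le> m"
    by (rule LIMSEQ_le) (use JF less_imp_le in blast)
  have "L f = ip f h" if f: "f \<in> H" for f
  proof (rule ccontr)
    define c where "c = L f - ip f h"
    assume "L f \<noteq> ip f h"
    then have c: "(cmod c)\<^sup>2 > 0" by (simp add: c_def)
    have var: "2 * Re (a * c) \<le> (cmod a)\<^sup>2 * (hnorm ip f)\<^sup>2" for a
    proof -
      have "J h \<le> J (\<lambda>x. h x + a * f x)"
        using Jh m_le[OF add_mem[OF h scale_mem[OF f, of a]]] by linarith
      moreover have "Re (cnj a * ip h f) = Re (a * ip f h)"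
        using ip_cnj[OF f h] by simp
      ultimately show ?thesis
        using hnorm_add_scaled_power2[OF h f, of a] L_add[OF h f, of a]
        by (simp add: J_def c_def algebra_simps)
    qed
    \<comment> \<open>A small step in the direction \<open>cnj c\<close>, in which the linear term of \<open>J\<close> beats the quadratic one.\<close>
    define t where "t = 1 / ((hnorm ip f)\<^sup>2 + 1)"
    have pos: "(hnorm ip f)\<^sup>2 + 1 > 0" by (smt (verit) zero_le_power2)
    then have t: "t > 0" by (simp add: t_def)
    have "2 * Re (of_real t * cnj c * c) = 2 * t * (cmod c)\<^sup>2"
      by (simp add: cmod_power2) (simp add: power2_eq_square algebra_simps)
    moreover have "(cmod (of_real t * cnj c))\<^sup>2 = t\<^sup>2 * (cmod c)\<^sup>2"
      by (simp add: norm_mult power_mult_distrib)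
    ultimately have "2 * t * (cmod c)\<^sup>2 \<le> t\<^sup>2 * (cmod c)\<^sup>2 * (hnorm ip f)\<^sup>2"
      using var[of "of_real t * cnj c"] by simp
    then have "(t * (cmod c)\<^sup>2) * 2 \<le> (t * (cmod c)\<^sup>2) * (t * (hnorm ip f)\<^sup>2)"
      by (simp add: power2_eq_square algebra_simps)
    then have "2 \<le> t * (hnorm ip f)\<^sup>2"
      using t c by (simp add: mult_le_cancel_left_pos)
    also have "\<dots> \<le> 1" using pos by (simp add: t_def)
    finally show False by simp
  qed
  then show ?thesis using h by blast
qed

end

section \<open>Bounded and compact operators, and the essential norm\<close>

context function_hilbert_space begin

abbreviation hdist :: "('x \<Rightarrow> complex) \<Rightarrow> ('x \<Rightarrow> complex) \<Rightarrow> real"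
  where "hdist f g \<equiv> hnorm ip (\<lambda>x. f x - g x)"

lemma hdist_triangle: "f \<in> H \<Longrightarrow> g \<in> H \<Longrightarrow> h \<in> H \<Longrightarrow> hdist f h \<le> hdist f g + hdist g h"
  using hnorm_triangle[of "\<lambda>x. f x - g x" "\<lambda>x. g x - h x"] by (simp add: diff_mem)

lemma Metric_space: "Metric_space H hdist"
proof
  show "hdist f g = 0 \<longleftrightarrow> f = g" if "f \<in> H" "g \<in> H" for f g
    using that by (simp add: hnorm_eq_0 diff_mem fun_eq_iff)
  show "hdist f g = hdist g f" for f g by (rule hnorm_diff_commute)
qed (simp_all add: hnorm_nonneg hdist_triangle)

sublocale M: Metric_space H hdist
  by (rule Metric_space)

lemma mcomplete: M.mcomplete
  unfolding M.mcomplete_def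
proof (intro allI impI)
  fix F assume F: "M.MCauchy F"
  then have mem: "\<And>n. F n \<in> H" by (auto simp: M.MCauchy_def)
  have "\<exists>f\<in>H. (\<lambda>n. hdist (F n) f) \<longlonglongrightarrow> 0"
    using F by (intro complete mem) (auto simp: M.MCauchy_def)
  then obtain f where "f \<in> H" "(\<lambda>n. hdist (F n) f) \<longlonglongrightarrow> 0" by blast
  then have "limitin M.mtopology F f sequentially"
    using mem by (auto simp: M.limit_metric_sequentially LIMSEQ_iff hnorm_nonneg)
  then show "\<exists>f. limitin M.mtopology F f sequentially" by blast
qed

lemma linear_opD:
  assumes "linear_op H T"
  shows linear_op_mem: "f \<in> H \<Longrightarrow> T f \<in> H"
    and linear_op_lin: "f \<in> H \<Longrightarrow> g \<in> H \<Longrightarrow> T (\<lambda>x. a * f x + b * g x) = (\<lambda>x. a * T f x + b * T g x)"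
  using assms by (auto simp: linear_op_def)

lemma linear_op_scale: "linear_op H T \<Longrightarrow> f \<in> H \<Longrightarrow> T (\<lambda>x. a * f x) = (\<lambda>x. a * T f x)"
  using linear_op_lin[of T f f a 0] by simp

lemma linear_op_zero: "linear_op H T \<Longrightarrow> T (\<lambda>x. 0) = (\<lambda>x. 0)"
  using linear_op_scale[of T "\<lambda>_. 0" 0] zero_mem by simp

lemma linear_op_diff: "linear_op H T \<Longrightarrow> f \<in> H \<Longrightarrow> g \<in> H \<Longrightarrow> T (\<lambda>x. f x - g x) = (\<lambda>x. T f x - T g x)"
  using linear_op_lin[of T f g 1 "-1"] by simp

lemma linear_op_sum:
  assumes T: "linear_op H T" and "finite A" and "\<And>k. k \<in> A \<Longrightarrow> v k \<in> H"
  shows "(\<lambda>x. \<Sum>k\<in>A. c k * v k x) \<in> H \<and> T (\<lambda>x. \<Sum>k\<in>A. c k * v k x) = (\<lambda>x. \<Sum>k\<in>A. c k * T (v k) x)"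
  using assms(2,3)
proof (induction rule: finite_induct)
  case empty
  then show ?case using zero_mem linear_op_zero[OF T] by simp
next
  case (insert k A)
  then show ?case
    using lin_mem[of "v k" "\<lambda>x. \<Sum>k\<in>A. c k * v k x" "c k" 1]
      linear_op_lin[OF T, of "v k" "\<lambda>x. \<Sum>k\<in>A. c k * v k x" "c k" 1] by simp
qed

definition bounded_op :: "(('x \<Rightarrow> complex) \<Rightarrow> ('x \<Rightarrow> complex)) \<Rightarrow> bool" where
  "bounded_op T \<longleftrightarrow> linear_op H T \<and> (\<exists>C. \<forall>f\<in>H. hnorm ip (T f) \<le> C * hnorm ip f)"

lemma bounded_op_linear: "bounded_op T \<Longrightarrow> linear_op H T"
  by (simp add: bounded_op_def)

lemma bounded_opE:
  assumes "bounded_op T"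
  obtains C where "C \<ge> 0" "\<And>f. f \<in> H \<Longrightarrow> hnorm ip (T f) \<le> C * hnorm ip f"
proof -
  obtain C where C: "\<And>f. f \<in> H \<Longrightarrow> hnorm ip (T f) \<le> C * hnorm ip f"
    using assms by (auto simp: bounded_op_def)
  have "hnorm ip (T f) \<le> \<bar>C\<bar> * hnorm ip f" if "f \<in> H" for f
    using C[OF that] mult_right_mono[OF abs_ge_self[of C] hnorm_nonneg[of f]] by linarith
  then show thesis using that[of "\<bar>C\<bar>"] by simp
qed

lemma hnorm_normalize:
  assumes f: "f \<in> H" and nz: "hnorm ip f \<noteq> 0"
  shows "hnorm ip (\<lambda>x. of_real (1 / hnorm ip f) * f x) = 1"
  using hnorm_scale[OF f, of "of_real (1 / hnorm ip f)"] nz hnorm_nonneg[of f]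
  by (simp add: norm_divide)

lemma bounded_opI:
  assumes T: "linear_op H T" and bd: "\<And>f. f \<in> H \<Longrightarrow> hnorm ip f \<le> 1 \<Longrightarrow> hnorm ip (T f) \<le> C"
  shows "f \<in> H \<Longrightarrow> hnorm ip (T f) \<le> C * hnorm ip f" "bounded_op T"
proof -
  show *: "hnorm ip (T f) \<le> C * hnorm ip f" if f: "f \<in> H" for f
  proof (cases "hnorm ip f = 0")
    case True
    then show ?thesis using hnorm_eq_0[OF f] linear_op_zero[OF T] hnorm_zero by simp
  next
    case False
    let ?a = "of_real (1 / hnorm ip f)"
    have "hnorm ip (T (\<lambda>x. ?a * f x)) \<le> C"
      using hnorm_normalize[OF f False] by (intro bd scale_mem f) simp
    also have "T (\<lambda>x. ?a * f x) = (\<lambda>x. ?a * T f x)"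
      by (rule linear_op_scale[OF T f])
    also have "hnorm ip \<dots> = hnorm ip (T f) / hnorm ip f"
      using hnorm_scale[OF linear_op_mem[OF T f], of ?a] hnorm_nonneg[of f] by (simp add: norm_divide)
    finally show ?thesis
      using False hnorm_nonneg[of f] by (simp add: pos_divide_le_eq)
  qed
  show "bounded_op T" using * T by (auto simp: bounded_op_def)
qed

lemma hilbert_adjoint:
  assumes T: "bounded_op T" and g: "g \<in> H"
  shows hilbert_adjoint_mem: "hilbert_adjoint H ip T g \<in> H"
    and ip_hilbert_adjoint: "f \<in> H \<Longrightarrow> ip (T f) g = ip f (hilbert_adjoint H ip T g)"
proof -
  note lin = bounded_op_linear[OF T]
  obtain C where C: "\<And>f. f \<in> H \<Longrightarrow> hnorm ip (T f) \<le> C * hnorm ip f"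
    using bounded_opE[OF T] by blast
  have "\<exists>h\<in>H. \<forall>f\<in>H. ip (T f) g = ip f h"
  proof (rule riesz_representation)
    show "ip (T (\<lambda>x. a * f x + b * k x)) g = a * ip (T f) g + b * ip (T k) g" if "f \<in> H" "k \<in> H" for f k a b
      using that by (simp add: linear_op_lin[OF lin] ip_lin linear_op_mem[OF lin] g)
    show "cmod (ip (T f) g) \<le> C * hnorm ip g * hnorm ip f" if f: "f \<in> H" for f
      using cauchy_schwarz[OF linear_op_mem[OF lin f] g] mult_right_mono[OF C[OF f] hnorm_nonneg[of g]]
      by (simp add: mult_ac)
  qed
  then obtain h where h: "h \<in> H" "\<forall>f\<in>H. ip (T f) g = ip f h" by blast
  have "hilbert_adjoint H ip T g = h"
    unfolding hilbert_adjoint_def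
  proof (rule the_equality)
    show "h \<in> H \<and> (\<forall>f\<in>H. ip (T f) g = ip f h)" using h by blast
    show "k = h" if "k \<in> H \<and> (\<forall>f\<in>H. ip (T f) g = ip f k)" for k
      using that h by (intro ip_eqI) auto
  qed
  then show "hilbert_adjoint H ip T g \<in> H" "f \<in> H \<Longrightarrow> ip (T f) g = ip f (hilbert_adjoint H ip T g)"
    using h by auto
qed

lemma hnorm_le_dual:
  assumes x: "x \<in> H" and bd: "\<And>g. g \<in> H \<Longrightarrow> hnorm ip g \<le> 1 \<Longrightarrow> cmod (ip x g) \<le> C"
  shows "hnorm ip x \<le> C"
proof (cases "hnorm ip x = 0")
  case True
  then show ?thesis using bd[OF zero_mem] hnorm_zero by (simp add: order_trans[OF norm_ge_zero])
next
  case False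
  let ?a = "complex_of_real (1 / hnorm ip x)"
  have "cmod (ip x (\<lambda>z. ?a * x z)) \<le> C"
    using hnorm_normalize[OF x False] by (intro bd scale_mem x) simp
  moreover have "ip x (\<lambda>z. ?a * x z) = of_real (hnorm ip x)"
    using False by (simp only: ip_scale_right[OF x x] ip_self[OF x]) (simp add: power2_eq_square)
  ultimately show ?thesis
    by simp
qed

lemma bounded_op_adjoint:
  assumes T: "bounded_op T"
  shows "bounded_op (hilbert_adjoint H ip T)"
proof -
  let ?A = "hilbert_adjoint H ip T"
  note mem = hilbert_adjoint_mem[OF T] and adj = ip_hilbert_adjoint[OF T]
  note Tmem = linear_op_mem[OF bounded_op_linear[OF T]]
  obtain C where C: "C \<ge> 0" "\<And>f. f \<in> H \<Longrightarrow> hnorm ip (T f) \<le> C * hnorm ip f"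
    using bounded_opE[OF T] by blast
  have lin: "linear_op H ?A"
    unfolding linear_op_def
  proof (intro conjI ballI allI image_subsetI)
    show "?A f \<in> H" if "f \<in> H" for f using mem that .
    show "?A (\<lambda>x. a * f x + b * g x) = (\<lambda>x. a * ?A f x + b * ?A g x)" if fg: "f \<in> H" "g \<in> H" for f g a b
    proof (rule ip_eqI)
      fix k assume k: "k \<in> H"
      have "ip k (?A (\<lambda>x. a * f x + b * g x)) = ip (T k) (\<lambda>x. a * f x + b * g x)"
        using adj[OF lin_mem[OF fg] k] by simp
      also have "\<dots> = cnj a * ip (T k) f + cnj b * ip (T k) g"
        using fg Tmem[OF k] by (simp add: ip_simps)
      also have "\<dots> = ip k (\<lambda>x. a * ?A f x + b * ?A g x)"
        using fg k mem adj by (simp add: ip_simps)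
      finally show "ip k (?A (\<lambda>x. a * f x + b * g x)) = ip k (\<lambda>x. a * ?A f x + b * ?A g x)" .
    qed (use fg mem lin_mem in auto)
  qed
  have "hnorm ip (?A g) \<le> C" if g: "g \<in> H" "hnorm ip g \<le> 1" for g
  proof (rule hnorm_le_dual[OF mem[OF g(1)]])
    fix k assume k: "k \<in> H" "hnorm ip k \<le> 1"
    have "cmod (ip (?A g) k) = cmod (ip (T k) g)"
      using ip_cnj[OF k(1) mem[OF g(1)]] adj[OF g(1) k(1)] by simp
    also have "\<dots> \<le> hnorm ip (T k) * hnorm ip g"
      by (intro cauchy_schwarz Tmem k g)
    also have "\<dots> \<le> (C * 1) * 1"
      using C k g by (intro mult_mono order_trans[OF C(2)]) (auto simp: hnorm_nonneg mult_left_le)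
    finally show "cmod (ip (?A g) k) \<le> C" by simp
  qed
  then show ?thesis by (rule bounded_opI(2)[OF lin])
qed

text \<open>In a complete space a set has compact closure iff it is totally bounded, that is, iff each of its
  sequences has a Cauchy subsequence.\<close>

lemma compact_op_iff:
  "compact_op H ip K \<longleftrightarrow> linear_op H K \<and>
     (\<forall>F :: nat \<Rightarrow> 'x \<Rightarrow> complex. (\<forall>n. F n \<in> H \<and> hnorm ip (F n) \<le> 1) \<longrightarrow>
        (\<exists>(r :: nat \<Rightarrow> nat) h. strict_mono r \<and> h \<in> H \<and> (\<lambda>n. hdist (K (F (r n))) h) \<longlonglongrightarrow> 0))"
proof (cases "linear_op H K")
  case lin: True
  let ?S = "K ` {f \<in> H. hnorm ip f \<le> 1}"
  have S: "?S \<subseteq> H" using linear_op_mem[OF lin] by auto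
  have conv: "M.MCauchy G \<longleftrightarrow> (\<exists>h\<in>H. (\<lambda>n. hdist (G n) h) \<longlonglongrightarrow> 0)" if G: "\<And>n. G n \<in> H" for G
  proof
    assume "M.MCauchy G"
    then show "\<exists>h\<in>H. (\<lambda>n. hdist (G n) h) \<longlonglongrightarrow> 0"
      by (intro complete G) (auto simp: M.MCauchy_def)
  next
    assume "\<exists>h\<in>H. (\<lambda>n. hdist (G n) h) \<longlonglongrightarrow> 0"
    then have "\<exists>h. limitin M.mtopology G h sequentially"
      using G by (auto simp: M.limit_metric_sequentially LIMSEQ_iff hnorm_nonneg)
    then show "M.MCauchy G" using M.convergent_imp_MCauchy[of G] G by blast
  qed
  have "compact_op H ip K \<longleftrightarrow> M.mtotally_bounded ?S"
    using lin S M.mtotally_bounded_eq_compact_closure_of[OF mcomplete, of ?S]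
    by (simp add: compact_op_def norm_topology_def)
  also have "\<dots> \<longleftrightarrow> (\<forall>\<sigma> :: nat \<Rightarrow> 'x \<Rightarrow> complex. range \<sigma> \<subseteq> ?S \<longrightarrow> (\<exists>r :: nat \<Rightarrow> nat. strict_mono r \<and> M.MCauchy (\<sigma> \<circ> r)))"
    using S by (simp add: M.mtotally_bounded_sequentially)
  also have "\<dots> \<longleftrightarrow> (\<forall>F :: nat \<Rightarrow> 'x \<Rightarrow> complex. (\<forall>n. F n \<in> H \<and> hnorm ip (F n) \<le> 1) \<longrightarrow>
        (\<exists>r :: nat \<Rightarrow> nat. strict_mono r \<and> M.MCauchy (\<lambda>n. K (F (r n)))))"
  proof safe
    fix F :: "nat \<Rightarrow> ('x \<Rightarrow> complex)"
    assume *: "\<forall>\<sigma> :: nat \<Rightarrow> 'x \<Rightarrow> complex. range \<sigma> \<subseteq> ?S \<longrightarrow> (\<exists>r :: nat \<Rightarrow> nat. strict_mono r \<and> M.MCauchy (\<sigma> \<circ> r))"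
      and F: "\<forall>n. F n \<in> H \<and> hnorm ip (F n) \<le> 1"
    from *[rule_format, of "\<lambda>n. K (F n)"] F
    show "\<exists>r :: nat \<Rightarrow> nat. strict_mono r \<and> M.MCauchy (\<lambda>n. K (F (r n)))" by (auto simp: o_def)
  next
    fix \<sigma> :: "nat \<Rightarrow> ('x \<Rightarrow> complex)"
    assume *: "\<forall>F :: nat \<Rightarrow> 'x \<Rightarrow> complex. (\<forall>n. F n \<in> H \<and> hnorm ip (F n) \<le> 1) \<longrightarrow> (\<exists>r :: nat \<Rightarrow> nat. strict_mono r \<and> M.MCauchy (\<lambda>n. K (F (r n))))"
      and "range \<sigma> \<subseteq> ?S"
    then have "\<forall>n. \<exists>f. f \<in> H \<and> hnorm ip f \<le> 1 \<and> \<sigma> n = K f" by blast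
    then obtain F where "\<forall>n. F n \<in> H \<and> hnorm ip (F n) \<le> 1 \<and> \<sigma> n = K (F n)" by metis
    with * show "\<exists>r :: nat \<Rightarrow> nat. strict_mono r \<and> M.MCauchy (\<sigma> \<circ> r)" by (auto simp: o_def)
  qed
  also have "\<dots> \<longleftrightarrow> (\<forall>F :: nat \<Rightarrow> 'x \<Rightarrow> complex. (\<forall>n. F n \<in> H \<and> hnorm ip (F n) \<le> 1) \<longrightarrow>
        (\<exists>(r :: nat \<Rightarrow> nat) h. strict_mono r \<and> h \<in> H \<and> (\<lambda>n. hdist (K (F (r n))) h) \<longlonglongrightarrow> 0))"
  proof (intro iff_allI imp_cong refl)
    fix F :: "nat \<Rightarrow> ('x \<Rightarrow> complex)"
    assume "\<forall>n. F n \<in> H \<and> hnorm ip (F n) \<le> 1"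
    then have "K (F n) \<in> H" for n using linear_op_mem[OF lin] by simp
    then have "M.MCauchy (\<lambda>n. K (F (r n))) \<longleftrightarrow> (\<exists>h\<in>H. (\<lambda>n. hdist (K (F (r n))) h) \<longlonglongrightarrow> 0)" for r
      by (intro conv)
    then show "(\<exists>r :: nat \<Rightarrow> nat. strict_mono r \<and> M.MCauchy (\<lambda>n. K (F (r n)))) \<longleftrightarrow>
        (\<exists>(r :: nat \<Rightarrow> nat) h. strict_mono r \<and> h \<in> H \<and> (\<lambda>n. hdist (K (F (r n))) h) \<longlonglongrightarrow> 0)"
      by blast
  qed
  finally show ?thesis using lin by simp
qed (simp add: compact_op_def)

lemma compact_op_subseq:
  fixes F :: "nat \<Rightarrow> 'x \<Rightarrow> complex"
  assumes "compact_op H ip K" "\<And>n. F n \<in> H" "\<And>n. hnorm ip (F n) \<le> 1"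
  obtains r :: "nat \<Rightarrow> nat" and h where "strict_mono r" "h \<in> H" "(\<lambda>n. hdist (K (F (r n))) h) \<longlonglongrightarrow> 0"
proof -
  have "\<exists>(r :: nat \<Rightarrow> nat) h. strict_mono r \<and> h \<in> H \<and> (\<lambda>n. hdist (K (F (r n))) h) \<longlonglongrightarrow> 0"
    using assms by (simp add: compact_op_iff)
  then show thesis using that by (elim exE conjE)
qed

lemma compact_op_bounded:
  assumes K: "compact_op H ip K"
  shows "bounded_op K"
proof -
  have lin: "linear_op H K" using K by (simp add: compact_op_def)
  have "\<exists>C. \<forall>f. f \<in> H \<and> hnorm ip f \<le> 1 \<longrightarrow> hnorm ip (K f) \<le> C"
  proof (rule ccontr)
    assume "\<nexists>C. \<forall>f. f \<in> H \<and> hnorm ip f \<le> 1 \<longrightarrow> hnorm ip (K f) \<le> C"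
    then have "\<forall>n. \<exists>f. f \<in> H \<and> hnorm ip f \<le> 1 \<and> hnorm ip (K f) > real n"
      by (meson not_le)
    then obtain F where F: "\<And>n. F n \<in> H" "\<And>n. hnorm ip (F n) \<le> 1" "\<And>n. hnorm ip (K (F n)) > real n"
      by metis
    obtain r h where r: "strict_mono r" and h: "h \<in> H" and lim: "(\<lambda>n. hdist (K (F (r n))) h) \<longlonglongrightarrow> 0"
      by (rule compact_op_subseq[OF K F(1,2)])
    have "\<forall>\<^sub>F n in sequentially. hdist (K (F (r n))) h < 1"
      using order_tendstoD(2)[OF lim, of 1] by simp
    moreover have "\<forall>\<^sub>F n in sequentially. real n > hnorm ip h + 1"
      using filterlim_real_sequentially unfolding filterlim_at_top_dense by blast
    ultimately have "\<forall>\<^sub>F n in sequentially. False"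
    proof eventually_elim
      case (elim n)
      have "real n \<le> real (r n)" using seq_suble[OF r, of n] by simp
      also have "\<dots> < hnorm ip (K (F (r n)))" by (rule F)
      also have "\<dots> \<le> hnorm ip h + hdist (K (F (r n))) h"
        by (rule hnorm_triangle_sub[OF linear_op_mem[OF lin F(1)] h])
      finally show ?case using elim by linarith
    qed
    then show False by simp
  qed
  then show ?thesis using bounded_opI(2)[OF lin] by blast
qed

text \<open>Bounded sequences of coefficients have convergent subsequences; pass to subsequences for one
  coefficient after the other.\<close>

lemma compact_op_finite_rank:
  fixes n :: nat
  assumes lin: "linear_op H K" and v: "\<And>k. k < n \<Longrightarrow> v k \<in> H"
    and rep: "\<And>f. f \<in> H \<Longrightarrow> K f = (\<lambda>x. \<Sum>k<n. c k f * v k x)"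
    and bd: "\<And>k f. k < n \<Longrightarrow> f \<in> H \<Longrightarrow> hnorm ip f \<le> 1 \<Longrightarrow> cmod (c k f) \<le> B k"
  shows "compact_op H ip K"
  unfolding compact_op_iff
proof (intro conjI lin allI impI)
  fix F :: "nat \<Rightarrow> ('x \<Rightarrow> complex)"
  assume F: "\<forall>n. F n \<in> H \<and> hnorm ip (F n) \<le> 1"
  have "\<exists>r :: nat \<Rightarrow> nat. strict_mono r \<and> (\<exists>h\<in>H. (\<lambda>j. hdist (\<lambda>x. \<Sum>k<m. c k (F (r j)) * v k x) h) \<longlonglongrightarrow> 0 \<and>
      (\<forall>j. (\<lambda>x. \<Sum>k<m. c k (F (r j)) * v k x) \<in> H))" if "m \<le> n" for m
    using that
  proof (induction m)
    case 0
    show ?case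
      by (rule exI[of _ "\<lambda>j. j"]) (auto simp: strict_mono_def hnorm_zero zero_mem intro!: bexI[of _ "\<lambda>_. 0"])
  next
    case (Suc m)
    then obtain r h where r: "strict_mono r" and h: "h \<in> H"
      and lim: "(\<lambda>j. hdist (\<lambda>x. \<Sum>k<m. c k (F (r j)) * v k x) h) \<longlonglongrightarrow> 0"
      and mem: "\<And>j. (\<lambda>x. \<Sum>k<m. c k (F (r j)) * v k x) \<in> H"
      by auto
    have vm: "v m \<in> H" using Suc v by simp
    have "bounded (range (\<lambda>j. c m (F (r j))))"
      using bd[of m] F Suc.prems by (auto simp: bounded_iff)
    then obtain l s where s: "strict_mono s" and l: "((\<lambda>j. c m (F (r j))) \<circ> s) \<longlonglongrightarrow> l"
      using bounded_imp_convergent_subsequence by blast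
    let ?S = "\<lambda>j x. \<Sum>k<m. c k (F (r (s j))) * v k x"
    have mem': "(\<lambda>x. ?S j x + a * v m x) \<in> H" for j a
      using lin_mem[OF mem[of "s j"] vm, of 1 a] by simp
    have h': "(\<lambda>x. h x + l * v m x) \<in> H" using lin_mem[OF h vm, of 1 l] by simp
    let ?D = "\<lambda>j. hdist (\<lambda>x. ?S j x + c m (F (r (s j))) * v m x) (\<lambda>x. h x + l * v m x)"
    let ?E = "\<lambda>j. hdist (?S j) h + cmod (c m (F (r (s j))) - l) * hnorm ip (v m)"
    have le: "?D j \<le> ?E j" for j
      using hnorm_triangle[OF diff_mem[OF mem[of "s j"] h] scale_mem[OF vm, of "c m (F (r (s j))) - l"]]
        hnorm_scale[OF vm, of "c m (F (r (s j))) - l"]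
      by (simp add: algebra_simps)
    have "?E \<longlonglongrightarrow> 0 + cmod (l - l) * hnorm ip (v m)"
      using LIMSEQ_subseq_LIMSEQ[OF lim s] l by (intro tendsto_intros) (auto simp: o_def)
    then have E: "?E \<longlonglongrightarrow> 0" by simp
    have "?D \<longlonglongrightarrow> 0"
      by (rule Lim_null_comparison[OF always_eventually E]) (simp add: hnorm_nonneg le)
    then show ?case
      using h' mem'
      by (intro exI[of _ "r \<circ> s"] conjI strict_mono_o[OF r s] bexI[of _ "\<lambda>x. h x + l * v m x"]) simp_all
  qed
  from this[of n] obtain r h where "strict_mono r" "h \<in> H"
    "(\<lambda>j. hdist (\<lambda>x. \<Sum>k<n. c k (F (r j)) * v k x) h) \<longlonglongrightarrow> 0"
    by blast
  moreover have "K (F j) = (\<lambda>x. \<Sum>k<n. c k (F j) * v k x)" for j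
    using F rep by simp
  ultimately show "\<exists>r h. strict_mono r \<and> h \<in> H \<and> (\<lambda>j. hdist (K (F (r j))) h) \<longlonglongrightarrow> 0"
    by auto
qed

lemma compact_op_zero: "compact_op H ip (\<lambda>f x. 0)"
  by (rule compact_op_finite_rank[where n=0 and c="\<lambda>_ _. 0" and v="\<lambda>_ _. 0"]) 
     (auto simp: linear_op_def zero_mem)

lemma bounded_op_diff:
  assumes T: "bounded_op T" and K: "bounded_op K"
  shows "bounded_op (\<lambda>f x. T f x - K f x)"
proof -
  note T' = bounded_op_linear[OF T] and K' = bounded_op_linear[OF K]
  obtain C where C: "\<And>f. f \<in> H \<Longrightarrow> hnorm ip (T f) \<le> C * hnorm ip f" using bounded_opE[OF T] by blast
  obtain D where D: "\<And>f. f \<in> H \<Longrightarrow> hnorm ip (K f) \<le> D * hnorm ip f" using bounded_opE[OF K] by blast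
  have "linear_op H (\<lambda>f x. T f x - K f x)"
    unfolding linear_op_def
    using diff_mem linear_op_mem[OF T'] linear_op_mem[OF K'] 
    by (auto simp: linear_op_lin[OF T'] linear_op_lin[OF K'] algebra_simps)
  moreover have "hnorm ip (\<lambda>x. T f x - K f x) \<le> (C + D) * hnorm ip f" if f: "f \<in> H" for f
    using hnorm_triangle[OF linear_op_mem[OF T' f] scale_mem[OF linear_op_mem[OF K' f], of "-1"]]
      hnorm_uminus[of "K f"] C[OF f] D[OF f] by (simp add: algebra_simps)
  ultimately show ?thesis by (auto simp: bounded_op_def)
qed

lemma bounded_op_compose:
  assumes S: "bounded_op S" and T: "bounded_op T"
  shows "bounded_op (S \<circ> T)"
proof -
  note S' = bounded_op_linear[OF S] and T' = bounded_op_linear[OF T]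
  obtain C where C: "C \<ge> 0" "\<And>f. f \<in> H \<Longrightarrow> hnorm ip (S f) \<le> C * hnorm ip f" using bounded_opE[OF S] by blast
  obtain D where D: "\<And>f. f \<in> H \<Longrightarrow> hnorm ip (T f) \<le> D * hnorm ip f" using bounded_opE[OF T] by blast
  have "linear_op H (S \<circ> T)"
    unfolding linear_op_def using linear_op_mem[OF S'] linear_op_mem[OF T']
    by (auto simp: linear_op_lin[OF S'] linear_op_lin[OF T'])
  moreover have "hnorm ip ((S \<circ> T) f) \<le> (C * D) * hnorm ip f" if f: "f \<in> H" for f
    using order_trans[OF C(2)[OF linear_op_mem[OF T' f]] mult_left_mono[OF D[OF f] C(1)]]
    by (simp add: mult.assoc)
  ultimately show ?thesis unfolding bounded_op_def by blast
qed

lemma hnorm_le_op_norm: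
  assumes T: "bounded_op T" and f: "f \<in> H" "hnorm ip f \<le> 1"
  shows "hnorm ip (T f) \<le> op_norm H ip T"
proof -
  obtain C where C: "C \<ge> 0" "\<And>f. f \<in> H \<Longrightarrow> hnorm ip (T f) \<le> C * hnorm ip f" using bounded_opE[OF T] by blast
  have "hnorm ip (T f) \<le> C" if "f \<in> H" "hnorm ip f \<le> 1" for f
    using C(2)[OF that(1)] mult_left_mono[OF that(2) C(1)] by simp
  then show ?thesis
    unfolding op_norm_def using f by (intro cSUP_upper) (auto simp: bdd_above_def)
qed

lemma op_norm_le:
  assumes "\<And>f. f \<in> H \<Longrightarrow> hnorm ip f \<le> 1 \<Longrightarrow> hnorm ip (T f) \<le> C"
  shows "op_norm H ip T \<le> C"
  unfolding op_norm_def using assms zero_mem hnorm_zero by (intro cSUP_least) auto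

lemma op_norm_nonneg: "bounded_op T \<Longrightarrow> 0 \<le> op_norm H ip T"
  using order_trans[OF hnorm_nonneg hnorm_le_op_norm[of T "\<lambda>_. 0"]] zero_mem hnorm_zero by simp

lemma ess_norm_le:
  assumes T: "bounded_op T" and K: "compact_op H ip K"
    and "\<And>f. f \<in> H \<Longrightarrow> hnorm ip f \<le> 1 \<Longrightarrow> hnorm ip (\<lambda>x. T f x - K f x) \<le> C"
  shows "ess_norm H ip T \<le> C"
proof -
  have "ess_norm H ip T \<le> op_norm H ip (\<lambda>f x. T f x - K f x)"
    unfolding ess_norm_def
    using K op_norm_nonneg[OF bounded_op_diff[OF T compact_op_bounded]]
    by (intro cINF_lower) (auto simp: bdd_below_def)
  also have "\<dots> \<le> C" by (intro op_norm_le assms)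
  finally show ?thesis .
qed

lemma ess_norm_nonneg:
  assumes T: "bounded_op T" shows "0 \<le> ess_norm H ip T"
  unfolding ess_norm_def
  using compact_op_zero op_norm_nonneg[OF bounded_op_diff[OF T compact_op_bounded]]
  by (intro cINF_greatest) auto

text \<open>Along a subsequence \<open>K (f n)\<close> converges in norm to some \<open>h\<close>, so \<open>\<langle>K (f n), g n\<rangle>\<close> behaves like
  \<open>\<langle>h, g n\<rangle>\<close> and tends to 0. Subtracting \<open>K\<close> therefore does not change the limit of \<open>|\<langle>T (f n), g n\<rangle>|\<close>.\<close>

lemma ess_norm_ge:
  assumes T: "bounded_op T"
    and f: "\<And>n. f n \<in> H" and g: "\<And>n. g n \<in> H"
    and f_lim: "(\<lambda>n. hnorm ip (f n)) \<longlonglongrightarrow> a" and a: "a > 0"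
    and g_lim: "(\<lambda>n. hnorm ip (g n)) \<longlonglongrightarrow> b" and b: "b > 0"
    and weak: "\<And>h. h \<in> H \<Longrightarrow> (\<lambda>n. ip h (g n)) \<longlonglongrightarrow> 0"
    and lim: "(\<lambda>n. cmod (ip (T (f n)) (g n))) \<longlonglongrightarrow> l"
  shows "l / (a * b) \<le> ess_norm H ip T"
  unfolding ess_norm_def
proof (rule cINF_greatest)
  show "{K. compact_op H ip K} \<noteq> {}" using compact_op_zero by blast
  fix K assume "K \<in> {K. compact_op H ip K}"
  then have K: "compact_op H ip K" by simp
  let ?D = "\<lambda>f x. T f x - K f x"
  let ?N = "op_norm H ip ?D"
  have bK: "bounded_op K" by (rule compact_op_bounded[OF K])
  have D: "bounded_op ?D" by (rule bounded_op_diff[OF T bK])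
  note mem = linear_op_mem[OF bounded_op_linear[OF T]] linear_op_mem[OF bounded_op_linear[OF bK]] f g
  have Dle: "hnorm ip (?D u) \<le> ?N * hnorm ip u" if "u \<in> H" for u
    by (intro bounded_opI(1)[OF bounded_op_linear[OF D]] hnorm_le_op_norm[OF D] that)
  \<comment> \<open>Compactness speaks of the unit ball, which contains \<open>f n / (a + 1)\<close> for large \<open>n\<close>.\<close>
  define F where "F n = (\<lambda>x. of_real (1 / (a + 1)) * f n x)" for n
  have F: "F n \<in> H" for n unfolding F_def by (intro scale_mem f)
  have KF: "K (F n) = (\<lambda>x. of_real (1 / (a + 1)) * K (f n) x)" for n
    unfolding F_def by (intro linear_op_scale bounded_op_linear[OF bK] f)
  obtain n0 where n0: "\<And>n. n \<ge> n0 \<Longrightarrow> hnorm ip (f n) < a + 1"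
    using order_tendstoD(2)[OF f_lim, of "a + 1"] by (auto simp: eventually_sequentially)
  have "hnorm ip (F (n + n0)) \<le> 1" for n
  proof -
    have "hnorm ip (F (n + n0)) = hnorm ip (f (n + n0)) / (a + 1)"
      unfolding F_def hnorm_scale[OF f] norm_of_real using a by simp
    then show ?thesis using n0[of "n + n0"] a by simp
  qed
  with F obtain r h where r: "strict_mono r" and h: "h \<in> H"
    and K_lim: "(\<lambda>n. hdist (K (F (r n + n0))) h) \<longlonglongrightarrow> 0"
    by (rule compact_op_subseq[OF K, of "\<lambda>n. F (n + n0)"])
  define s where "s n = r n + n0" for n
  have s: "strict_mono s" using r by (simp add: s_def strict_mono_def)
  note sub = LIMSEQ_subseq_LIMSEQ[OF _ s, unfolded o_def]
  have "(\<lambda>n. ip (K (F (s n))) (g (s n))) \<longlonglongrightarrow> 0"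
  proof (rule Lim_null_comparison)
    show "\<forall>\<^sub>F n in sequentially. norm (ip (K (F (s n))) (g (s n))) \<le>
        hdist (K (F (s n))) h * hnorm ip (g (s n)) + cmod (ip h (g (s n)))"
    proof (intro always_eventually allI)
      fix n
      have "ip (K (F (s n))) (g (s n)) = ip (\<lambda>x. K (F (s n)) x - h x) (g (s n)) + ip h (g (s n))"
        using mem F h by (simp add: ip_diff_left)
      then show "norm (ip (K (F (s n))) (g (s n))) \<le> hdist (K (F (s n))) h * hnorm ip (g (s n)) + cmod (ip h (g (s n)))"
        using norm_triangle_ineq[of "ip (\<lambda>x. K (F (s n)) x - h x) (g (s n))" "ip h (g (s n))"]
          cauchy_schwarz[of "\<lambda>x. K (F (s n)) x - h x" "g (s n)"] mem F h by (simp add: diff_mem)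
    qed
    show "(\<lambda>n. hdist (K (F (s n))) h * hnorm ip (g (s n)) + cmod (ip h (g (s n)))) \<longlonglongrightarrow> 0"
      using tendsto_add[OF tendsto_mult[OF K_lim[folded s_def] sub[OF g_lim]] tendsto_norm[OF sub[OF weak[OF h]]]]
      by simp
  qed
  then have "(\<lambda>n. of_real (a + 1) * ip (K (F (s n))) (g (s n))) \<longlonglongrightarrow> 0"
    by (rule tendsto_mult_right_zero)
  moreover have "of_real (a + 1) * ip (K (F (s n))) (g (s n)) = ip (K (f (s n))) (g (s n))" for n
  proof -
    have "of_real (a + 1) * (of_real (1 / (a + 1)) * w) = w" for w :: complex
      using a unfolding mult.assoc[symmetric] of_real_mult[symmetric] by simp
    then show ?thesis unfolding KF using mem by (simp only: ip_scale_left)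
  qed
  ultimately have Kg: "(\<lambda>n. ip (K (f (s n))) (g (s n))) \<longlonglongrightarrow> 0"
    by simp
  have lim1: "(\<lambda>n. cmod (ip (T (f (s n))) (g (s n))) - cmod (ip (K (f (s n))) (g (s n)))) \<longlonglongrightarrow> l - cmod 0"
    by (intro tendsto_intros sub[OF lim] Kg)
  have lim2: "(\<lambda>n. ?N * hnorm ip (f (s n)) * hnorm ip (g (s n))) \<longlonglongrightarrow> ?N * a * b"
    by (intro tendsto_intros sub[OF f_lim] sub[OF g_lim])
  have le: "cmod (ip (T (f n)) (g n)) - cmod (ip (K (f n)) (g n)) \<le> ?N * hnorm ip (f n) * hnorm ip (g n)" for n
  proof -
    have "cmod (ip (T (f n)) (g n)) - cmod (ip (K (f n)) (g n)) \<le> cmod (ip (?D (f n)) (g n))"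
      using mem by (simp add: ip_diff_left norm_triangle_ineq2)
    also have "\<dots> \<le> hnorm ip (?D (f n)) * hnorm ip (g n)"
      by (intro cauchy_schwarz diff_mem mem)
    also have "\<dots> \<le> ?N * hnorm ip (f n) * hnorm ip (g n)"
      by (intro mult_right_mono Dle mem hnorm_nonneg)
    finally show ?thesis .
  qed
  have "l - cmod 0 \<le> ?N * a * b"
    by (rule LIMSEQ_le[OF lim1 lim2]) (use le in blast)
  then show "l / (a * b) \<le> ?N"
    using a b by (simp add: pos_divide_le_eq mult.assoc)
qed

end

section \<open>Holomorphic change of variables\<close>

definition complex_of_vec :: "real ^ 2 \<Rightarrow> complex" where
  "complex_of_vec v = Complex (v $ 1) (v $ 2)"

definition vec_of_complex :: "complex \<Rightarrow> real ^ 2" where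
  "vec_of_complex z = vector [Re z, Im z]"

lemma complex_of_vec_inverse [simp]: "complex_of_vec (vec_of_complex z) = z"
  by (simp add: complex_of_vec_def vec_of_complex_def)

lemma vec_of_complex_inverse [simp]: "vec_of_complex (complex_of_vec v) = v"
  by (simp add: complex_of_vec_def vec_of_complex_def vec_eq_iff forall_2)

lemma bounded_linear_vec_of_complex: "bounded_linear vec_of_complex"
  by (intro linear_conv_bounded_linear[THEN iffD1] linearI)
     (simp_all add: vec_of_complex_def vec_eq_iff forall_2)

lemma bounded_linear_complex_of_vec: "bounded_linear complex_of_vec"
  by (intro linear_conv_bounded_linear[THEN iffD1] linearI)
     (simp_all add: complex_of_vec_def complex_eq_iff)

lemma measurable_complex_of_vec [measurable]: "complex_of_vec \<in> borel_measurable borel"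
  by (intro borel_measurable_continuous_onI linear_continuous_on bounded_linear_complex_of_vec)

lemma lborel_complex_of_vec: "distr lborel borel complex_of_vec = lborel"
proof (rule lborel_eqI[symmetric])
  fix l u :: complex
  assume "\<And>b. b \<in> Basis \<Longrightarrow> l \<bullet> b \<le> u \<bullet> b"
  from this[of 1] this[of \<i>] have le: "Re l \<le> Re u" "Im l \<le> Im u" by (simp_all add: Basis_complex_def)
  have B: "(Basis :: (real ^ 2) set) = {axis 1 1, axis 2 1}"
    by (auto simp: Basis_vec_def) (metis (full_types) exhaust_2)
  have ne: "axis 1 1 \<noteq> (axis 2 1 :: real ^ 2)" by (simp add: axis_eq_axis)
  have "complex_of_vec -` box l u = box (vec_of_complex l) (vec_of_complex u)"
    by (auto simp: box_def Basis_complex_def B inner_axis complex_of_vec_def vec_of_complex_def)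
  then have "emeasure (distr lborel borel complex_of_vec) (box l u) =
      emeasure lborel (box (vec_of_complex l) (vec_of_complex u))"
    by (simp add: emeasure_distr)
  also have "\<dots> = ennreal (\<Prod>b\<in>Basis. (vec_of_complex u - vec_of_complex l) \<bullet> b)"
    using le by (intro emeasure_lborel_box) (auto simp: B inner_axis vec_of_complex_def)
  also have "(\<Prod>b\<in>Basis. (vec_of_complex u - vec_of_complex l) \<bullet> b) = (\<Prod>b\<in>Basis. (u - l) \<bullet> b)"
    using ne by (simp add: B Basis_complex_def inner_axis vec_of_complex_def)
  finally show "emeasure (distr lborel borel complex_of_vec) (box l u) = ennreal (\<Prod>b\<in>Basis. (u - l) \<bullet> b)" .
qed simp

text \<open>The isometry between the complex numbers and \<open>real ^ 2\<close> preserves Lebesgue measure, so integrals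
  over the plane become integrals over vectors, where the change of variables theorem is stated.\<close>

lemma complex_set_integral_transfer:
  fixes F :: "complex \<Rightarrow> real"
  assumes A: "A \<in> sets borel" and F: "set_borel_measurable borel A F"
  shows "set_integrable lborel A F \<longleftrightarrow> (\<lambda>v. F (complex_of_vec v)) absolutely_integrable_on (vec_of_complex ` A)"
    and "set_integrable lborel A F \<Longrightarrow>
      set_lebesgue_integral lborel A F = integral (vec_of_complex ` A) (\<lambda>v. F (complex_of_vec v))"
proof -
  let ?G = "\<lambda>z. indicator A z *\<^sub>R F z"
  have G: "?G \<in> borel_measurable borel" using F by (simp add: set_borel_measurable_def)
  have mU: "complex_of_vec \<in> lborel \<rightarrow>\<^sub>M borel" by simp
  have ind: "indicator (vec_of_complex ` A) v *\<^sub>R F (complex_of_vec v) = ?G (complex_of_vec v)" for v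
    using image_iff[of v vec_of_complex A] vec_of_complex_inverse[of v] complex_of_vec_inverse
    by (cases "complex_of_vec v \<in> A") (force simp: indicator_def)+
  have GU: "(\<lambda>v. ?G (complex_of_vec v)) \<in> borel_measurable lborel"
    using measurable_compose[OF measurable_complex_of_vec G] by simp
  have dist: "integrable lborel ?G \<longleftrightarrow> integrable lborel (\<lambda>v. ?G (complex_of_vec v))"
      "integral\<^sup>L lborel ?G = (LINT v|lborel. ?G (complex_of_vec v))"
    by (rule integrable_distr_eq[OF mU G, unfolded lborel_complex_of_vec]
          integral_distr[OF mU G, unfolded lborel_complex_of_vec])+
  have int: "set_integrable lborel A F \<longleftrightarrow> integrable lborel (\<lambda>v. ?G (complex_of_vec v))"
    unfolding set_integrable_def by (rule dist)
  then show *: "set_integrable lborel A F \<longleftrightarrow> (\<lambda>v. F (complex_of_vec v)) absolutely_integrable_on (vec_of_complex ` A)"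
    unfolding set_integrable_def[of lebesgue] ind using integrable_completion[OF GU] by simp
  assume I: "set_integrable lborel A F"
  have "set_lebesgue_integral lborel A F = (LINT v|lborel. ?G (complex_of_vec v))"
    unfolding set_lebesgue_integral_def by (rule dist)
  also have "\<dots> = (LINT v : (vec_of_complex ` A) | lebesgue. F (complex_of_vec v))"
    unfolding set_lebesgue_integral_def ind by (rule integral_completion[OF GU, symmetric])
  also have "\<dots> = integral (vec_of_complex ` A) (\<lambda>v. F (complex_of_vec v))"
    using I * by (intro set_lebesgue_integral_eq_integral) simp
  finally show "set_lebesgue_integral lborel A F = integral (vec_of_complex ` A) (\<lambda>v. F (complex_of_vec v))" .
qed

text \<open>The real Jacobian matrix of \<open>g\<close> is multiplication by \<open>g'\<close>, whose determinant is \<open>|g'|\<^sup>2\<close>.\<close>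

lemma holomorphic_change_of_variables:
  fixes F :: "complex \<Rightarrow> real"
  assumes S: "open S" and g: "g holomorphic_on S" and inj: "inj_on g S"
    and F: "set_borel_measurable borel (g ` S) F"
    and int: "set_integrable lborel (g ` S) F"
  shows "set_integrable lborel S (\<lambda>z. (cmod (deriv g z))\<^sup>2 * F (g z))"
    and "(LINT z:S|lborel. (cmod (deriv g z))\<^sup>2 * F (g z)) = (LINT w:g ` S|lborel. F w)"
proof -
  have gS: "open (g ` S)" by (rule open_mapping_thm3[OF g S inj])
  have gm: "set_borel_measurable borel S g"
    using holomorphic_on_imp_continuous_on[OF g] S by (intro borel_measurable_continuous_on_indicator[folded set_borel_measurable_def]) auto
  have dm: "set_borel_measurable borel S (deriv g)"
    using holomorphic_on_imp_continuous_on[OF holomorphic_deriv[OF g S]] S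
    by (intro borel_measurable_continuous_on_indicator[folded set_borel_measurable_def]) auto
  have "(\<lambda>z. indicator S z *\<^sub>R ((cmod (deriv g z))\<^sup>2 * F (g z))) \<in> borel_measurable borel"
  proof -
    define H where "H w = indicator (g ` S) w *\<^sub>R F w" for w
    define G where "G z = indicator S z *\<^sub>R g z" for z
    define D where "D z = indicator S z *\<^sub>R deriv g z" for z
    have [measurable]: "H \<in> borel_measurable borel" "G \<in> borel_measurable borel" "D \<in> borel_measurable borel"
      using F gm dm by (simp_all add: set_borel_measurable_def H_def[abs_def] G_def[abs_def] D_def[abs_def])
    have "(\<lambda>z. (cmod (D z))\<^sup>2 * H (G z)) \<in> borel_measurable borel"
      by measurable
    also have "(\<lambda>z. (cmod (D z))\<^sup>2 * H (G z)) = (\<lambda>z. indicator S z *\<^sub>R ((cmod (deriv g z))\<^sup>2 * F (g z)))"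
      by (rule ext) (auto simp: indicator_def D_def G_def H_def)
    finally show ?thesis .
  qed
  then have DF: "set_borel_measurable borel S (\<lambda>z. (cmod (deriv g z))\<^sup>2 * F (g z))"
    by (simp add: set_borel_measurable_def)
  let ?T = vec_of_complex and ?U = complex_of_vec
  let ?g = "\<lambda>v. ?T (g (?U v))" and ?g' = "\<lambda>v w. ?T (deriv g (?U v) * ?U w)"
  let ?f = "\<lambda>v. vec (F (?U v)) :: real ^ 1"
  have im: "?g ` (?T ` S) = ?T ` g ` S" by (auto simp: image_image)
  have det: "\<bar>det (matrix (?g' v))\<bar> = (cmod (deriv g (?U v)))\<^sup>2" for v
  proof -
    have "det (matrix (?g' v)) = (Re (deriv g (?U v)))\<^sup>2 + (Im (deriv g (?U v)))\<^sup>2"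
      by (simp add: det_2 matrix_def vec_of_complex_def complex_of_vec_def axis_def power2_eq_square)
    then show ?thesis by (simp add: cmod_power2)
  qed
  have "open (?T ` S)"
  proof -
    have "v \<in> ?T ` S" if "?U v \<in> S" for v using imageI[OF that, of ?T] by simp
    then have "?T ` S = ?U -` S" by auto
    moreover have "open (?U -` S)"
      by (rule continuous_open_vimage[OF S]) (rule linear_continuous_at[OF bounded_linear_complex_of_vec])
    ultimately show ?thesis by simp
  qed
  then have TS: "?T ` S \<in> sets lebesgue" by auto
  have der: "(?g has_derivative ?g' v) (at v within ?T ` S)" if "v \<in> ?T ` S" for v
  proof -
    have Uv: "?U v \<in> S" using that by auto
    have "(g has_derivative (*) (deriv g (?U v))) (at (?U v))"
      using holomorphic_derivI[OF g S Uv] by (simp add: has_field_derivative_def)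
    then have "((\<lambda>v. g (?U v)) has_derivative (\<lambda>w. deriv g (?U v) * ?U w)) (at v)"
      by (rule has_derivative_compose[OF bounded_linear_imp_has_derivative[OF bounded_linear_complex_of_vec]])
    then have "(?g has_derivative ?g' v) (at v)"
      by (rule bounded_linear.has_derivative[OF bounded_linear_vec_of_complex])
    then show ?thesis by (rule has_derivative_at_withinI)
  qed
  have injT: "inj_on ?g (?T ` S)"
  proof (rule inj_onI)
    fix v w assume vw: "v \<in> ?T ` S" "w \<in> ?T ` S" and "?g v = ?g w"
    then have "?U (?g v) = ?U (?g w)" by (simp only:)
    then have "g (?U v) = g (?U w)" by simp
    then have "?U v = ?U w" using vw inj by (auto dest: inj_onD)
    then have "?T (?U v) = ?T (?U w)" by (simp only:)
    then show "v = w" by simp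
  qed
  have cv: "(\<lambda>v. (cmod (deriv g (?U v)))\<^sup>2 * F (g (?U v))) absolutely_integrable_on (?T ` S) \<and>
      integral (?T ` S) (\<lambda>v. (cmod (deriv g (?U v)))\<^sup>2 * F (g (?U v))) = b \<longleftrightarrow>
      (\<lambda>v. F (?U v)) absolutely_integrable_on (?T ` g ` S) \<and> integral (?T ` g ` S) (\<lambda>v. F (?U v)) = b" for b
    using has_absolute_integral_change_of_variables[OF TS der injT, of ?f "vec b"]
    by (simp add: im det absolutely_integrable_on_1_iff integral_on_1_eq)
  note tr = complex_set_integral_transfer[OF borel_open[OF gS] F]
    complex_set_integral_transfer[OF borel_open[OF S] DF]
  show "set_integrable lborel S (\<lambda>z. (cmod (deriv g z))\<^sup>2 * F (g z))"
    "(LINT z:S|lborel. (cmod (deriv g z))\<^sup>2 * F (g z)) = (LINT w:g ` S|lborel. F w)"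
    using int cv tr by auto
qed

lemma lborel_complex_affine:
  assumes c: "c \<noteq> (0::complex)"
  shows "lborel = density (distr lborel borel (\<lambda>z. a + c * z)) (\<lambda>_. ennreal ((cmod c)\<^sup>2))"
proof (rule lborel_eqI)
  fix l u :: complex
  assume le: "\<And>b. b \<in> Basis \<Longrightarrow> l \<bullet> b \<le> u \<bullet> b"
  let ?g = "\<lambda>z. a + c * z" and ?S = "(\<lambda>z. a + c * z) -` box l u"
  have S: "open ?S" by (intro continuous_open_vimage) (auto intro: continuous_intros)
  have im: "?g ` ?S = box l u"
  proof -
    have "w \<in> ?g ` ?S" if "w \<in> box l u" for w
      using c that by (intro image_eqI[of _ _ "(w - a) / c"]) simp_all
    then show ?thesis by auto
  qed
  have fin: "emeasure lborel (box l u) < \<infinity>" by (simp add: emeasure_lborel_box_eq)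
  have m: "?g \<in> borel_measurable borel" by measurable
  have d: "deriv ?g z = c" for z by (rule DERIV_imp_deriv) (auto intro!: derivative_eq_intros)
  have h: "set_borel_measurable borel (?g ` ?S) (\<lambda>_. 1::real)" "set_integrable lborel (?g ` ?S) (\<lambda>_. 1::real)"
    using fin unfolding im
    by (auto simp: set_borel_measurable_def set_integrable_def intro!: borel_measurable_scaleR borel_measurable_indicator)
  have inj: "inj_on ?g ?S" using c by (auto simp: inj_on_def)
  note cv = holomorphic_change_of_variables[OF S _ inj h]
  have "integrable lborel (\<lambda>z. indicator ?S z *\<^sub>R (cmod c)\<^sup>2)"
    using cv(1) by (simp add: set_integrable_def d holomorphic_intros)
  then have "integrable lborel (\<lambda>z. (1 / (cmod c)\<^sup>2) *\<^sub>R (indicator ?S z *\<^sub>R (cmod c)\<^sup>2))"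
    by (rule integrable_scaleR_right)
  then have "integrable lborel (indicator ?S :: complex \<Rightarrow> real)"
    using c by simp
  then have finS: "emeasure lborel ?S < \<infinity>"
    using S by (simp add: integrable_indicator_iff)
  have "measure lborel ?S * (cmod c)\<^sup>2 = measure lborel (box l u)"
    using cv(2) unfolding im by (simp add: set_lebesgue_integral_def d holomorphic_intros)
  then have eq: "emeasure lborel ?S * ennreal ((cmod c)\<^sup>2) = emeasure lborel (box l u)"
    using finS fin by (simp add: emeasure_eq_ennreal_measure less_top flip: ennreal_mult'')
  have "emeasure (density (distr lborel borel ?g) (\<lambda>_. ennreal ((cmod c)\<^sup>2))) (box l u)
      = emeasure lborel ?S * ennreal ((cmod c)\<^sup>2)"
    using m by (simp add: emeasure_density nn_integral_cmult_indicator emeasure_distr) (simp add: mult.commute)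
  also have "\<dots> = ennreal (\<Prod>b\<in>Basis. (u - l) \<bullet> b)"
    unfolding eq using le by (rule emeasure_lborel_box)
  finally show "emeasure (density (distr lborel borel ?g) (\<lambda>_. ennreal ((cmod c)\<^sup>2))) (box l u)
      = ennreal (\<Prod>b\<in>Basis. (u - l) \<bullet> b)" .
qed simp

lemma lborel_integral_complex_affine:
  fixes f :: "complex \<Rightarrow> 'b::{banach, second_countable_topology}"
  assumes c: "c \<noteq> (0::complex)" and f: "f \<in> borel_measurable borel"
  shows "integral\<^sup>L lborel f = (cmod c)\<^sup>2 *\<^sub>R (LINT z|lborel. f (a + c * z))"
    and "integrable lborel f \<longleftrightarrow> integrable lborel (\<lambda>z. f (a + c * z))"
proof -
  let ?g = "\<lambda>z. a + c * z"
  have m: "?g \<in> lborel \<rightarrow>\<^sub>M borel" by simp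
  have fd: "f \<in> borel_measurable (distr lborel borel ?g)" using f by simp
  have "integral\<^sup>L lborel f = (LINT z|distr lborel borel ?g. (cmod c)\<^sup>2 *\<^sub>R f z)"
    by (subst lborel_complex_affine[OF c, of a]) (rule integral_density[OF fd], auto)
  also have "\<dots> = (LINT z|lborel. (cmod c)\<^sup>2 *\<^sub>R f (?g z))"
    using f by (subst integral_distr[OF m]) auto
  finally show "integral\<^sup>L lborel f = (cmod c)\<^sup>2 *\<^sub>R (LINT z|lborel. f (a + c * z))" by simp
  have "integrable lborel f \<longleftrightarrow> integrable (distr lborel borel ?g) (\<lambda>z. (cmod c)\<^sup>2 *\<^sub>R f z)"
    by (subst lborel_complex_affine[OF c, of a]) (rule integrable_density[OF fd], auto)
  also have "\<dots> \<longleftrightarrow> integrable lborel (\<lambda>z. (cmod c)\<^sup>2 *\<^sub>R f (?g z))"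
    using f by (subst integrable_distr_eq[OF m]) auto
  also have "\<dots> \<longleftrightarrow> integrable lborel (\<lambda>z. f (?g z))"
    using c integrable_scaleR_right[of "(cmod c)\<^sup>2" lborel "\<lambda>z. f (?g z)"]
      integrable_scaleR_right[of "1 / (cmod c)\<^sup>2" lborel "\<lambda>z. (cmod c)\<^sup>2 *\<^sub>R f (?g z)"] by auto
  finally show "integrable lborel f \<longleftrightarrow> integrable lborel (\<lambda>z. f (a + c * z))" .
qed

section \<open>The weighted area measure\<close>

text \<open>The density of \<open>weighted_area \<alpha>\<close> with respect to Lebesgue measure on the whole plane; being 0 outside the
  disk, it makes the values of the other factors of an integrand irrelevant there.\<close>

definition area_weight :: "real \<Rightarrow> complex \<Rightarrow> real" where
  "area_weight \<alpha> z = indicator (ball 0 1) z * ((1 + \<alpha>) / pi * (1 - (cmod z)\<^sup>2) powr \<alpha>)"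

lemma measurable_area_weight [measurable]: "area_weight \<alpha> \<in> borel_measurable borel"
  unfolding area_weight_def[abs_def]
  by (intro borel_measurable_times borel_measurable_indicator borel_measurable_const powr_real_measurable
        borel_measurable_diff borel_measurable_power borel_measurable_norm) auto

lemma area_weight_nonneg: "-1 < \<alpha> \<Longrightarrow> 0 \<le> area_weight \<alpha> z"
  by (simp add: area_weight_def)

lemma area_weight_inside:
  "cmod z < 1 \<Longrightarrow> area_weight \<alpha> z = (1 + \<alpha>) / pi * (1 - (cmod z)\<^sup>2) powr \<alpha>"
  by (simp add: area_weight_def)

lemma area_weight_outside: "\<not> cmod z < 1 \<Longrightarrow> area_weight \<alpha> z = 0"
  by (simp add: area_weight_def)

lemma area_weight_le: "0 \<le> \<alpha> \<Longrightarrow> area_weight \<alpha> z \<le> (1 + \<alpha>) / pi"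
proof (cases "cmod z < 1")
  case True
  assume \<alpha>: "0 \<le> \<alpha>"
  have "(1 - (cmod z)\<^sup>2) powr \<alpha> \<le> 1"
    using True \<alpha> abs_square_less_1[of "cmod z"] by (intro powr_le1) auto
  then have "(1 + \<alpha>) / pi * (1 - (cmod z)\<^sup>2) powr \<alpha> \<le> (1 + \<alpha>) / pi * 1"
    using \<alpha> by (intro mult_left_mono) auto
  then show ?thesis using True by (simp add: area_weight_inside)
qed (simp add: area_weight_outside)

lemma scale_measure_conv_density: "scale_measure r M = density M (\<lambda>_. r)"
  by (rule measure_eqI) (simp_all add: emeasure_density nn_integral_cmult_indicator)

lemma weighted_area_integral:
  fixes f :: "complex \<Rightarrow> 'b::{banach, second_countable_topology}"
  assumes \<alpha>: "-1 < \<alpha>" and f: "continuous_on (ball 0 1) f"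
  shows integrable_weighted_area: "integrable (weighted_area \<alpha>) f \<longleftrightarrow> integrable lborel (\<lambda>z. area_weight \<alpha> z *\<^sub>R f z)"
    and integral_weighted_area: "integral\<^sup>L (weighted_area \<alpha>) f = (LINT z|lborel. area_weight \<alpha> z *\<^sub>R f z)"
    and borel_measurable_area_weight: "(\<lambda>z. area_weight \<alpha> z *\<^sub>R f z) \<in> borel_measurable borel"
proof -
  let ?R = "restrict_space lborel (ball (0::complex) 1)"
  define w where "w z = (1 + \<alpha>) / pi * (1 - (cmod z)\<^sup>2) powr \<alpha>" for z
  have sets: "sets ?R = sets (restrict_space borel (ball 0 1))"
    by (simp add: sets_restrict_space)
  have w[measurable]: "w \<in> borel_measurable ?R"
    unfolding w_def[abs_def] by (intro measurable_restrict_space1) measurable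
  have wnn: "0 \<le> w z" for z using \<alpha> by (simp add: w_def)
  have fm: "f \<in> borel_measurable ?R"
    using borel_measurable_continuous_on_restrict[OF f] by (simp add: measurable_cong_sets[OF sets refl])
  have eq: "weighted_area \<alpha> = density ?R w"
  proof -
    have "weighted_area \<alpha> = density ?R (\<lambda>z. ennreal (1 / pi) * ennreal ((1 + \<alpha>) * (1 - (cmod z)\<^sup>2) powr \<alpha>))"
      unfolding weighted_area_def area_measure_def scale_measure_conv_density
      by (rule density_density_eq) (auto intro!: measurable_restrict_space1)
    also have "(\<lambda>z. ennreal (1 / pi) * ennreal ((1 + \<alpha>) * (1 - (cmod z)\<^sup>2) powr \<alpha>)) = (\<lambda>z. ennreal (w z))"
      using \<alpha> by (simp add: w_def flip: ennreal_mult)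
    finally show ?thesis .
  qed
  have aw: "indicator (ball 0 1) z *\<^sub>R (w z *\<^sub>R f z) = area_weight \<alpha> z *\<^sub>R f z" for z
    by (simp add: area_weight_def w_def)
  have B: "ball (0::complex) 1 \<inter> space lborel \<in> sets lborel" by simp
  show "integrable (weighted_area \<alpha>) f \<longleftrightarrow> integrable lborel (\<lambda>z. area_weight \<alpha> z *\<^sub>R f z)"
    unfolding eq integrable_density[OF fm w AE_I2[OF wnn]] integrable_restrict_space[OF B] aw ..
  show "integral\<^sup>L (weighted_area \<alpha>) f = (LINT z|lborel. area_weight \<alpha> z *\<^sub>R f z)"
    unfolding eq integral_density[OF fm w AE_I2[OF wnn]] integral_restrict_space[OF B] aw ..
  have "(\<lambda>z. w z *\<^sub>R f z) \<in> borel_measurable ?R" using fm by measurable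
  then show "(\<lambda>z. area_weight \<alpha> z *\<^sub>R f z) \<in> borel_measurable borel"
    unfolding borel_measurable_restrict_space_iff[OF B] aw by simp
qed

text \<open>The rotation by the angle \<open>\<pi> / k\<close> preserves the measure and changes the sign of \<open>z ^ k\<close>.\<close>

lemma radial_integral_monomial_eq_0:
  fixes \<rho> :: "real \<Rightarrow> real"
  assumes k: "k > 0" and \<rho>[measurable]: "\<rho> \<in> borel_measurable borel"
  shows "(LINT z|lborel. \<rho> (cmod z) *\<^sub>R z ^ k) = 0"
proof -
  let ?c = "cis (pi / real k)"
  have "?c ^ k = -1" using k by (simp only: Complex.DeMoivre) (simp add: cis_pi)
  then have "\<rho> (cmod (0 + ?c * z)) *\<^sub>R (0 + ?c * z) ^ k = - (\<rho> (cmod z) *\<^sub>R z ^ k)" for z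
    by (simp add: norm_mult power_mult_distrib)
  then have "(LINT z|lborel. \<rho> (cmod z) *\<^sub>R z ^ k) = - (LINT z|lborel. \<rho> (cmod z) *\<^sub>R z ^ k)"
    by (subst lborel_integral_complex_affine(1)[of ?c _ 0]) (simp_all del: scaleR_conv_of_real)
  then show ?thesis by simp
qed

text \<open>Integrate the power series of \<open>h\<close> term by term; it converges absolutely and uniformly on
  the support of the radial factor. Applied to \<open>h - h 0\<close> with a constant factor this is the mean value property over disks, and with
  weights \<open>|z|\<^sup>2\<^sup>j w(z)\<close> it gives the orthogonality of monomials to functions that vanish to higher order at 0.\<close>

lemma radial_integral_holomorphic:
  fixes \<rho> :: "real \<Rightarrow> real"
  assumes h: "h holomorphic_on ball 0 1" and h0: "h 0 = 0" and r: "r < 1"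
    and \<rho>[measurable]: "\<rho> \<in> borel_measurable borel" and bd: "\<And>t. \<bar>\<rho> t\<bar> \<le> B" and supp: "\<And>t. t \<ge> r \<Longrightarrow> \<rho> t = 0"
  shows "integrable lborel (\<lambda>z. \<rho> (cmod z) *\<^sub>R h z)" "(LINT z|lborel. \<rho> (cmod z) *\<^sub>R h z) = 0"
proof -
  define s where "s = max 0 r"
  have s: "0 \<le> s" "s < 1" "r \<le> s" using r by (auto simp: s_def)
  define a where "a n = (deriv ^^ n) h 0 / fact n" for n
  have sums: "(\<lambda>n. a n * z ^ n) sums h z" if "cmod z < 1" for z
    using holomorphic_power_series[OF h, of z] that by (simp add: a_def)
  \<comment> \<open>A point strictly between the support of \<open>\<rho>\<close> and the circle.\<close>
  define t where "t = (s + 1) / 2"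
  have t: "s < t" "t < 1" using s by (auto simp: t_def)
  have summ: "summable (\<lambda>n. norm (a n) * s ^ n)"
  proof -
    have "summable (\<lambda>n. norm (a n * of_real s ^ n))"
      using sums_summable[OF sums, of "of_real t"] t s
      by (intro powser_insidea[of a "of_real t"]) auto
    then show ?thesis using s by (simp add: norm_mult norm_power)
  qed
  let ?f = "\<lambda>n z. \<rho> (cmod z) *\<^sub>R (a n * z ^ n)"
  have B: "0 \<le> B" using bd[of 0] by linarith
  have fle: "norm (?f n z) \<le> (B * (norm (a n) * s ^ n)) * indicator (ball 0 1) z" for n z
  proof (cases "cmod z < r")
    case True
    then have "cmod z ^ n \<le> s ^ n" using s by (intro power_mono) auto
    then show ?thesis using True bd[of "cmod z"] r B s
      by (auto simp: norm_mult norm_power intro!: mult_mono)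
  next
    case False
    then show ?thesis using supp B s by (simp add: indicator_def)
  qed
  have ind: "integrable lborel (\<lambda>z. C * indicator (ball (0::complex) 1) z)" for C :: real
    using emeasure_lborel_ball_finite[of "0::complex" 1]
    by (intro integrable_mult_right) (simp add: integrable_indicator_iff)
  have int: "integrable lborel (?f n)" for n
    by (rule Bochner_Integration.integrable_bound[OF ind[of "B * (norm (a n) * s ^ n)"]])
       (auto intro!: AE_I2 order_trans[OF fle abs_ge_self] simp del: norm_scaleR simp add: real_norm_def)
  have fsum: "(\<Sum>n. ?f n z) = \<rho> (cmod z) *\<^sub>R h z \<and> summable (\<lambda>n. norm (?f n z))" for z
  proof (cases "cmod z < r")
    case True
    have "summable (\<lambda>n. norm (?f n z))"
      by (rule summable_comparison_test'[OF summable_mult[OF summ, of B], of 0])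
         (use fle[where z = z] s True in \<open>auto simp: indicator_def\<close>)
    moreover have "(\<lambda>n. ?f n z) sums (\<rho> (cmod z) *\<^sub>R h z)"
      using sums[of z] True r by (intro sums_scaleR_right) auto
    ultimately show ?thesis by (auto simp: sums_iff)
  next
    case False
    then show ?thesis using supp by simp
  qed
  have summ_int: "summable (\<lambda>n. LINT z|lborel. norm (?f n z))"
  proof (rule summable_comparison_test'[of "\<lambda>n. (B * measure lborel (ball (0::complex) 1)) * (norm (a n) * s ^ n)" 0])
    show "summable (\<lambda>n. (B * measure lborel (ball (0::complex) 1)) * (norm (a n) * s ^ n))"
      by (intro summable_mult summ)
    fix n
    have "(LINT z|lborel. norm (?f n z)) \<le> (LINT z|lborel. (B * (norm (a n) * s ^ n)) * indicator (ball (0::complex) 1) z)"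
      by (intro integral_mono integrable_norm int ind fle)
    then show "norm (LINT z|lborel. norm (?f n z)) \<le> (B * measure lborel (ball (0::complex) 1)) * (norm (a n) * s ^ n)"
      by (simp add: mult_ac)
  qed
  have "(\<lambda>n. integral\<^sup>L lborel (?f n)) sums (LINT z|lborel. (\<Sum>n. ?f n z))"
    by (rule sums_integral[OF int _ summ_int]) (use fsum in auto)
  moreover have "integral\<^sup>L lborel (?f n) = 0" for n
  proof (cases "n = 0")
    case True
    then show ?thesis by (simp add: a_def h0)
  next
    case False
    have "integral\<^sup>L lborel (?f n) = a n * (LINT z|lborel. \<rho> (cmod z) *\<^sub>R z ^ n)"
      by (subst integral_mult_right_zero[symmetric]) (simp add: scaleR_conv_of_real mult_ac)
    then show ?thesis using radial_integral_monomial_eq_0[of n \<rho>] False by simp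
  qed
  ultimately show "(LINT z|lborel. \<rho> (cmod z) *\<^sub>R h z) = 0"
    using fsum sums_unique2[of "\<lambda>_. 0"] by (auto simp: sums_iff)
  have "integrable lborel (\<lambda>z. \<Sum>n. ?f n z)"
    by (rule integrable_suminf[OF int _ summ_int]) (use fsum in auto)
  then show "integrable lborel (\<lambda>z. \<rho> (cmod z) *\<^sub>R h z)" using fsum by simp
qed

lemma holomorphic_mean_value_bound:
  assumes g: "g holomorphic_on ball 0 1"
  shows "integrable lborel (\<lambda>z. indicator (ball 0 (1/2)) z *\<^sub>R g z)"
    and "cmod (g 0) * (pi / 4) \<le> (LINT z|lborel. indicator (ball 0 (1/2)) z * cmod (g z))"
proof -
  define \<rho> :: "real \<Rightarrow> real" where "\<rho> t = indicator {..<1/2} t" for t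
  have \<rho>: "\<rho> \<in> borel_measurable borel" unfolding \<rho>_def[abs_def] by measurable
  have ind: "\<rho> (cmod z) = indicator (ball 0 (1/2)) z" for z by (simp add: \<rho>_def indicator_def)
  have vol: "measure lborel (ball (0::complex) (1/2)) = pi / 4"
    using content_ball[of "1/2" "0::complex"] by (simp add: unit_ball_vol_2 power2_eq_square)
  have "(\<lambda>z. g z - g 0) holomorphic_on ball 0 1" by (intro holomorphic_intros g)
  from radial_integral_holomorphic[OF this _ _ \<rho>, of "1/2" 1]
  have I: "integrable lborel (\<lambda>z. indicator (ball 0 (1/2)) z *\<^sub>R (g z - g 0))"
    and Z: "(LINT z|lborel. indicator (ball 0 (1/2)) z *\<^sub>R (g z - g 0)) = 0"
    by (auto simp: ind) (auto simp: \<rho>_def)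
  have C: "integrable lborel (\<lambda>z. indicator (ball (0::complex) (1/2)) z *\<^sub>R g 0)"
    using emeasure_lborel_ball_finite[of "0::complex" "1/2"]
    by (intro integrable_scaleR_left) (simp add: integrable_indicator_iff)
  show int: "integrable lborel (\<lambda>z. indicator (ball 0 (1/2)) z *\<^sub>R g z)"
    using Bochner_Integration.integrable_add[OF I C] by (simp add: algebra_simps)
  have "(LINT z|lborel. indicator (ball 0 (1/2)) z *\<^sub>R g z) = (LINT z|lborel. indicator (ball (0::complex) (1/2)) z *\<^sub>R g 0)"
    using Bochner_Integration.integral_diff[OF int C] Z by (simp add: algebra_simps)
  also have "\<dots> = (LINT z|lborel. indicator (ball (0::complex) (1/2)) z) *\<^sub>R g 0"
    using emeasure_lborel_ball_finite[of "0::complex" "1/2"]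
    by (intro integral_scaleR_left) (simp add: integrable_indicator_iff)
  also have "\<dots> = (pi / 4) *\<^sub>R g 0" using vol by simp
  finally have "cmod ((pi / 4) *\<^sub>R g 0) \<le> (LINT z|lborel. norm (indicator (ball 0 (1/2)) z *\<^sub>R g z))"
    by (metis integral_norm_bound)
  then show "cmod (g 0) * (pi / 4) \<le> (LINT z|lborel. indicator (ball 0 (1/2)) z * cmod (g z))"
    by (simp add: mult.commute)
qed

section \<open>The weighted Dirichlet space is a Hilbert space\<close>

abbreviation dnorm :: "real \<Rightarrow> (complex \<Rightarrow> complex) \<Rightarrow> real" where
  "dnorm \<alpha> \<equiv> hnorm (dirichlet_inner \<alpha>)"

lemma dirichlet_space_iff:
  assumes \<alpha>: "-1 < \<alpha>"
  shows "f \<in> dirichlet_space \<alpha> \<longleftrightarrow> f holomorphic_on ball 0 1 \<and> (\<forall>z. z \<notin> ball 0 1 \<longrightarrow> f z = 0) \<and>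
     integrable lborel (\<lambda>z. area_weight \<alpha> z * (cmod (deriv f z))\<^sup>2)"
proof -
  have "integrable (weighted_area \<alpha>) (\<lambda>z. (cmod (deriv f z))\<^sup>2) \<longleftrightarrow>
      integrable lborel (\<lambda>z. area_weight \<alpha> z * (cmod (deriv f z))\<^sup>2)" if "f holomorphic_on ball 0 1"
    using integrable_weighted_area[OF \<alpha>, of "\<lambda>z. (cmod (deriv f z))\<^sup>2"] holomorphic_on_imp_continuous_on[OF holomorphic_deriv[OF that]]
    by (simp add: continuous_intros)
  then show ?thesis by (auto simp: dirichlet_space_def)
qed

lemma dirichlet_spaceD:
  assumes "f \<in> dirichlet_space \<alpha>"
  shows dirichlet_holomorphic: "f holomorphic_on ball 0 1"
    and dirichlet_outside: "z \<notin> ball 0 1 \<Longrightarrow> f z = 0"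
    and dirichlet_deriv_holomorphic: "deriv f holomorphic_on ball 0 1"
    and dirichlet_deriv_continuous: "continuous_on (ball 0 1) (deriv f)"
    and dirichlet_has_deriv: "z \<in> ball 0 1 \<Longrightarrow> (f has_field_derivative deriv f z) (at z)"
  using assms holomorphic_deriv[of f "ball 0 1"] holomorphic_on_imp_continuous_on[of "deriv f" "ball 0 1"] holomorphic_derivI[of f "ball 0 1" z]
  by (auto simp: dirichlet_space_def)

lemma dirichlet_integrable:
  assumes \<alpha>: "-1 < \<alpha>" and f: "f \<in> dirichlet_space \<alpha>"
  shows "integrable lborel (\<lambda>z. area_weight \<alpha> z * (cmod (deriv f z))\<^sup>2)"
  using f dirichlet_space_iff[OF \<alpha>] by blast

lemma dirichlet_hnorm:
  assumes \<alpha>: "-1 < \<alpha>" and f: "f \<in> dirichlet_space \<alpha>"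
  shows "(dnorm \<alpha> f)\<^sup>2 = (cmod (f 0))\<^sup>2 + (LINT z|lborel. area_weight \<alpha> z * (cmod (deriv f z))\<^sup>2)"
  using integral_weighted_area[OF \<alpha>, of "\<lambda>z. (cmod (deriv f z))\<^sup>2"] dirichlet_deriv_continuous[OF f]
  by (simp add: hnorm_dirichlet_inner continuous_intros)

lemma dirichlet_inner_lborel:
  assumes \<alpha>: "-1 < \<alpha>" and f: "f \<in> dirichlet_space \<alpha>" and g: "g \<in> dirichlet_space \<alpha>"
  shows "dirichlet_inner \<alpha> f g = f 0 * cnj (g 0) + (LINT z|lborel. area_weight \<alpha> z *\<^sub>R (deriv f z * cnj (deriv g z)))"
    and "integrable lborel (\<lambda>z. area_weight \<alpha> z *\<^sub>R (deriv f z * cnj (deriv g z)))"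
proof -
  have cont: "continuous_on (ball 0 1) (\<lambda>z. deriv f z * cnj (deriv g z))"
    by (intro continuous_intros dirichlet_deriv_continuous[OF f] dirichlet_deriv_continuous[OF g])
  show "dirichlet_inner \<alpha> f g = f 0 * cnj (g 0) + (LINT z|lborel. area_weight \<alpha> z *\<^sub>R (deriv f z * cnj (deriv g z)))"
    unfolding dirichlet_inner_def integral_weighted_area[OF \<alpha> cont] ..
  have "integrable lborel (\<lambda>z. area_weight \<alpha> z * (cmod (deriv f z))\<^sup>2 + area_weight \<alpha> z * (cmod (deriv g z))\<^sup>2)"
    by (intro Bochner_Integration.integrable_add dirichlet_integrable \<alpha> f g)
  then show "integrable lborel (\<lambda>z. area_weight \<alpha> z *\<^sub>R (deriv f z * cnj (deriv g z)))"
  proof (rule Bochner_Integration.integrable_bound)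
    show "AE z in lborel. norm (area_weight \<alpha> z *\<^sub>R (deriv f z * cnj (deriv g z)))
        \<le> norm (area_weight \<alpha> z * (cmod (deriv f z))\<^sup>2 + area_weight \<alpha> z * (cmod (deriv g z))\<^sup>2)"
    proof (rule AE_I2)
      fix z
      have "cmod (deriv f z) * cmod (deriv g z) \<le> (cmod (deriv f z))\<^sup>2 + (cmod (deriv g z))\<^sup>2"
        using sum_squares_bound[of "cmod (deriv f z)" "cmod (deriv g z)"]
          mult_nonneg_nonneg[OF norm_ge_zero[of "deriv f z"] norm_ge_zero[of "deriv g z"]] by linarith
      then have "area_weight \<alpha> z * (cmod (deriv f z) * cmod (deriv g z)) \<le> area_weight \<alpha> z * ((cmod (deriv f z))\<^sup>2 + (cmod (deriv g z))\<^sup>2)"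
        using area_weight_nonneg[OF \<alpha>] by (rule mult_left_mono)
      then show "norm (area_weight \<alpha> z *\<^sub>R (deriv f z * cnj (deriv g z)))
        \<le> norm (area_weight \<alpha> z * (cmod (deriv f z))\<^sup>2 + area_weight \<alpha> z * (cmod (deriv g z))\<^sup>2)"
        using area_weight_nonneg[OF \<alpha>] by (simp add: norm_mult distrib_left)
    qed
    show "(\<lambda>z. area_weight \<alpha> z *\<^sub>R (deriv f z * cnj (deriv g z))) \<in> borel_measurable lborel"
      using borel_measurable_area_weight[OF \<alpha> cont] by simp
  qed
qed

lemma dirichlet_inner_self:
  "dirichlet_inner \<alpha> f f = complex_of_real ((cmod (f 0))\<^sup>2 + (LINT z|weighted_area \<alpha>. (cmod (deriv f z))\<^sup>2))"
  unfolding dirichlet_inner_def complex_norm_square[symmetric]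
  by (simp only: integral_complex_of_real of_real_add)

lemma Re_dirichlet_inner_nonneg: "0 \<le> Re (dirichlet_inner \<alpha> f f)"
  by (simp add: dirichlet_inner_self)

lemma dirichlet_hnorm_nonneg: "0 \<le> dnorm \<alpha> f"
  by (simp add: hnorm_def Re_dirichlet_inner_nonneg)

text \<open>The mean \<open>(t + Q / t) / 2\<close> is smallest for \<open>t = sqrt Q\<close>. Here \<open>t\<close> is the free parameter of a
  weighted inequality between geometric and arithmetic means, and its best value gives the bound that the
  Cauchy-Schwarz inequality would give.\<close>

lemma le_sqrt_if_le_all_means:
  fixes x Q :: real
  assumes Q: "Q \<ge> 0" and le: "\<And>t. t > 0 \<Longrightarrow> x \<le> (t + Q / t) / 2"
  shows "x \<le> sqrt Q"
proof (cases "Q = 0")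
  case True
  have "x \<le> 0 + e" if "e > 0" for e using le[of "2 * e"] that True by simp
  then have "x \<le> 0" by (rule field_le_epsilon)
  then show ?thesis using True by simp
next
  case False
  then have "sqrt Q > 0" using Q by simp
  moreover have "Q / sqrt Q = sqrt Q" using Q by (simp add: real_div_sqrt)
  ultimately show ?thesis using le[of "sqrt Q"] by simp
qed

text \<open>By the mean value property \<open>f'(z)\<close> is the average of \<open>f'\<close> over a disk around \<open>z\<close> that stays in \<open>|z| < (1 + r) / 2\<close>,
  where the weight is bounded below; so it is controlled by the \<open>L\<^sup>2\<close> norm. Integrating \<open>f'\<close> along a
  radius bounds \<open>f\<close> itself.\<close>

lemma dirichlet_point_bounds:
  assumes \<alpha>: "0 < \<alpha>" and r: "0 \<le> r" "r < 1"
  obtains C where "C > 0"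
    "\<And>f z. f \<in> dirichlet_space \<alpha> \<Longrightarrow> cmod z \<le> r \<Longrightarrow> cmod (deriv f z) \<le> C * dnorm \<alpha> f"
    "\<And>f z. f \<in> dirichlet_space \<alpha> \<Longrightarrow> cmod z \<le> r \<Longrightarrow> cmod (f z) \<le> C * dnorm \<alpha> f"
proof -
  have \<alpha>': "-1 < \<alpha>" using \<alpha> by simp
  define c where "c = 1 - r"
  define R where "R = (1 + r) / 2"
  have c: "c > 0" and R: "0 < R" "R < 1" using r by (auto simp: c_def R_def)
  define w0 where "w0 = (1 + \<alpha>) / pi * (1 - R\<^sup>2) powr \<alpha>"
  have R2: "R\<^sup>2 < 1" using R by (simp add: power_less_one_iff)
  have w0: "w0 > 0" using \<alpha> R2 by (simp add: w0_def)
  have w0_le: "w0 \<le> area_weight \<alpha> z" if "cmod z < R" for z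
  proof -
    have "(cmod z)\<^sup>2 \<le> R\<^sup>2" using that by (intro power_mono) auto
    then have "(1 - R\<^sup>2) powr \<alpha> \<le> (1 - (cmod z)\<^sup>2) powr \<alpha>"
      using R2 \<alpha> by (intro powr_mono2) auto
    then show ?thesis
      using that R \<alpha> by (simp add: w0_def area_weight_inside divide_right_mono mult_left_mono)
  qed
  define K where "K = 4 / (pi * w0 * c\<^sup>2)"
  have K: "K > 0" using w0 c by (simp add: K_def)
  let ?N = "dnorm \<alpha>"
  have d: "cmod (deriv f z) \<le> sqrt K * ?N f" if f: "f \<in> dirichlet_space \<alpha>" and z: "cmod z \<le> r" for f z
  proof -
    let ?G = "\<lambda>z. area_weight \<alpha> z * (cmod (deriv f z))\<^sup>2"
    let ?B = "indicator (ball (0::complex) (1/2)) :: complex \<Rightarrow> real"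
    define I where "I = integral\<^sup>L lborel ?G"
    have I: "0 \<le> I" "I \<le> (?N f)\<^sup>2"
      using area_weight_nonneg[OF \<alpha>'] dirichlet_hnorm[OF \<alpha>' f] by (auto simp: I_def intro!: integral_nonneg)
    have Gint: "integrable lborel ?G" by (rule dirichlet_integrable[OF \<alpha>' f])
    then have Gm: "?G \<in> borel_measurable borel" by (auto dest: borel_measurable_integrable)
    have Gc: "integrable lborel (\<lambda>w. ?G (z + of_real c * w))" "(LINT w|lborel. ?G (z + of_real c * w)) = I / c\<^sup>2"
      using lborel_integral_complex_affine[of "of_real c" ?G z] Gm Gint c by (auto simp: I_def)
    have norm_cw: "cmod (of_real c * w) = c * cmod w" for w
      using c by (simp add: norm_mult)
    have cr: "r = 1 - c" by (simp add: c_def)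
    have inside: "z + of_real c * w \<in> ball 0 1" if "w \<in> ball 0 1" for w
      using norm_triangle_ineq[of z "of_real c * w"] norm_cw[of w] z mult_strict_left_mono[of "cmod w" 1 c, OF that[unfolded mem_ball_0] c]
      unfolding mem_ball_0 cr by linarith
    have "(\<lambda>w. deriv f (z + of_real c * w)) holomorphic_on ball 0 1"
      by (rule holomorphic_on_compose_gen[of "\<lambda>w. z + of_real c * w" _ "deriv f" "ball 0 1", unfolded o_def])
         (use inside in \<open>auto intro!: holomorphic_intros dirichlet_deriv_holomorphic[OF f]\<close>)
    from holomorphic_mean_value_bound[OF this]
    have gint: "integrable lborel (\<lambda>w. ?B w *\<^sub>R deriv f (z + of_real c * w))"
      and mv: "cmod (deriv f z) * (pi / 4) \<le> (LINT w|lborel. ?B w * cmod (deriv f (z + of_real c * w)))"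
      by auto
    have Bint: "integrable lborel ?B"
      using emeasure_lborel_ball_finite[of "0::complex" "1/2"] by (simp add: integrable_indicator_iff)
    have vol: "measure lborel (ball (0::complex) (1/2)) = pi / 4"
      using content_ball[of "1/2" "0::complex"] by (simp add: unit_ball_vol_2 power2_eq_square)
    have "cmod (deriv f z) \<le> (t + K * I / t) / 2" if t: "t > 0" for t
    proof -
      have "cmod (deriv f z) * (pi / 4) \<le> (LINT w|lborel. ?B w * cmod (deriv f (z + of_real c * w)))" by (rule mv)
      also have "\<dots> \<le> (LINT w|lborel. (t / 2) * ?B w + (1 / (2 * t * w0)) * ?G (z + of_real c * w))"
      proof (rule integral_mono)
        show "integrable lborel (\<lambda>w. ?B w * cmod (deriv f (z + of_real c * w)))"
          using integrable_norm[OF gint] by simp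
        show "integrable lborel (\<lambda>w. (t / 2) * ?B w + (1 / (2 * t * w0)) * ?G (z + of_real c * w))"
          by (intro Bochner_Integration.integrable_add integrable_mult_right Bint Gc)
        fix w
        show "?B w * cmod (deriv f (z + of_real c * w)) \<le> (t / 2) * ?B w + (1 / (2 * t * w0)) * ?G (z + of_real c * w)"
        proof (cases "w \<in> ball 0 (1/2)")
          case True
          let ?x = "cmod (deriv f (z + of_real c * w))"
          have "c * cmod w < c / 2" using mult_strict_left_mono[of "cmod w" "1/2" c, OF True[unfolded mem_ball_0] c] by simp
          then have "cmod (z + of_real c * w) < R"
            using norm_triangle_ineq[of z "of_real c * w"] norm_cw[of w] z
            unfolding cr R_def by (simp add: field_simps)
          then have "w0 * ?x\<^sup>2 \<le> ?G (z + of_real c * w)"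
            by (intro mult_right_mono w0_le) auto
          then have "?x\<^sup>2 / (2 * t) \<le> (1 / (2 * t * w0)) * ?G (z + of_real c * w)"
            using t w0 by (simp add: field_simps)
          moreover have "?x \<le> t / 2 + ?x\<^sup>2 / (2 * t)"
          proof -
            have "0 \<le> (?x - t)\<^sup>2" by simp
            then have "2 * t * ?x \<le> t\<^sup>2 + ?x\<^sup>2" by (simp add: power2_diff algebra_simps)
            then show ?thesis using t by (simp add: field_simps power2_eq_square)
          qed
          ultimately show ?thesis using True by simp
        next
          case False
          then show ?thesis using t w0 area_weight_nonneg[OF \<alpha>'] by simp
        qed
      qed
      also have "\<dots> = (t / 2) * (pi / 4) + (1 / (2 * t * w0)) * (I / c\<^sup>2)"
        using Gc Bint vol by (simp add: mult.commute mult.left_commute)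
      finally have "cmod (deriv f z) * (pi / 4) \<le> (t / 2) * (pi / 4) + (1 / (2 * t * w0)) * (I / c\<^sup>2)" .
      then have "(cmod (deriv f z) * (pi / 4)) * (4 / pi) \<le> ((t / 2) * (pi / 4) + (1 / (2 * t * w0)) * (I / c\<^sup>2)) * (4 / pi)"
        by (intro mult_right_mono) auto
      then show ?thesis using t w0 c by (simp add: K_def field_simps)
    qed
    then have "cmod (deriv f z) \<le> sqrt (K * I)"
      by (rule le_sqrt_if_le_all_means[rotated]) (use K I in auto)
    also have "\<dots> \<le> sqrt (K * (?N f)\<^sup>2)"
      using K I by (intro real_sqrt_le_mono mult_left_mono) auto
    also have "\<dots> = sqrt K * ?N f"
      using dirichlet_hnorm_nonneg by (simp add: real_sqrt_mult)
    finally show ?thesis .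
  qed
  have v: "cmod (f z) \<le> (sqrt K + 1) * ?N f" if f: "f \<in> dirichlet_space \<alpha>" and z: "cmod z \<le> r" for f z
  proof -
    have "norm (f z - f 0) \<le> (sqrt K * ?N f) * norm (z - 0)"
    proof (rule field_differentiable_bound)
      show "convex (cball (0::complex) r)" by simp
      show "(f has_field_derivative deriv f w) (at w within cball 0 r)" if "w \<in> cball 0 r" for w
        using that r by (intro has_field_derivative_at_within[OF dirichlet_has_deriv[OF f]]) auto
      show "norm (deriv f w) \<le> sqrt K * ?N f" if "w \<in> cball 0 r" for w
        using that by (intro d f) auto
    qed (use z r in auto)
    also have "\<dots> \<le> (sqrt K * ?N f) * 1"
      using z r K dirichlet_hnorm_nonneg by (intro mult_left_mono) auto
    finally have "norm (f z - f 0) \<le> sqrt K * ?N f" by simp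
    moreover have "cmod (f 0) \<le> ?N f"
    proof (rule power2_le_imp_le)
      show "(cmod (f 0))\<^sup>2 \<le> (?N f)\<^sup>2"
        unfolding dirichlet_hnorm[OF \<alpha>' f] using area_weight_nonneg[OF \<alpha>'] by (auto intro!: integral_nonneg)
    qed (rule dirichlet_hnorm_nonneg)
    ultimately show ?thesis
      using norm_triangle_ineq2[of "f z" "f 0"] by (simp add: algebra_simps)
  qed
  have le: "sqrt K * ?N f \<le> (sqrt K + 1) * ?N f" for f
    using dirichlet_hnorm_nonneg by (intro mult_right_mono) auto
  show thesis
  proof (rule that[of "sqrt K + 1"])
    show "0 < sqrt K + 1" using K by (simp add: add_pos_pos)
    show "cmod (deriv f z) \<le> (sqrt K + 1) * ?N f" if "f \<in> dirichlet_space \<alpha>" "cmod z \<le> r" for f z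
      using order_trans[OF d[OF that] le] .
  qed (rule v)
qed

text \<open>At points where \<open>f\<close> is not differentiable both sides are the same unspecified value.\<close>

lemma deriv_uminus: "cmod (deriv (\<lambda>x. - f x) z) = cmod (deriv f z)"
proof (cases "f field_differentiable at z")
  case True
  then show ?thesis by (simp add: deriv_minus)
next
  case False
  then have "\<not> (f has_field_derivative D) (at z)" for D
    by (auto simp: field_differentiable_def)
  moreover have "\<not> ((\<lambda>x. - f x) has_field_derivative D) (at z)" for D
    using calculation[of "- D"] DERIV_minus[of "\<lambda>x. - f x" D z UNIV] by auto
  ultimately show ?thesis by (simp add: deriv_def)
qed

lemma dirichlet_hnorm_uminus: "dnorm \<alpha> (\<lambda>x. - f x) = dnorm \<alpha> f"
  by (simp add: hnorm_def dirichlet_inner_self deriv_uminus)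

lemma dirichlet_space_lin:
  assumes \<alpha>: "-1 < \<alpha>" and f: "f \<in> dirichlet_space \<alpha>" and g: "g \<in> dirichlet_space \<alpha>"
  shows dirichlet_lin_mem: "(\<lambda>x. a * f x + b * g x) \<in> dirichlet_space \<alpha>"
    and dirichlet_deriv_lin: "z \<in> ball 0 1 \<Longrightarrow> deriv (\<lambda>x. a * f x + b * g x) z = a * deriv f z + b * deriv g z"
proof -
  let ?h = "\<lambda>x. a * f x + b * g x"
  show d: "deriv ?h z = a * deriv f z + b * deriv g z" if "z \<in> ball 0 1" for z
    using that by (intro DERIV_imp_deriv DERIV_add DERIV_cmult dirichlet_has_deriv[OF f] dirichlet_has_deriv[OF g])
  have hol: "?h holomorphic_on ball 0 1"
    by (intro holomorphic_intros dirichlet_holomorphic[OF f] dirichlet_holomorphic[OF g])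
  have cont: "continuous_on (ball 0 1) (\<lambda>z. (cmod (deriv ?h z))\<^sup>2)"
    by (intro continuous_intros holomorphic_on_imp_continuous_on holomorphic_deriv hol) auto
  have "integrable lborel (\<lambda>z. area_weight \<alpha> z * (cmod (deriv ?h z))\<^sup>2)"
  proof (rule Bochner_Integration.integrable_bound)
    show "integrable lborel (\<lambda>z. 2 * (cmod a)\<^sup>2 * (area_weight \<alpha> z * (cmod (deriv f z))\<^sup>2) +
        2 * (cmod b)\<^sup>2 * (area_weight \<alpha> z * (cmod (deriv g z))\<^sup>2))"
      by (intro Bochner_Integration.integrable_add integrable_mult_right dirichlet_integrable \<alpha> f g)
    show "AE z in lborel. norm (area_weight \<alpha> z * (cmod (deriv ?h z))\<^sup>2) \<le>
        norm (2 * (cmod a)\<^sup>2 * (area_weight \<alpha> z * (cmod (deriv f z))\<^sup>2) +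
        2 * (cmod b)\<^sup>2 * (area_weight \<alpha> z * (cmod (deriv g z))\<^sup>2))"
    proof (rule AE_I2)
      fix z
      show "norm (area_weight \<alpha> z * (cmod (deriv ?h z))\<^sup>2) \<le>
        norm (2 * (cmod a)\<^sup>2 * (area_weight \<alpha> z * (cmod (deriv f z))\<^sup>2) +
        2 * (cmod b)\<^sup>2 * (area_weight \<alpha> z * (cmod (deriv g z))\<^sup>2))"
      proof (cases "cmod z < 1")
        case True
        let ?x = "cmod a * cmod (deriv f z)" and ?y = "cmod b * cmod (deriv g z)"
        have "cmod (deriv ?h z) \<le> ?x + ?y"
          using d[of z] True norm_triangle_ineq[of "a * deriv f z" "b * deriv g z"] by (simp add: norm_mult)
        then have "(cmod (deriv ?h z))\<^sup>2 \<le> (?x + ?y)\<^sup>2" by (rule power_mono) simp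
        also have "\<dots> \<le> 2 * ?x\<^sup>2 + 2 * ?y\<^sup>2"
          using sum_squares_bound[of ?x ?y] by (simp add: power2_sum)
        finally have "area_weight \<alpha> z * (cmod (deriv ?h z))\<^sup>2 \<le> area_weight \<alpha> z * (2 * ?x\<^sup>2 + 2 * ?y\<^sup>2)"
          by (rule mult_left_mono) (rule area_weight_nonneg[OF \<alpha>])
        then show ?thesis
          using area_weight_nonneg[OF \<alpha>] by (simp add: power_mult_distrib algebra_simps)
      qed (simp add: area_weight_outside)
    qed
    show "(\<lambda>z. area_weight \<alpha> z * (cmod (deriv ?h z))\<^sup>2) \<in> borel_measurable lborel"
      using borel_measurable_area_weight[OF \<alpha> cont] by simp
  qed
  then show "?h \<in> dirichlet_space \<alpha>"
    using hol dirichlet_outside[OF f] dirichlet_outside[OF g] by (auto simp: dirichlet_space_iff[OF \<alpha>])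
qed

lemma dirichlet_zero_mem: "-1 < \<alpha> \<Longrightarrow> (\<lambda>_. 0) \<in> dirichlet_space \<alpha>"
  by (simp add: dirichlet_space_iff)

text \<open>Norm convergence controls point values uniformly on smaller disks, so a Cauchy sequence has a locally uniform,
  hence holomorphic, limit, and the derivatives converge pointwise. Fatou's lemma gives convergence in norm.\<close>

lemma dirichlet_complete:
  assumes \<alpha>: "0 < \<alpha>" and F: "\<And>n. F n \<in> dirichlet_space \<alpha>"
    and Cauchy: "\<And>e. e > 0 \<Longrightarrow> \<exists>N. \<forall>m\<ge>N. \<forall>n\<ge>N. dnorm \<alpha> (\<lambda>x. F m x - F n x) < e"
  shows "\<exists>f\<in>dirichlet_space \<alpha>. (\<lambda>n. dnorm \<alpha> (\<lambda>x. F n x - f x)) \<longlonglongrightarrow> 0"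
proof -
  have \<alpha>': "-1 < \<alpha>" using \<alpha> by simp
  let ?N = "dnorm \<alpha>"
  have diff_mem: "(\<lambda>x. f x - g x) \<in> dirichlet_space \<alpha>"
    and diff_deriv: "\<And>z. z \<in> ball 0 1 \<Longrightarrow> deriv (\<lambda>x. f x - g x) z = deriv f z - deriv g z"
    if "f \<in> dirichlet_space \<alpha>" "g \<in> dirichlet_space \<alpha>" for f g
    using dirichlet_lin_mem[OF \<alpha>' that, of 1 "-1"] dirichlet_deriv_lin[OF \<alpha>' that, of _ 1 "-1"] by simp_all
  define f where "f z = (if z \<in> ball 0 1 then lim (\<lambda>n. F n z) else 0)" for z
  have unif: "uniform_limit (cball 0 r) F f sequentially" if r: "0 \<le> r" "r < 1" for r
  proof -
    obtain C where C: "C > 0" "\<And>f z. f \<in> dirichlet_space \<alpha> \<Longrightarrow> cmod z \<le> r \<Longrightarrow> cmod (f z) \<le> C * ?N f"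
      by (rule dirichlet_point_bounds[OF \<alpha> r]) blast
    have "uniformly_Cauchy_on (cball 0 r) F"
    proof (rule uniformly_Cauchy_onI)
      fix e :: real assume e: "e > 0"
      then have "\<exists>M. \<forall>m\<ge>M. \<forall>n\<ge>M. ?N (\<lambda>x. F m x - F n x) < e / C"
        using C(1) by (intro Cauchy) simp
      then obtain M where M: "\<And>m n. m \<ge> M \<Longrightarrow> n \<ge> M \<Longrightarrow> ?N (\<lambda>x. F m x - F n x) < e / C"
        by blast
      have "dist (F m z) (F n z) < e" if "z \<in> cball 0 r" "m \<ge> M" "n \<ge> M" for z m n
      proof -
        have "dist (F m z) (F n z) \<le> C * ?N (\<lambda>x. F m x - F n x)"
          using C(2)[OF diff_mem[OF F F], of z m n] that by (simp add: dist_norm)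
        also have "\<dots> < e" using M[OF that(2,3)] C(1) by (simp add: pos_less_divide_eq mult.commute)
        finally show ?thesis .
      qed
      then show "\<exists>M. \<forall>x\<in>cball 0 r. \<forall>m\<ge>M. \<forall>n\<ge>M. dist (F m x) (F n x) < e" by blast
    qed
    then have "uniform_limit (cball 0 r) F (\<lambda>z. lim (\<lambda>n. F n z)) sequentially"
      using Cauchy_uniformly_convergent uniformly_convergent_uniform_limit_iff by blast
    then show ?thesis
      by (rule uniform_limit_cong'[THEN iffD1, rotated 2]) (use r in \<open>auto simp: f_def\<close>)
  qed
  have loc: "\<exists>d>0. cball x d \<subseteq> ball 0 1 \<and> uniform_limit (cball x d) F f sequentially" if "x \<in> ball 0 1" for x
  proof -
    have x: "cmod x < 1" using that by simp
    define d where "d = (1 - cmod x) / 2"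
    have "cball x d \<subseteq> cball 0 ((1 + cmod x) / 2)"
    proof
      fix y assume "y \<in> cball x d"
      then have "cmod (y - x) \<le> (1 - cmod x) / 2" by (simp add: d_def dist_norm norm_minus_commute)
      then have "cmod y \<le> (1 + cmod x) / 2" using norm_triangle_sub[of y x] by (simp add: field_simps)
      then show "y \<in> cball 0 ((1 + cmod x) / 2)" by simp
    qed
    moreover have "uniform_limit (cball 0 ((1 + cmod x) / 2)) F f sequentially"
      using x by (intro unif) auto
    moreover have "cball 0 ((1 + cmod x) / 2) \<subseteq> ball (0::complex) 1" using x by auto
    ultimately show ?thesis
      using x uniform_limit_on_subset by (intro exI[of _ d]) (auto simp: d_def)
  qed
  have f_hol: "f holomorphic_on ball 0 1"
    by (rule holomorphic_uniform_sequence[of _ F, OF open_ball dirichlet_holomorphic[OF F]]) (use loc in blast)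
  obtain f' where f': "\<And>z. z \<in> ball 0 1 \<Longrightarrow> (f has_field_derivative f' z) (at z)"
      "\<And>z. z \<in> ball 0 1 \<Longrightarrow> (\<lambda>n. deriv (F n) z) \<longlonglongrightarrow> f' z"
    using has_complex_derivative_uniform_sequence[of _ F "\<lambda>n. deriv (F n)", OF open_ball dirichlet_has_deriv[OF F] loc] by blast
  have deriv_lim: "(\<lambda>n. deriv (F n) z) \<longlonglongrightarrow> deriv f z" if "z \<in> ball 0 1" for z
    using f'[OF that] by (simp add: DERIV_imp_deriv)
  have val_lim: "(\<lambda>n. F n 0) \<longlonglongrightarrow> f 0"
    using unif[of 0] by (auto intro: tendsto_uniform_limitI)
  \<comment> \<open>Fatou's lemma carries the Cauchy estimate to the limit.\<close>
  have key: "(\<lambda>x. f x - F n x) \<in> dirichlet_space \<alpha> \<and> ?N (\<lambda>x. f x - F n x) \<le> 2 * e"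
    if e: "e > 0" and N: "\<And>m. m \<ge> N \<Longrightarrow> ?N (\<lambda>x. F m x - F n x) < e" for e n N
  proof -
    let ?h = "\<lambda>x. f x - F n x"
    have h_hol: "?h holomorphic_on ball 0 1"
      by (intro holomorphic_intros f_hol dirichlet_holomorphic[OF F])
    have cont: "continuous_on (ball 0 1) (\<lambda>z. (cmod (deriv ?h z))\<^sup>2)"
      by (intro continuous_intros holomorphic_on_imp_continuous_on holomorphic_deriv h_hol) auto
    let ?u = "\<lambda>m z. area_weight \<alpha> z * (cmod (deriv (\<lambda>x. F m x - F n x) z))\<^sup>2"
    let ?v = "\<lambda>z. area_weight \<alpha> z * (cmod (deriv ?h z))\<^sup>2"
    have uv: "(\<lambda>m. ?u m z) \<longlonglongrightarrow> ?v z" for z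
    proof (cases "z \<in> ball 0 1")
      case True
      have h: "deriv ?h z = deriv f z - deriv (F n) z"
        by (intro DERIV_imp_deriv DERIV_diff dirichlet_has_deriv[OF F True] holomorphic_derivI[OF f_hol open_ball True])
      then show ?thesis
        unfolding diff_deriv[OF F F True] h by (intro tendsto_intros deriv_lim[OF True])
    qed (simp add: area_weight_outside)
    have um: "?u m \<in> borel_measurable borel" for m
      using dirichlet_integrable[OF \<alpha>' diff_mem[OF F F]] by (auto dest: borel_measurable_integrable)
    have vm: "?v \<in> borel_measurable borel"
      using borel_measurable_area_weight[OF \<alpha>' cont] by simp
    have "(\<integral>\<^sup>+z. ennreal (?v z) \<partial>lborel) = (\<integral>\<^sup>+z. liminf (\<lambda>m. ennreal (?u m z)) \<partial>lborel)"
      by (intro nn_integral_cong lim_imp_Liminf[symmetric] tendsto_ennrealI uv) simp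
    also have "\<dots> \<le> liminf (\<lambda>m. \<integral>\<^sup>+z. ennreal (?u m z) \<partial>lborel)"
      using um by (intro nn_integral_liminf) auto
    also have "\<dots> \<le> ennreal (e\<^sup>2)"
    proof (rule Liminf_le)
      show "\<forall>\<^sub>F m in sequentially. (\<integral>\<^sup>+z. ennreal (?u m z) \<partial>lborel) \<le> ennreal (e\<^sup>2)"
        unfolding eventually_sequentially
      proof (intro exI allI impI)
        fix m assume m: "m \<ge> N"
        have "(?N (\<lambda>x. F m x - F n x))\<^sup>2 \<le> e\<^sup>2"
          using N[OF m] by (intro power_mono dirichlet_hnorm_nonneg) auto
        then have "integral\<^sup>L lborel (?u m) \<le> e\<^sup>2"
          using dirichlet_hnorm[OF \<alpha>' diff_mem[OF F F], of m n] zero_le_power2[of "cmod (F m 0 - F n 0)"] by linarith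
        then show "(\<integral>\<^sup>+z. ennreal (?u m z) \<partial>lborel) \<le> ennreal (e\<^sup>2)"
          using area_weight_nonneg[OF \<alpha>'] dirichlet_integrable[OF \<alpha>' diff_mem[OF F F]]
          by (subst nn_integral_eq_integral) (auto intro: ennreal_leI)
      qed
    qed simp
    finally have nn: "(\<integral>\<^sup>+z. ennreal (?v z) \<partial>lborel) \<le> ennreal (e\<^sup>2)" .
    have v_int: "integrable lborel ?v"
      using vm nn area_weight_nonneg[OF \<alpha>']
      by (intro integrableI_nonneg) (auto simp: order_le_less_trans[OF _ ennreal_less_top])
    have mem: "?h \<in> dirichlet_space \<alpha>"
      using h_hol v_int dirichlet_outside[OF F] by (auto simp: dirichlet_space_iff[OF \<alpha>'] f_def)
    have "ennreal (integral\<^sup>L lborel ?v) \<le> ennreal (e\<^sup>2)"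
      using nn area_weight_nonneg[OF \<alpha>'] by (subst nn_integral_eq_integral[OF v_int, symmetric]) auto
    then have I: "integral\<^sup>L lborel ?v \<le> e\<^sup>2" by (simp add: ennreal_le_iff)
    have "(\<lambda>m. cmod (F m 0 - F n 0)) \<longlonglongrightarrow> cmod (f 0 - F n 0)"
      by (intro tendsto_intros val_lim)
    moreover have "\<exists>N. \<forall>m\<ge>N. cmod (F m 0 - F n 0) \<le> e"
    proof (intro exI allI impI)
      fix m assume m: "m \<ge> N"
      have "(cmod (F m 0 - F n 0))\<^sup>2 \<le> (?N (\<lambda>x. F m x - F n x))\<^sup>2"
        unfolding dirichlet_hnorm[OF \<alpha>' diff_mem[OF F F]] using area_weight_nonneg[OF \<alpha>'] by (auto intro!: integral_nonneg)
      then show "cmod (F m 0 - F n 0) \<le> e"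
        using N[OF m] by (meson dirichlet_hnorm_nonneg less_imp_le order_trans power2_le_imp_le)
    qed
    ultimately have "cmod (f 0 - F n 0) \<le> e" by (rule LIMSEQ_le_const2)
    then have "(cmod (f 0 - F n 0))\<^sup>2 \<le> e\<^sup>2" by (rule power_mono) simp
    moreover have "(2 * e)\<^sup>2 = 4 * e\<^sup>2" by (simp add: power_mult_distrib)
    ultimately have "(?N ?h)\<^sup>2 \<le> (2 * e)\<^sup>2"
      using dirichlet_hnorm[OF \<alpha>' mem] I zero_le_power2[of e] by linarith
    then show ?thesis using mem e by (auto intro: power2_le_imp_le)
  qed
  have neg: "?N (\<lambda>x. F n x - f x) = ?N (\<lambda>x. f x - F n x)" for n
    using dirichlet_hnorm_uminus[of \<alpha> "\<lambda>x. f x - F n x"] by simp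
  show ?thesis
  proof (intro bexI LIMSEQ_I)
    obtain N where "\<forall>m\<ge>N. \<forall>n\<ge>N. ?N (\<lambda>x. F m x - F n x) < 1" using Cauchy[of 1] by auto
    then have "(\<lambda>x. f x - F N x) \<in> dirichlet_space \<alpha>" using key[of 1 N N] by auto
    from dirichlet_lin_mem[OF \<alpha>' this F[of N], of 1 1] show "f \<in> dirichlet_space \<alpha>" by simp
    fix e :: real assume e: "e > 0"
    then obtain N where N: "\<forall>m\<ge>N. \<forall>n\<ge>N. ?N (\<lambda>x. F m x - F n x) < e / 4" using Cauchy[of "e / 4"] by auto
    have "?N (\<lambda>x. F n x - f x) < e" if "n \<ge> N" for n
      using key[of "e / 4" N n] N that e by (auto simp: neg)
    then show "\<exists>N. \<forall>n\<ge>N. norm (?N (\<lambda>x. F n x - f x) - 0) < e"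
      using dirichlet_hnorm_nonneg by auto
  qed
qed

lemma dirichlet_hilbert_space:
  assumes \<alpha>: "0 < \<alpha>"
  shows "function_hilbert_space (dirichlet_space \<alpha>) (dirichlet_inner \<alpha>)"
proof
  have \<alpha>': "-1 < \<alpha>" using \<alpha> by simp
  show "(\<lambda>_. 0) \<in> dirichlet_space \<alpha>" by (rule dirichlet_zero_mem[OF \<alpha>'])
  show "(\<lambda>x. a * f x + b * g x) \<in> dirichlet_space \<alpha>" if "f \<in> dirichlet_space \<alpha>" "g \<in> dirichlet_space \<alpha>" for f g a b
    by (rule dirichlet_lin_mem[OF \<alpha>' that])
  show "dirichlet_inner \<alpha> (\<lambda>x. a * f x + b * g x) h = a * dirichlet_inner \<alpha> f h + b * dirichlet_inner \<alpha> g h"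
    if f: "f \<in> dirichlet_space \<alpha>" and g: "g \<in> dirichlet_space \<alpha>" and h: "h \<in> dirichlet_space \<alpha>" for f g h a b
  proof -
    let ?I = "\<lambda>f z. area_weight \<alpha> z *\<^sub>R (deriv f z * cnj (deriv h z))"
    have "?I (\<lambda>x. a * f x + b * g x) z = a * ?I f z + b * ?I g z" for z
      using dirichlet_deriv_lin[OF \<alpha>' f g, of z a b]
      by (cases "z \<in> ball 0 1") (auto simp: algebra_simps area_weight_outside)
    then have "integral\<^sup>L lborel (?I (\<lambda>x. a * f x + b * g x)) = (LINT z|lborel. a * ?I f z + b * ?I g z)"
      by (simp only:)
    also have "\<dots> = (LINT z|lborel. a * ?I f z) + (LINT z|lborel. b * ?I g z)"
      by (intro Bochner_Integration.integral_add integrable_mult_right dirichlet_inner_lborel(2)[OF \<alpha>'] f g h)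
    also have "\<dots> = a * integral\<^sup>L lborel (?I f) + b * integral\<^sup>L lborel (?I g)"
      by (simp only: integral_mult_right_zero)
    finally have "integral\<^sup>L lborel (?I (\<lambda>x. a * f x + b * g x)) = a * integral\<^sup>L lborel (?I f) + b * integral\<^sup>L lborel (?I g)" .
    then show ?thesis
      unfolding dirichlet_inner_lborel(1)[OF \<alpha>' dirichlet_lin_mem[OF \<alpha>' f g] h]
        dirichlet_inner_lborel(1)[OF \<alpha>' f h] dirichlet_inner_lborel(1)[OF \<alpha>' g h]
      by (simp add: algebra_simps)
  qed
  show "dirichlet_inner \<alpha> g f = cnj (dirichlet_inner \<alpha> f g)" for f g
    proof -
    have eq: "(\<lambda>z. deriv g z * cnj (deriv f z)) = (\<lambda>z. cnj (deriv f z * cnj (deriv g z)))"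
      by (simp add: mult.commute)
    have "(LINT z|weighted_area \<alpha>. deriv g z * cnj (deriv f z)) = cnj (LINT z|weighted_area \<alpha>. deriv f z * cnj (deriv g z))"
      unfolding eq by (rule Bochner_Integration.integral_cnj)
    then show ?thesis unfolding dirichlet_inner_def by simp
  qed
  show "0 \<le> Re (dirichlet_inner \<alpha> f f)" for f by (rule Re_dirichlet_inner_nonneg)
  show "dnorm \<alpha> (\<lambda>x. - f x) = dnorm \<alpha> f" for f
    by (rule dirichlet_hnorm_uminus)
  show "f = (\<lambda>_. 0)" if f: "f \<in> dirichlet_space \<alpha>" and z: "Re (dirichlet_inner \<alpha> f f) = 0" for f
  proof
    fix z
    show "f z = 0"
    proof (cases "cmod z < 1")
      case True
      obtain C where C: "\<And>g w. g \<in> dirichlet_space \<alpha> \<Longrightarrow> cmod w \<le> cmod z \<Longrightarrow> cmod (g w) \<le> C * dnorm \<alpha> g"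
        by (rule dirichlet_point_bounds[OF \<alpha> norm_ge_zero True]) blast
      have "cmod (f z) \<le> C * dnorm \<alpha> f" by (intro C f) simp
      then show ?thesis using z by (simp add: hnorm_def)
    qed (use dirichlet_outside[OF f] in auto)
  qed
  show "\<exists>f\<in>dirichlet_space \<alpha>. (\<lambda>n. dnorm \<alpha> (\<lambda>x. F n x - f x)) \<longlonglongrightarrow> 0"
    if "\<And>n. F n \<in> dirichlet_space \<alpha>"
      "\<And>e. e > 0 \<Longrightarrow> \<exists>N. \<forall>m\<ge>N. \<forall>n\<ge>N. dnorm \<alpha> (\<lambda>x. F m x - F n x) < e" for F
    using dirichlet_complete[OF \<alpha> that] by blast
qed

section \<open>Taylor truncation\<close>

definition taylor_coeff :: "nat \<Rightarrow> (complex \<Rightarrow> complex) \<Rightarrow> complex" where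
  "taylor_coeff k f = (deriv ^^ k) f 0 / fact k"

definition disk_monomial :: "nat \<Rightarrow> complex \<Rightarrow> complex" where
  "disk_monomial k z = (if z \<in> ball 0 1 then z ^ k else 0)"

definition taylor_trunc :: "nat \<Rightarrow> (complex \<Rightarrow> complex) \<Rightarrow> complex \<Rightarrow> complex" where
  "taylor_trunc n f = (\<lambda>z. \<Sum>k<n. taylor_coeff k f * disk_monomial k z)"

lemma disk_monomial_has_deriv:
  assumes "z \<in> ball 0 1"
  shows "(disk_monomial k has_field_derivative of_nat k * z ^ (k - 1)) (at z)"
proof (rule has_field_derivative_transform_within_open[OF _ open_ball assms])
  show "((\<lambda>z. z ^ k) has_field_derivative of_nat k * z ^ (k - 1)) (at z)"
    by (auto intro!: derivative_eq_intros)
qed (simp add: disk_monomial_def)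

lemma integrable_area_weight:
  assumes \<alpha>: "0 < \<alpha>" shows "integrable lborel (area_weight \<alpha>)"
proof (rule Bochner_Integration.integrable_bound)
  show "integrable lborel (\<lambda>z. (1 + \<alpha>) / pi * indicator (ball (0::complex) 1) z)"
    using emeasure_lborel_ball_finite[of "0::complex" 1]
    by (intro integrable_mult_right) (simp add: integrable_indicator_iff)
  show "AE z in lborel. norm (area_weight \<alpha> z) \<le> norm ((1 + \<alpha>) / pi * indicator (ball (0::complex) 1) z)"
  proof (rule AE_I2)
    fix z show "norm (area_weight \<alpha> z) \<le> norm ((1 + \<alpha>) / pi * indicator (ball (0::complex) 1) z)"
      using area_weight_le[of \<alpha> z] area_weight_nonneg[of \<alpha> z] \<alpha>
      by (cases "cmod z < 1") (auto simp: area_weight_outside)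
  qed
qed simp

lemma dirichlet_mem_bounded_deriv:
  assumes \<alpha>: "0 < \<alpha>" and hol: "f holomorphic_on ball 0 1" and out: "\<And>z. z \<notin> ball 0 1 \<Longrightarrow> f z = 0"
    and bd: "\<And>z. z \<in> ball 0 1 \<Longrightarrow> cmod (deriv f z) \<le> B"
  shows "f \<in> dirichlet_space \<alpha>"
proof -
  have \<alpha>': "-1 < \<alpha>" using \<alpha> by simp
  have cont: "continuous_on (ball 0 1) (\<lambda>z. (cmod (deriv f z))\<^sup>2)"
    by (intro continuous_intros holomorphic_on_imp_continuous_on holomorphic_deriv hol) auto
  have "integrable lborel (\<lambda>z. area_weight \<alpha> z * (cmod (deriv f z))\<^sup>2)"
  proof (rule Bochner_Integration.integrable_bound)
    show "integrable lborel (\<lambda>z. B\<^sup>2 * area_weight \<alpha> z)"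
      by (intro integrable_mult_right integrable_area_weight[OF \<alpha>])
    show "AE z in lborel. norm (area_weight \<alpha> z * (cmod (deriv f z))\<^sup>2) \<le> norm (B\<^sup>2 * area_weight \<alpha> z)"
    proof (rule AE_I2)
      fix z
      show "norm (area_weight \<alpha> z * (cmod (deriv f z))\<^sup>2) \<le> norm (B\<^sup>2 * area_weight \<alpha> z)"
      proof (cases "z \<in> ball 0 1")
        case True
        have "(cmod (deriv f z))\<^sup>2 \<le> B\<^sup>2" using bd[OF True] by (rule power_mono) simp
        then have "area_weight \<alpha> z * (cmod (deriv f z))\<^sup>2 \<le> area_weight \<alpha> z * B\<^sup>2"
          by (rule mult_left_mono) (rule area_weight_nonneg[OF \<alpha>'])
        then show ?thesis
          using area_weight_nonneg[OF \<alpha>', of z] by (simp add: mult.commute)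
      qed (simp add: area_weight_outside)
    qed
    show "(\<lambda>z. area_weight \<alpha> z * (cmod (deriv f z))\<^sup>2) \<in> borel_measurable lborel"
      using borel_measurable_area_weight[OF \<alpha>' cont] by simp
  qed
  then show ?thesis
    using hol out by (simp add: dirichlet_space_iff[OF \<alpha>'])
qed

lemma disk_monomial_mem:
  assumes \<alpha>: "0 < \<alpha>" shows "disk_monomial k \<in> dirichlet_space \<alpha>"
proof (rule dirichlet_mem_bounded_deriv[OF \<alpha>])
  show "disk_monomial k holomorphic_on ball 0 1"
    unfolding holomorphic_on_open[OF open_ball] using disk_monomial_has_deriv by blast
  show "disk_monomial k z = 0" if "z \<notin> ball 0 1" for z using that by (simp add: disk_monomial_def)
  fix z :: complex assume z: "z \<in> ball 0 1"
  have "cmod (deriv (disk_monomial k) z) = real k * cmod z ^ (k - 1)"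
    using DERIV_imp_deriv[OF disk_monomial_has_deriv[OF z, of k]] by (simp add: norm_mult norm_power)
  also have "\<dots> \<le> real k"
    using z by (intro mult_left_le power_le_one) auto
  finally show "cmod (deriv (disk_monomial k) z) \<le> real k" .
qed

lemma taylor_remainder_factor:
  assumes f: "f holomorphic_on ball 0 1"
  obtains q where "q holomorphic_on ball 0 1"
    "\<And>z. z \<in> ball 0 1 \<Longrightarrow> f z - taylor_trunc n f z = z ^ n * q z"
proof -
  define c where "c k = taylor_coeff k f" for k
  have sums: "(\<lambda>k. c k * z ^ k) sums f z" if "z \<in> ball 0 1" for z
    using holomorphic_power_series[OF f that] by (simp add: c_def taylor_coeff_def)
  have tail: "(\<lambda>k. z ^ n * (c (k + n) * z ^ k)) sums (f z - taylor_trunc n f z)" if "z \<in> ball 0 1" for z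
    using sums_split_initial_segment[OF sums[OF that], of n] that
    by (simp add: taylor_trunc_def disk_monomial_def c_def power_add mult_ac)
  define q where "q z = (\<Sum>k. c (k + n) * z ^ k)" for z
  have q: "(\<lambda>k. c (k + n) * z ^ k) sums q z" if "z \<in> ball 0 1" for z
  proof (cases "z = 0")
    case True
    have "summable (\<lambda>k. c (k + n) * z ^ k)"
      using True by (intro summable_finite[of "{0}"]) auto
    then show ?thesis by (simp add: q_def summable_sums)
  next
    case False
    have "summable (\<lambda>k. (1 / z ^ n) * (z ^ n * (c (k + n) * z ^ k)))"
      by (intro summable_mult sums_summable[OF tail[OF that]])
    then show ?thesis using False by (simp add: q_def summable_sums)
  qed
  show thesis
  proof
    show "q holomorphic_on ball 0 1"
      by (rule power_series_holomorphic) (use q in simp)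
    show "f z - taylor_trunc n f z = z ^ n * q z" if "z \<in> ball 0 1" for z
      by (rule sums_unique2[OF tail[OF that] sums_mult[OF q[OF that]]])
  qed
qed

lemma taylor_coeff_lin:
  assumes f: "f holomorphic_on ball 0 1" and g: "g holomorphic_on ball 0 1"
  shows "taylor_coeff k (\<lambda>x. a * f x + b * g x) = a * taylor_coeff k f + b * taylor_coeff k g"
proof -
  have "(deriv ^^ k) (\<lambda>x. a * f x + b * g x) 0 = a * (deriv ^^ k) f 0 + b * (deriv ^^ k) g 0"
    by (subst higher_deriv_add[of _ "ball 0 1"])
       (auto intro!: holomorphic_on_mult holomorphic_on_const f g
          simp: higher_deriv_cmult[OF f _ open_ball] higher_deriv_cmult[OF g _ open_ball])
  then show ?thesis by (simp add: taylor_coeff_def add_divide_distrib)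
qed

lemma taylor_coeff_bounded:
  assumes \<alpha>: "0 < \<alpha>"
  obtains B where "\<And>f. f \<in> dirichlet_space \<alpha> \<Longrightarrow> dnorm \<alpha> f \<le> 1 \<Longrightarrow> cmod (taylor_coeff k f) \<le> B"
proof -
  obtain C where C: "C > 0" "\<And>f z. f \<in> dirichlet_space \<alpha> \<Longrightarrow> cmod z \<le> 1/2 \<Longrightarrow> cmod (f z) \<le> C * dnorm \<alpha> f"
    by (rule dirichlet_point_bounds[OF \<alpha>, of "1/2"]) auto
  have "cmod (taylor_coeff k f) \<le> C / (1/2) ^ k" if f: "f \<in> dirichlet_space \<alpha>" "dnorm \<alpha> f \<le> 1" for f
  proof -
    have "norm ((deriv ^^ k) f 0) \<le> fact k * C / (1/2) ^ k"
    proof (rule Cauchy_inequality)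
      show "f holomorphic_on ball 0 (1/2)"
        by (rule holomorphic_on_subset[OF dirichlet_holomorphic[OF f(1)]]) auto
      show "continuous_on (cball 0 (1/2)) f"
        by (rule continuous_on_subset[OF holomorphic_on_imp_continuous_on[OF dirichlet_holomorphic[OF f(1)]]]) auto
      show "norm (f x) \<le> C" if "norm (0 - x) = 1/2" for x
      proof -
        have "cmod (f x) \<le> C * dnorm \<alpha> f" using that by (intro C f) simp
        also have "\<dots> \<le> C * 1" using C f by (intro mult_left_mono) auto
        finally show ?thesis by simp
      qed
    qed simp
    then show ?thesis by (simp add: taylor_coeff_def norm_divide field_simps)
  qed
  then show thesis by (rule that)
qed

context
  fixes \<alpha> :: real assumes \<alpha>: "0 < \<alpha>"
begin

interpretation D: function_hilbert_space "dirichlet_space \<alpha>" "dirichlet_inner \<alpha>"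
  by (rule dirichlet_hilbert_space[OF \<alpha>])

lemma taylor_trunc_mem: "taylor_trunc n f \<in> dirichlet_space \<alpha>"
proof -
  have "linear_op (dirichlet_space \<alpha>) (\<lambda>f. f)" by (auto simp: linear_op_def)
  from D.linear_op_sum[OF this, of "{..<n}" disk_monomial "\<lambda>k. taylor_coeff k f"]
  show ?thesis by (simp add: taylor_trunc_def disk_monomial_mem[OF \<alpha>])
qed

text \<open>The derivative of the remainder is \<open>z ^ (n - 1)\<close> times a holomorphic function. Multiplied by the
  conjugate of \<open>z ^ (j - 1)\<close> it becomes \<open>|z|\<^sup>2\<^sup>(\<^sup>j\<^sup>-\<^sup>1\<^sup>)\<close> times a holomorphic function vanishing at 0, whose
  integral against a radial weight is 0 over every disk of radius less than 1, and so also in the limit.\<close>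

lemma taylor_remainder_orthogonal_monomial:
  assumes f: "f \<in> dirichlet_space \<alpha>" and j: "j < n"
  shows "dirichlet_inner \<alpha> (\<lambda>x. f x - taylor_trunc n f x) (disk_monomial j) = 0"
proof -
  have \<alpha>': "-1 < \<alpha>" using \<alpha> by simp
  let ?R = "\<lambda>x. f x - taylor_trunc n f x"
  have R: "?R \<in> dirichlet_space \<alpha>" by (intro D.diff_mem f taylor_trunc_mem)
  obtain q where q: "q holomorphic_on ball 0 1" and Rq: "\<And>z. z \<in> ball 0 1 \<Longrightarrow> ?R z = z ^ n * q z"
    using taylor_remainder_factor[OF dirichlet_holomorphic[OF f], of n] by blast
  have R0: "?R 0 = 0" using Rq[of 0] j by simp
  let ?F = "\<lambda>z. area_weight \<alpha> z *\<^sub>R (deriv ?R z * cnj (deriv (disk_monomial j) z))"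
  have F_int: "integrable lborel ?F"
    by (rule dirichlet_inner_lborel(2)[OF \<alpha>' R disk_monomial_mem[OF \<alpha>]])
  have "integral\<^sup>L lborel ?F = 0"
  proof (cases "j = 0")
    case True
    have F0: "?F z = 0" for z
      using DERIV_imp_deriv[OF disk_monomial_has_deriv, of z 0] True
      by (cases "z \<in> ball 0 1") (auto simp: area_weight_outside)
    show ?thesis unfolding F0 by simp
  next
    case False
    define h where "h z = of_nat j * z ^ (n - j) * (of_nat n * q z + z * deriv q z)" for z
    have h: "h holomorphic_on ball 0 1"
      unfolding h_def by (intro holomorphic_intros q holomorphic_deriv) auto
    have h0: "h 0 = 0" using j by (simp add: h_def)
    have Fh: "?F z = (area_weight \<alpha> z * cmod z ^ (2 * (j - 1))) *\<^sub>R h z" if z: "z \<in> ball 0 1" for z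
    proof -
      have "((\<lambda>z. z ^ n * q z) has_field_derivative of_nat n * z ^ (n - 1) * q z + z ^ n * deriv q z) (at z)"
        using z by (auto intro!: derivative_eq_intros holomorphic_derivI[OF q])
      then have "(?R has_field_derivative of_nat n * z ^ (n - 1) * q z + z ^ n * deriv q z) (at z)"
        by (rule has_field_derivative_transform_within_open[OF _ open_ball z]) (simp add: Rq)
      then have "deriv ?R z = of_nat n * z ^ (n - 1) * q z + z ^ n * deriv q z"
        by (rule DERIV_imp_deriv)
      also have "\<dots> = z ^ (n - 1) * (of_nat n * q z + z * deriv q z)"
        using j by (cases n) (simp_all add: algebra_simps)
      also have "z ^ (n - 1) = z ^ (n - j) * z ^ (j - 1)"
        using j False by (simp flip: power_add)
      finally have 1: "deriv ?R z = z ^ (n - j) * z ^ (j - 1) * (of_nat n * q z + z * deriv q z)" .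
      have 2: "deriv (disk_monomial j) z = of_nat j * z ^ (j - 1)"
        by (rule DERIV_imp_deriv[OF disk_monomial_has_deriv[OF z]])
      have zz: "z ^ (j - 1) * cnj (z ^ (j - 1)) = of_real (cmod z ^ (2 * (j - 1)))"
      proof -
        have "z ^ (j - 1) * cnj (z ^ (j - 1)) = (z * cnj z) ^ (j - 1)"
          by (simp add: power_mult_distrib)
        then show ?thesis unfolding complex_norm_square[symmetric] power_mult of_real_power[symmetric] .
      qed
      have "deriv ?R z * cnj (deriv (disk_monomial j) z) = (z ^ (j - 1) * cnj (z ^ (j - 1))) * h z"
        unfolding 1 2 h_def complex_cnj_mult complex_cnj_of_nat by (simp only: mult_ac)
      also have "\<dots> = of_real (cmod z ^ (2 * (j - 1))) * h z"
        by (simp only: zz)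
      finally have "deriv ?R z * cnj (deriv (disk_monomial j) z) = of_real (cmod z ^ (2 * (j - 1))) * h z" .
      then show ?thesis by (simp add: scaleR_conv_of_real)
    qed
    define \<rho> where "\<rho> r t = indicator {0..<r} t * ((1 + \<alpha>) / pi * (1 - t\<^sup>2) powr \<alpha> * t ^ (2 * (j - 1)))" for r t :: real
    have \<rho>F: "indicator (ball 0 r) z *\<^sub>R ?F z = \<rho> r (cmod z) *\<^sub>R h z" if "r < 1" for r z
      using that Fh[of z] by (auto simp: \<rho>_def indicator_def area_weight_inside mult_ac)
    have Z: "(LINT z|lborel. indicator (ball 0 r) z *\<^sub>R ?F z) = 0" if r: "r < 1" for r
      unfolding \<rho>F[OF r]
    proof (rule radial_integral_holomorphic(2)[OF h h0 r])
      show "\<rho> r \<in> borel_measurable borel" unfolding \<rho>_def[abs_def]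
        by (intro borel_measurable_times borel_measurable_indicator borel_measurable_const powr_real_measurable
          borel_measurable_diff borel_measurable_power) auto
      show "\<bar>\<rho> r t\<bar> \<le> (1 + \<alpha>) / pi" for t
      proof (cases "t \<in> {0..<r}")
        case True
        then have t: "0 \<le> t" "t < 1" using r by auto
        have "(1 - t\<^sup>2) powr \<alpha> \<le> 1"
          using t \<alpha> abs_square_less_1[of t] by (intro powr_le1) auto
        moreover have "t ^ (2 * (j - 1)) \<le> 1" using t by (intro power_le_one) auto
        ultimately have "(1 - t\<^sup>2) powr \<alpha> * t ^ (2 * (j - 1)) \<le> 1"
          using t by (intro mult_le_one) auto
        then have "(1 + \<alpha>) / pi * ((1 - t\<^sup>2) powr \<alpha> * t ^ (2 * (j - 1))) \<le> (1 + \<alpha>) / pi * 1"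
          using \<alpha> by (intro mult_left_mono) auto
        then show ?thesis using True t \<alpha> by (simp add: \<rho>_def abs_mult)
      qed (use \<alpha> in \<open>simp add: \<rho>_def\<close>)
      show "\<rho> r t = 0" if "t \<ge> r" for t using that by (simp add: \<rho>_def)
    qed
    define r where "r i = 1 - 1 / real (Suc i)" for i
    have r: "r i < 1" for i by (simp add: r_def)
    have r_lim: "r \<longlonglongrightarrow> 1"
      using tendsto_diff[OF tendsto_const[of "1::real"] LIMSEQ_inverse_real_of_nat] by (simp add: r_def[abs_def] inverse_eq_divide)
    have "(\<lambda>i. LINT z|lborel. indicator (ball 0 (r i)) z *\<^sub>R ?F z) \<longlonglongrightarrow> integral\<^sup>L lborel ?F"
    proof (rule integral_dominated_convergence[where w = "\<lambda>z. norm (?F z)"])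
      show "AE z in lborel. (\<lambda>i. indicator (ball 0 (r i)) z *\<^sub>R ?F z) \<longlonglongrightarrow> ?F z"
      proof (rule AE_I2)
        fix z
        show "(\<lambda>i. indicator (ball 0 (r i)) z *\<^sub>R ?F z) \<longlonglongrightarrow> ?F z"
        proof (cases "cmod z < 1")
          case True
          have "\<forall>\<^sub>F i in sequentially. indicator (ball 0 (r i)) z *\<^sub>R ?F z = ?F z"
            using order_tendstoD(1)[OF r_lim True] by eventually_elim simp
          then show ?thesis by (rule tendsto_eventually)
        qed (simp add: area_weight_outside)
      qed
      show "AE z in lborel. norm (indicator (ball 0 (r i)) z *\<^sub>R ?F z) \<le> norm (?F z)" for i
        by (rule AE_I2) (simp add: indicator_def)
      show Fm: "?F \<in> borel_measurable lborel" using F_int by (rule borel_measurable_integrable)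
      show "(\<lambda>z. indicator (ball 0 (r i)) z *\<^sub>R ?F z) \<in> borel_measurable lborel" for i
        by (rule borel_measurable_scaleR[OF borel_measurable_indicator Fm]) simp
      show "integrable lborel (\<lambda>z. norm (?F z))" by (rule integrable_norm[OF F_int])
    qed
    then show ?thesis unfolding Z[OF r] using LIMSEQ_unique tendsto_const by blast
  qed
  then show ?thesis
    unfolding dirichlet_inner_lborel(1)[OF \<alpha>' R disk_monomial_mem[OF \<alpha>]] using R0 by simp
qed

text \<open>Truncation is the orthogonal projection onto the polynomials of degree less than \<open>n\<close>.\<close>

lemma taylor_remainder_norm_le:
  assumes f: "f \<in> dirichlet_space \<alpha>"
  shows "dnorm \<alpha> (\<lambda>x. f x - taylor_trunc n f x) \<le> dnorm \<alpha> f"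
proof -
  let ?R = "\<lambda>x. f x - taylor_trunc n f x" and ?P = "taylor_trunc n f"
  have R: "?R \<in> dirichlet_space \<alpha>" by (intro D.diff_mem f taylor_trunc_mem)
  have "dirichlet_inner \<alpha> ?R (\<lambda>x. \<Sum>k\<in>A. taylor_coeff k f * disk_monomial k x) = 0 \<and>
      (\<lambda>x. \<Sum>k\<in>A. taylor_coeff k f * disk_monomial k x) \<in> dirichlet_space \<alpha>"
    if "finite A" "A \<subseteq> {..<n}" for A
    using that
  proof (induction rule: finite_induct)
    case empty
    show ?case using D.ip_scale_right[OF D.zero_mem R, of 0] by (simp add: D.zero_mem)
  next
    case (insert k A)
    then show ?case
      using D.ip_simps R disk_monomial_mem[OF \<alpha>] taylor_remainder_orthogonal_monomial[OF f, of k n] by simp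
  qed
  from this[of "{..<n}"] have "dirichlet_inner \<alpha> ?R ?P = 0" by (simp add: taylor_trunc_def)
  then have "(dnorm \<alpha> (\<lambda>x. ?R x + 1 * ?P x))\<^sup>2 = (dnorm \<alpha> ?R)\<^sup>2 + (dnorm \<alpha> ?P)\<^sup>2"
    using D.hnorm_add_scaled_power2[OF R taylor_trunc_mem, of 1 n f] by simp
  then have "(dnorm \<alpha> ?R)\<^sup>2 \<le> (dnorm \<alpha> f)\<^sup>2" by simp
  then show ?thesis by (rule power2_le_imp_le) (rule D.hnorm_nonneg)
qed

text \<open>The remainder is \<open>z ^ n\<close> times a holomorphic \<open>q\<close>, and its norm is at most 1, which bounds it on a
  circle of radius \<open>\<rho>\<close>. The maximum principle for \<open>q\<close> then gives the bound \<open>C (|z| / \<rho>) ^ n\<close> inside, as in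
  the Schwarz lemma, and Cauchy's estimate passes it on to the derivative.\<close>

lemma taylor_remainder_small:
  assumes r: "0 \<le> r" "r < 1" and e: "e > 0"
  obtains n where "\<And>f z. f \<in> dirichlet_space \<alpha> \<Longrightarrow> dnorm \<alpha> f \<le> 1 \<Longrightarrow> cmod z \<le> r \<Longrightarrow>
      cmod (f z - taylor_trunc n f z) \<le> e \<and> cmod (deriv (\<lambda>x. f x - taylor_trunc n f x) z) \<le> e"
proof -
  \<comment> \<open>Three nested radii \<open>r < s < \<rho> < 1\<close>; the gap between \<open>r\<close> and \<open>s\<close> is used for Cauchy's estimate.\<close>
  define \<rho> where "\<rho> = (2 + r) / 3"
  define s where "s = (1 + 2 * r) / 3"
  have rs: "r < s" "s < \<rho>" "\<rho> < 1" "0 < s" using r by (auto simp: \<rho>_def s_def)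
  obtain C where C: "C > 0" "\<And>f z. f \<in> dirichlet_space \<alpha> \<Longrightarrow> cmod z \<le> \<rho> \<Longrightarrow> cmod (f z) \<le> C * dnorm \<alpha> f"
    by (rule dirichlet_point_bounds[OF \<alpha>, of \<rho>]) (use rs in auto)
  have "(\<lambda>n. C * (s / \<rho>) ^ n) \<longlonglongrightarrow> 0"
    using rs by (intro tendsto_mult_right_zero LIMSEQ_power_zero) auto
  moreover have "0 < min e (e * (s - r))" using e rs by simp
  ultimately have "\<forall>\<^sub>F n in sequentially. C * (s / \<rho>) ^ n < min e (e * (s - r))"
    by (rule order_tendstoD(2))
  then obtain n where n: "C * (s / \<rho>) ^ n < min e (e * (s - r))" by (auto simp: eventually_sequentially)
  show thesis
  proof (rule that[of n])
    fix f z assume f: "f \<in> dirichlet_space \<alpha>" "dnorm \<alpha> f \<le> 1" and z: "cmod z \<le> r"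
    let ?R = "\<lambda>x. f x - taylor_trunc n f x"
    have R: "?R \<in> dirichlet_space \<alpha>" by (intro D.diff_mem f taylor_trunc_mem)
    obtain q where q: "q holomorphic_on ball 0 1" and Rq: "\<And>z. z \<in> ball 0 1 \<Longrightarrow> ?R z = z ^ n * q z"
      using taylor_remainder_factor[OF dirichlet_holomorphic[OF f(1)], of n] by blast
    have small: "cmod (?R w) \<le> C * (s / \<rho>) ^ n" if w: "cmod w \<le> s" for w
    proof -
      have "cmod (q w) \<le> C / \<rho> ^ n"
      proof (rule maximum_modulus_frontier[of q "ball 0 \<rho>"])
        show "q holomorphic_on interior (ball 0 \<rho>)"
          using rs by (auto intro: holomorphic_on_subset[OF q])
        show "continuous_on (closure (ball 0 \<rho>)) q"
          using rs by (auto intro!: continuous_on_subset[OF holomorphic_on_imp_continuous_on[OF q]])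
        fix x :: complex assume "x \<in> frontier (ball 0 \<rho>)"
        then have x: "cmod x = \<rho>" using rs by simp
        have "cmod (?R x) \<le> C * dnorm \<alpha> ?R" using x by (intro C R) simp
        also have "\<dots> \<le> C * 1"
          using C f taylor_remainder_norm_le[OF f(1), of n] by (intro mult_left_mono) auto
        finally have "\<rho> ^ n * cmod (q x) \<le> C"
          using Rq[of x] x rs by (simp add: norm_mult norm_power)
        then show "cmod (q x) \<le> C / \<rho> ^ n" using rs by (simp add: field_simps)
      qed (use w rs in auto)
      moreover have "cmod w ^ n \<le> s ^ n" using w by (intro power_mono) auto
      ultimately have "cmod w ^ n * cmod (q w) \<le> s ^ n * (C / \<rho> ^ n)"
        using rs by (intro mult_mono) auto
      then show ?thesis
        using Rq[of w] w rs by (simp add: norm_mult norm_power power_divide mult_ac)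
    qed
    have "norm ((deriv ^^ 1) ?R z) \<le> fact 1 * (C * (s / \<rho>) ^ n) / (s - r) ^ 1"
    proof (rule Cauchy_inequality)
      have sub: "cball z (s - r) \<subseteq> ball 0 1"
      proof
        fix w assume "w \<in> cball z (s - r)"
        then have "cmod (w - z) \<le> s - r" by (simp add: dist_norm norm_minus_commute)
        then show "w \<in> ball 0 1" using norm_triangle_sub[of w z] z rs by simp
      qed
      show "continuous_on (cball z (s - r)) ?R"
        by (rule continuous_on_subset[OF holomorphic_on_imp_continuous_on[OF dirichlet_holomorphic[OF R]] sub])
      show "?R holomorphic_on ball z (s - r)"
        by (rule holomorphic_on_subset[OF dirichlet_holomorphic[OF R]]) (use sub ball_subset_cball in blast)
      show "norm (?R x) \<le> C * (s / \<rho>) ^ n" if "norm (z - x) = s - r" for x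
        using that norm_triangle_sub[of x z] z by (intro small) (simp add: norm_minus_commute)
    qed (use rs in simp)
    then have "cmod (deriv ?R z) * (s - r) \<le> C * (s / \<rho>) ^ n" using rs by (simp add: pos_le_divide_eq)
    also have "\<dots> \<le> e * (s - r)" using n by simp
    finally have "cmod (deriv ?R z) \<le> e" using rs by simp
    then show "cmod (f z - taylor_trunc n f z) \<le> e \<and> cmod (deriv ?R z) \<le> e"
      using small[of z] z rs n by auto
  qed
qed

end

section \<open>Linear fractional self-maps near the circle\<close>

text \<open>The denominator has no zero on the closed disk, so everything extends to the circle. The formula for
  differences makes injectivity, the derivative and the expansion bound explicit.\<close>

lemma lft_self_map_cases:
  assumes "lft_self_map \<phi>"
  obtains D p q where "D \<noteq> 0"
    "\<And>z. cmod z \<le> 1 \<Longrightarrow> p * z + q \<noteq> 0"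
    "\<And>z w. cmod z \<le> 1 \<Longrightarrow> cmod w \<le> 1 \<Longrightarrow> \<phi> z - \<phi> w = D * (z - w) / ((p * z + q) * (p * w + q))"
    "\<And>z. cmod z \<le> 1 \<Longrightarrow> (\<phi> has_field_derivative D / (p * z + q)\<^sup>2) (at z)"
    "\<And>z. cmod z < 1 \<Longrightarrow> cmod (\<phi> z) < 1"
    "\<And>z. cmod z \<le> 1 \<Longrightarrow> cmod (\<phi> z) \<le> 1"
proof -
  from assms[unfolded lft_self_map_def] obtain a b c d where
    *: "a * d - b * c \<noteq> 0 \<and> (\<forall>z\<in>ball 0 1. c * z + d \<noteq> 0) \<and>
      (\<forall>z. \<phi> z = (a * z + b) / (c * z + d)) \<and> \<phi> ` ball 0 1 \<subseteq> ball 0 1"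
    by (elim exE)
  then have D: "a * d - b * c \<noteq> 0" and nz: "\<forall>z\<in>ball 0 1. c * z + d \<noteq> 0" by simp_all
  have \<phi>: "\<phi> = (\<lambda>z. (a * z + b) / (c * z + d))" using * by (intro ext) simp
  have in_ball: "cmod (\<phi> z) < 1" if "cmod z < 1" for z
  proof -
    have "\<phi> z \<in> \<phi> ` ball 0 1" using that by simp
    then show ?thesis using * by (metis mem_ball_0 subsetD)
  qed
  have "closure (ball 0 1) \<subseteq> {z. cmod (a * z + b) \<le> cmod (c * z + d)}"
  proof (rule closure_minimal)
    show "ball 0 1 \<subseteq> {z. cmod (a * z + b) \<le> cmod (c * z + d)}"
    proof
      fix z :: complex assume z: "z \<in> ball 0 1"
      then have "c * z + d \<noteq> 0" using nz by blast
      moreover have "cmod (a * z + b) / cmod (c * z + d) < 1"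
        using in_ball[of z] z by (simp add: \<phi> norm_divide)
      ultimately show "z \<in> {z. cmod (a * z + b) \<le> cmod (c * z + d)}"
        by (simp add: divide_less_eq)
    qed
    show "closed {z. cmod (a * z + b) \<le> cmod (c * z + d)}"
      by (intro closed_Collect_le continuous_intros)
  qed
  then have le: "cmod (a * z + b) \<le> cmod (c * z + d)" if "cmod z \<le> 1" for z
    using that by (auto simp: closure_ball)
  \<comment> \<open>At a zero of the denominator on the circle the numerator would vanish too, contradicting \<open>a d \<noteq> b c\<close>.\<close>
  have nz': "c * z + d \<noteq> 0" if "cmod z \<le> 1" for z
  proof
    assume 0: "c * z + d = 0"
    then have "a * z + b = 0" using le[OF that] by simp
    then have "b = - (a * z)" "d = - (c * z)" using 0 by (simp_all add: eq_neg_iff_add_eq_0 add.commute)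
    then show False using D by simp
  qed
  show thesis
  proof (rule that[of "a * d - b * c" c d])
    show "\<phi> z - \<phi> w = (a * d - b * c) * (z - w) / ((c * z + d) * (c * w + d))" if "cmod z \<le> 1" "cmod w \<le> 1" for z w
      using nz'[OF that(1)] nz'[OF that(2)] by (simp add: \<phi> field_simps)
    show "(\<phi> has_field_derivative (a * d - b * c) / (c * z + d)\<^sup>2) (at z)" if "cmod z \<le> 1" for z
    proof -
      have "((\<lambda>z. (a * z + b) / (c * z + d)) has_field_derivative (a * d - b * c) / (c * z + d)\<^sup>2) (at z)"
        using nz'[OF that] by (auto intro!: derivative_eq_intros simp: power2_eq_square field_simps)
      then show ?thesis unfolding \<phi> .
    qed
    show "cmod (\<phi> z) \<le> 1" if "cmod z \<le> 1" for z
      using le[OF that] nz'[OF that] by (simp add: \<phi> norm_divide divide_le_eq)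
  qed (use D nz' in_ball in auto)
qed

lemma lft_self_map_facts:
  assumes \<phi>: "lft_self_map \<phi>"
  shows lft_in_disk: "cmod z < 1 \<Longrightarrow> cmod (\<phi> z) < 1"
    and lft_in_cdisk: "cmod z \<le> 1 \<Longrightarrow> cmod (\<phi> z) \<le> 1"
    and lft_has_deriv: "cmod z \<le> 1 \<Longrightarrow> (\<phi> has_field_derivative deriv \<phi> z) (at z)"
    and lft_deriv_nonzero: "cmod z \<le> 1 \<Longrightarrow> deriv \<phi> z \<noteq> 0"
    and lft_holomorphic: "\<phi> holomorphic_on ball 0 1"
    and lft_inj: "inj_on \<phi> (ball 0 1)"
    and lft_continuous: "continuous_on (cball 0 1) \<phi>"
    and lft_deriv_continuous: "continuous_on (cball 0 1) (deriv \<phi>)"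
    and lft_expansion: "\<exists>k>0. \<forall>z w. cmod z \<le> 1 \<longrightarrow> cmod w \<le> 1 \<longrightarrow> k * cmod (z - w) \<le> cmod (\<phi> z - \<phi> w)"
proof -
  obtain D p q where D: "D \<noteq> 0" and nz: "\<And>z. cmod z \<le> 1 \<Longrightarrow> p * z + q \<noteq> 0"
    and diff: "\<And>z w. cmod z \<le> 1 \<Longrightarrow> cmod w \<le> 1 \<Longrightarrow> \<phi> z - \<phi> w = D * (z - w) / ((p * z + q) * (p * w + q))"
    and der: "\<And>z. cmod z \<le> 1 \<Longrightarrow> (\<phi> has_field_derivative D / (p * z + q)\<^sup>2) (at z)"
    and lt: "\<And>z. cmod z < 1 \<Longrightarrow> cmod (\<phi> z) < 1" and le: "\<And>z. cmod z \<le> 1 \<Longrightarrow> cmod (\<phi> z) \<le> 1"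
    by (rule lft_self_map_cases[OF \<phi>]) (rule that)
  have deriv: "deriv \<phi> z = D / (p * z + q)\<^sup>2" if "cmod z \<le> 1" for z
    by (rule DERIV_imp_deriv[OF der[OF that]])
  show "cmod z < 1 \<Longrightarrow> cmod (\<phi> z) < 1" by (rule lt)
  show "cmod z \<le> 1 \<Longrightarrow> cmod (\<phi> z) \<le> 1" by (rule le)
  show "cmod z \<le> 1 \<Longrightarrow> (\<phi> has_field_derivative deriv \<phi> z) (at z)" using der deriv by simp
  show "cmod z \<le> 1 \<Longrightarrow> deriv \<phi> z \<noteq> 0" using deriv D nz by simp
  show "\<phi> holomorphic_on ball 0 1"
    unfolding holomorphic_on_open[OF open_ball]
  proof
    fix z :: complex assume "z \<in> ball 0 1"
    then show "\<exists>f'. (\<phi> has_field_derivative f') (at z)" using der[of z] by auto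
  qed
  show "continuous_on (cball 0 1) \<phi>"
    by (rule DERIV_continuous_on[of _ _ "\<lambda>z. D / (p * z + q)\<^sup>2"]) (use has_field_derivative_at_within[OF der] in auto)
  have "continuous_on (cball 0 1) (\<lambda>z. D / (p * z + q)\<^sup>2)"
    by (intro continuous_intros) (use nz in auto)
  then show "continuous_on (cball 0 1) (deriv \<phi>)"
    by (rule continuous_on_cong[THEN iffD1, rotated 2]) (use deriv in auto)
  show "inj_on \<phi> (ball 0 1)"
  proof (rule inj_onI)
    fix z w :: complex assume zw: "z \<in> ball 0 1" "w \<in> ball 0 1" "\<phi> z = \<phi> w"
    then have "D * (z - w) / ((p * z + q) * (p * w + q)) = 0" using diff[of z w] by simp
    then show "z = w" using D nz[of z] nz[of w] zw by simp
  qed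
  define m where "m = cmod p + cmod q"
  have m: "cmod (p * z + q) \<le> m" if "cmod z \<le> 1" for z
    using norm_triangle_ineq[of "p * z" q] mult_left_le[OF that, of "cmod p"] by (simp add: m_def norm_mult)
  have "0 < cmod (p * 0 + q)" using nz[of 0] by simp
  also have "\<dots> \<le> m" by (rule m) simp
  finally have m0: "m > 0" .
  show "\<exists>k>0. \<forall>z w. cmod z \<le> 1 \<longrightarrow> cmod w \<le> 1 \<longrightarrow> k * cmod (z - w) \<le> cmod (\<phi> z - \<phi> w)"
  proof (intro exI[of _ "cmod D / m\<^sup>2"] conjI allI impI)
    fix z w assume zw: "cmod z \<le> 1" "cmod w \<le> 1"
    have "cmod (p * z + q) * cmod (p * w + q) \<le> m\<^sup>2"
      unfolding power2_eq_square using m[OF zw(1)] m[OF zw(2)] m0 by (intro mult_mono) auto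
    then have "cmod D * cmod (z - w) / m\<^sup>2 \<le> cmod D * cmod (z - w) / (cmod (p * z + q) * cmod (p * w + q))"
      using nz[OF zw(1)] nz[OF zw(2)] m0 by (intro divide_left_mono) auto
    then show "cmod D / m\<^sup>2 * cmod (z - w) \<le> cmod (\<phi> z - \<phi> w)"
      by (simp add: diff[OF zw] norm_mult norm_divide)
  qed (use D m0 in simp)
qed

text \<open>The real part of the Cayley transform is the Poisson kernel.\<close>

lemma Re_cayley:
  assumes "cmod \<mu> = 1" and "\<zeta> \<noteq> \<mu>"
  shows "Re ((\<mu> + \<zeta>) / (\<mu> - \<zeta>)) = (1 - (cmod \<zeta>)\<^sup>2) / (cmod (\<mu> - \<zeta>))\<^sup>2"
proof -
  have "Re ((\<mu> + \<zeta>) / (\<mu> - \<zeta>)) = Re ((\<mu> + \<zeta>) * cnj (\<mu> - \<zeta>)) / (cmod (\<mu> - \<zeta>))\<^sup>2"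
    unfolding complex_div_cnj[of "\<mu> + \<zeta>" "\<mu> - \<zeta>"] of_real_power[symmetric] Re_divide_of_real ..
  also have "Re ((\<mu> + \<zeta>) * cnj (\<mu> - \<zeta>)) = (cmod \<mu>)\<^sup>2 - (cmod \<zeta>)\<^sup>2"
    unfolding cmod_power2 by (simp add: power2_eq_square algebra_simps)
  finally show ?thesis using assms by simp
qed

text \<open>If one of the claims failed, a boundary point of the half-plane or a point far away in it would be sent
  out of the half-plane.\<close>

lemma right_half_plane_affine:
  assumes pos: "\<And>w. Re w > 0 \<Longrightarrow> Re (\<kappa> * w + b) > 0"
  shows "Im \<kappa> = 0" "Re \<kappa> \<ge> 0" "Re b \<ge> 0"
proof -
  show im: "Im \<kappa> = 0"
  proof (rule ccontr)
    assume "Im \<kappa> \<noteq> 0"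
    then show False using pos[of "Complex 1 ((Re \<kappa> + Re b) / Im \<kappa>)"] by simp
  qed
  have lin: "Re \<kappa> * x + Re b > 0" if "x > 0" for x
    using pos[of "of_real x"] that im by simp
  show "Re \<kappa> \<ge> 0"
  proof (rule ccontr)
    assume "\<not> Re \<kappa> \<ge> 0"
    then have k: "Re \<kappa> < 0" by simp
    then show False using lin[of "(\<bar>Re b\<bar> + 1) / (- Re \<kappa>)"] by (simp add: divide_pos_neg)
  qed
  show "Re b \<ge> 0"
  proof (rule ccontr)
    assume nb: "\<not> Re b \<ge> 0"
    define x where "x = - Re b / (2 * (Re \<kappa> + 1))"
    have "x > 0" using nb \<open>Re \<kappa> \<ge> 0\<close> unfolding x_def by (intro divide_pos_pos) auto
    moreover have "Re \<kappa> * x \<le> - Re b / 2"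
    proof -
      have "Re \<kappa> * x \<le> (Re \<kappa> + 1) * x" using \<open>x > 0\<close> by (intro mult_right_mono) auto
      also have "\<dots> = - Re b / 2" using \<open>Re \<kappa> \<ge> 0\<close> by (simp add: x_def field_simps)
      finally show ?thesis .
    qed
    ultimately show False using lin[of x] nb by simp
  qed
qed

text \<open>Cayley transforms at \<open>\<xi>\<close> and \<open>\<phi> \<xi>\<close> move both points to infinity and turn \<open>\<phi>\<close> into an affine map
  \<open>w \<mapsto> \<kappa> w + b\<close> of the right half-plane into itself. Hence \<open>\<kappa>\<close> is positive and \<open>Re b \<ge> 0\<close>. The value
  of \<open>\<kappa>\<close> is \<open>\<phi> \<xi> / (\<xi> \<phi>' \<xi>)\<close>, which gives the argument of the derivative, and comparing real parts,
  which are Poisson kernels, gives Julia's inequality.\<close>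

lemma lft_contact:
  assumes \<phi>: "lft_self_map \<phi>" and \<xi>: "cmod \<xi> = 1" and \<mu>: "cmod (\<phi> \<xi>) = 1"
  shows lft_contact_deriv: "deriv \<phi> \<xi> = of_real (cmod (deriv \<phi> \<xi>)) * (\<phi> \<xi> / \<xi>)"
    and lft_julia: "cmod z < 1 \<Longrightarrow> (1 - (cmod z)\<^sup>2) / (cmod (\<xi> - z))\<^sup>2 \<le>
      cmod (deriv \<phi> \<xi>) * ((1 - (cmod (\<phi> z))\<^sup>2) / (cmod (\<phi> \<xi> - \<phi> z))\<^sup>2)"
proof -
  obtain D p q where D: "D \<noteq> 0" and nz: "\<And>z. cmod z \<le> 1 \<Longrightarrow> p * z + q \<noteq> 0"
    and diff: "\<And>z w. cmod z \<le> 1 \<Longrightarrow> cmod w \<le> 1 \<Longrightarrow> \<phi> z - \<phi> w = D * (z - w) / ((p * z + q) * (p * w + q))"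
    and der: "\<And>z. cmod z \<le> 1 \<Longrightarrow> (\<phi> has_field_derivative D / (p * z + q)\<^sup>2) (at z)"
    and lt: "\<And>z. cmod z < 1 \<Longrightarrow> cmod (\<phi> z) < 1" and le: "\<And>z. cmod z \<le> 1 \<Longrightarrow> cmod (\<phi> z) \<le> 1"
    by (rule lft_self_map_cases[OF \<phi>]) (rule that)
  define E where "E = p * \<xi> + q"
  have E: "E \<noteq> 0" using nz[of \<xi>] \<xi> by (simp add: E_def)
  have d: "deriv \<phi> \<xi> = D / E\<^sup>2" unfolding E_def by (rule DERIV_imp_deriv[OF der]) (simp add: \<xi>)
  have nz0: "\<xi> \<noteq> 0" "\<phi> \<xi> \<noteq> 0" using \<xi> \<mu> by auto
  define \<kappa> where "\<kappa> = \<phi> \<xi> * E\<^sup>2 / (\<xi> * D)"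
  define b where "b = \<kappa> - 2 * \<phi> \<xi> * E * p / D - 1"
  have conj: "(\<phi> \<xi> + \<phi> z) / (\<phi> \<xi> - \<phi> z) = \<kappa> * ((\<xi> + z) / (\<xi> - z)) + b" if z: "cmod z < 1" for z
  proof -
    have zl: "\<xi> - z \<noteq> 0" using z \<xi> by auto
    have F: "p * z + q \<noteq> 0" using nz[of z] z by simp
    have df: "\<phi> \<xi> - \<phi> z = D * (\<xi> - z) / (E * (p * z + q))"
      using diff[of \<xi> z] z \<xi> by (simp add: E_def)
    have ne: "\<phi> \<xi> - \<phi> z \<noteq> 0" using df D zl E F by simp
    have "(\<phi> \<xi> + \<phi> z) / (\<phi> \<xi> - \<phi> z) = 2 * \<phi> \<xi> / (\<phi> \<xi> - \<phi> z) - 1"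
      using ne by (simp add: field_simps)
    also have "2 * \<phi> \<xi> / (\<phi> \<xi> - \<phi> z) = 2 * \<phi> \<xi> * E * (p * z + q) / (D * (\<xi> - z))"
      unfolding df using D zl E F by (simp add: field_simps)
    also have "p * z + q = E - p * (\<xi> - z)" by (simp add: E_def algebra_simps)
    also have "2 * \<phi> \<xi> * E * (E - p * (\<xi> - z)) / (D * (\<xi> - z)) = 2 * \<phi> \<xi> * E\<^sup>2 / (D * (\<xi> - z)) - 2 * \<phi> \<xi> * E * p / D"
      using D zl by (simp add: field_simps power2_eq_square)
    also have "2 * \<phi> \<xi> * E\<^sup>2 / (D * (\<xi> - z)) = \<kappa> * (2 * \<xi> / (\<xi> - z))"
      using nz0 by (simp add: \<kappa>_def)
    also have "2 * \<xi> / (\<xi> - z) = (\<xi> + z) / (\<xi> - z) + 1"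
      using zl by (simp add: field_simps)
    finally show ?thesis by (simp add: b_def algebra_simps)
  qed
  have pos: "Re (\<kappa> * w + b) > 0" if w: "Re w > 0" for w
  proof -
    \<comment> \<open>The preimage of \<open>w\<close> under the Cayley transform at \<open>\<xi>\<close>.\<close>
    define z where "z = \<xi> * ((w - 1) / (w + 1))"
    have w1: "w + 1 \<noteq> 0" using w by (auto simp: complex_eq_iff)
    have "(cmod (w - 1))\<^sup>2 < (cmod (w + 1))\<^sup>2"
      using w unfolding cmod_power2 by (simp add: power2_eq_square algebra_simps)
    then have "cmod (w - 1) < cmod (w + 1)" by (rule power2_less_imp_less) simp
    then have z: "cmod z < 1" using \<xi> w1 by (simp add: z_def norm_mult norm_divide)
    have "(\<xi> + z) / (\<xi> - z) = w"
    proof -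
      have "\<xi> + z = 2 * \<xi> * w / (w + 1)" "\<xi> - z = 2 * \<xi> / (w + 1)"
        using w1 by (simp_all add: z_def field_simps)
      then show ?thesis using w1 nz0 by simp
    qed
    then have "Re (\<kappa> * w + b) = Re ((\<phi> \<xi> + \<phi> z) / (\<phi> \<xi> - \<phi> z))" using conj[OF z] by simp
    also have "\<dots> = (1 - (cmod (\<phi> z))\<^sup>2) / (cmod (\<phi> \<xi> - \<phi> z))\<^sup>2"
      using lt[OF z] \<mu> by (intro Re_cayley) auto
    also have "\<dots> > 0" using lt[OF z] \<mu> abs_square_less_1[of "cmod (\<phi> z)"] by (intro divide_pos_pos) auto
    finally show ?thesis .
  qed
  note \<kappa>b = right_half_plane_affine[OF pos]
  have \<kappa>_norm: "cmod \<kappa> = 1 / cmod (deriv \<phi> \<xi>)"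
    using \<xi> \<mu> by (simp add: \<kappa>_def d norm_mult norm_divide)
  have \<kappa>_real: "\<kappa> = of_real (cmod \<kappa>)"
    using \<kappa>b by (simp add: complex_eq_iff cmod_eq_Re)
  have d0: "cmod (deriv \<phi> \<xi>) > 0" using d D E by simp
  have "deriv \<phi> \<xi> * \<kappa> = \<phi> \<xi> / \<xi>" using d D E by (simp add: \<kappa>_def)
  then have "deriv \<phi> \<xi> * of_real (cmod \<kappa>) = \<phi> \<xi> / \<xi>" using \<kappa>_real by simp
  then show "deriv \<phi> \<xi> = of_real (cmod (deriv \<phi> \<xi>)) * (\<phi> \<xi> / \<xi>)"
    unfolding \<kappa>_norm using d0 by (simp add: field_simps)
  assume z: "cmod z < 1"
  have "cmod \<kappa> * ((1 - (cmod z)\<^sup>2) / (cmod (\<xi> - z))\<^sup>2) = Re (\<kappa> * ((\<xi> + z) / (\<xi> - z)))"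
  proof -
    have "Re (\<kappa> * X) = cmod \<kappa> * Re X" for X
    proof -
      have "Re (\<kappa> * X) = Re (of_real (cmod \<kappa>) * X)" by (simp only: \<kappa>_real[symmetric])
      then show ?thesis by simp
    qed
    moreover have "Re ((\<xi> + z) / (\<xi> - z)) = (1 - (cmod z)\<^sup>2) / (cmod (\<xi> - z))\<^sup>2"
      using z \<xi> by (intro Re_cayley) auto
    ultimately show ?thesis by (simp only:)
  qed
  also have "\<dots> \<le> Re (\<kappa> * ((\<xi> + z) / (\<xi> - z)) + b)" using \<kappa>b by simp
  also have "\<dots> = (1 - (cmod (\<phi> z))\<^sup>2) / (cmod (\<phi> \<xi> - \<phi> z))\<^sup>2"
    unfolding conj[OF z, symmetric] using lt[OF z] \<mu> by (intro Re_cayley) auto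
  finally have "cmod \<kappa> * ((1 - (cmod z)\<^sup>2) / (cmod (\<xi> - z))\<^sup>2) \<le> (1 - (cmod (\<phi> z))\<^sup>2) / (cmod (\<phi> \<xi> - \<phi> z))\<^sup>2" .
  then have "cmod (deriv \<phi> \<xi>) * (cmod \<kappa> * ((1 - (cmod z)\<^sup>2) / (cmod (\<xi> - z))\<^sup>2)) \<le>
      cmod (deriv \<phi> \<xi>) * ((1 - (cmod (\<phi> z))\<^sup>2) / (cmod (\<phi> \<xi> - \<phi> z))\<^sup>2)"
    by (rule mult_left_mono) simp
  moreover have "cmod (deriv \<phi> \<xi>) * (cmod \<kappa> * X) = X" for X
    unfolding \<kappa>_norm using d0 by simp
  ultimately show "(1 - (cmod z)\<^sup>2) / (cmod (\<xi> - z))\<^sup>2 \<le>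
      cmod (deriv \<phi> \<xi>) * ((1 - (cmod (\<phi> z))\<^sup>2) / (cmod (\<phi> \<xi> - \<phi> z))\<^sup>2)"
    by (simp only:)
qed

text \<open>The quotient that compares the weight at \<open>z\<close> with the weight at \<open>\<phi> z\<close>.\<close>

definition boundary_ratio :: "(complex \<Rightarrow> complex) \<Rightarrow> complex \<Rightarrow> real" where
  "boundary_ratio \<phi> z = (1 - (cmod z)\<^sup>2) / (1 - (cmod (\<phi> z))\<^sup>2)"

lemma boundary_ratio_pos: "lft_self_map \<phi> \<Longrightarrow> cmod z < 1 \<Longrightarrow> 0 < boundary_ratio \<phi> z"
  using abs_square_less_1[of "cmod z"] abs_square_less_1[of "cmod (\<phi> z)"] lft_in_disk[of \<phi> z]
  by (simp add: boundary_ratio_def)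

text \<open>The Schwarz lemma for \<open>\<phi>\<close> followed by the automorphism that moves \<open>\<phi> 0\<close> to 0.\<close>

lemma boundary_ratio_bounded:
  assumes \<phi>: "lft_self_map \<phi>"
  obtains M where "M > 0" "\<And>z. cmod z < 1 \<Longrightarrow> boundary_ratio \<phi> z \<le> M"
proof -
  define w where "w = \<phi> 0"
  have w: "cmod w < 1" using lft_in_disk[OF \<phi>, of 0] by (simp add: w_def)
  define g where "g z = Moebius_function 0 w (\<phi> z)" for z
  have hol: "g holomorphic_on ball 0 1" unfolding g_def
    by (rule holomorphic_on_compose_gen[OF lft_holomorphic[OF \<phi>] Moebius_function_holomorphic[OF w], unfolded o_def])
       (use lft_in_disk[OF \<phi>] in auto)
  have g0: "g 0 = 0" by (simp add: g_def w_def Moebius_function_eq_zero)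
  have g1: "cmod (g z) < 1" if "cmod z < 1" for z
    unfolding g_def by (rule Moebius_function_norm_lt_1[OF w lft_in_disk[OF \<phi> that]])
  define M where "M = 1 / (1 - cmod w)\<^sup>2"
  have "boundary_ratio \<phi> z \<le> M" if z: "cmod z < 1" for z
  proof -
    let ?u = "\<phi> z"
    have u: "cmod ?u < 1" by (rule lft_in_disk[OF \<phi> z])
    have "cmod (w * cnj ?u) \<le> cmod w" using u by (simp add: norm_mult mult_left_le)
    have wu: "cmod (cnj w * ?u) \<le> cmod w" using u by (simp add: norm_mult mult_left_le)
    then have den: "1 - cmod w \<le> cmod (1 - cnj w * ?u)"
      using norm_triangle_ineq2[of 1 "cnj w * ?u"] by simp
    have "cmod (g z) \<le> cmod z" by (rule Schwarz_Lemma(1)[OF hol g0 g1 z])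
    then have "(cmod (g z))\<^sup>2 \<le> (cmod z)\<^sup>2" by (rule power_mono) simp
    then have "1 - (cmod z)\<^sup>2 \<le> 1 - (cmod (g z))\<^sup>2" by simp
    also have "\<dots> = ((cmod (1 - cnj w * ?u))\<^sup>2 - (cmod (?u - w))\<^sup>2) / (cmod (1 - cnj w * ?u))\<^sup>2"
    proof -
      have "(cmod (g z))\<^sup>2 = (cmod (?u - w))\<^sup>2 / (cmod (1 - cnj w * ?u))\<^sup>2"
        by (simp add: g_def Moebius_function_simple norm_divide power_divide)
      moreover have "(cmod (1 - cnj w * ?u))\<^sup>2 \<noteq> 0" using den w by auto
      ultimately show ?thesis by (simp only: diff_divide_distrib) simp
    qed
    also have "(cmod (1 - cnj w * ?u))\<^sup>2 - (cmod (?u - w))\<^sup>2 = (1 - (cmod w)\<^sup>2) * (1 - (cmod ?u)\<^sup>2)"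
      unfolding cmod_power2 by (simp add: power2_eq_square algebra_simps)
    also have "\<dots> / (cmod (1 - cnj w * ?u))\<^sup>2 \<le> (1 * (1 - (cmod ?u)\<^sup>2)) / (1 - cmod w)\<^sup>2"
      using w u den abs_square_less_1[of "cmod w"] abs_square_less_1[of "cmod ?u"]
      by (intro frac_le mult_right_mono mult_nonneg_nonneg power_mono) auto
    finally have "1 - (cmod z)\<^sup>2 \<le> M * (1 - (cmod ?u)\<^sup>2)" by (simp add: M_def)
    then show ?thesis
      using abs_square_less_1[of "cmod ?u"] u by (simp add: boundary_ratio_def pos_divide_le_eq)
  qed
  moreover have "M > 0" using w by (simp add: M_def)
  ultimately show thesis using that by blast
qed

text \<open>At a contact point Julia's inequality bounds the quotient by \<open>|\<phi>' \<xi>| / |(\<phi> z - \<phi> \<xi>) / (z - \<xi>)|\<^sup>2\<close>. At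
  other points the denominator \<open>1 - |\<phi> z|\<^sup>2\<close> stays away from 0.\<close>

lemma boundary_ratio_upper_limit:
  assumes \<phi>: "lft_self_map \<phi>" and \<xi>: "cmod \<xi> = 1"
  obtains B where "(B \<longlongrightarrow> (if cmod (\<phi> \<xi>) = 1 then 1 / cmod (deriv \<phi> \<xi>) else 0)) (at \<xi> within ball 0 1)"
    "\<And>z. cmod z < 1 \<Longrightarrow> boundary_ratio \<phi> z \<le> B z"
proof (cases "cmod (\<phi> \<xi>) = 1")
  case True
  let ?s = "cmod (deriv \<phi> \<xi>)"
  define B where "B z = ?s / (cmod ((\<phi> z - \<phi> \<xi>) / (z - \<xi>)))\<^sup>2" for z
  have s: "?s > 0" using lft_deriv_nonzero[OF \<phi>, of \<xi>] \<xi> by simp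
  have "((\<lambda>z. (\<phi> z - \<phi> \<xi>) / (z - \<xi>)) \<longlongrightarrow> deriv \<phi> \<xi>) (at \<xi> within ball 0 1)"
    using has_field_derivative_at_within[OF lft_has_deriv[OF \<phi>], of \<xi> "ball 0 1"] \<xi>
    by (simp add: has_field_derivative_iff)
  then have "(B \<longlongrightarrow> ?s / ?s\<^sup>2) (at \<xi> within ball 0 1)"
    unfolding B_def by (intro tendsto_intros) (use s in auto)
  then have lim: "(B \<longlongrightarrow> 1 / ?s) (at \<xi> within ball 0 1)" using s by (simp add: power2_eq_square)
  have "boundary_ratio \<phi> z \<le> B z" if z: "cmod z < 1" for z
  proof -
    have z1: "(cmod (\<phi> z))\<^sup>2 < 1" using lft_in_disk[OF \<phi> z] abs_square_less_1[of "cmod (\<phi> z)"] by simp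
    have ne: "\<xi> \<noteq> z" "\<phi> \<xi> \<noteq> \<phi> z" using z \<xi> True lft_in_disk[OF \<phi> z] by auto
    have "(1 - (cmod z)\<^sup>2) / (cmod (\<xi> - z))\<^sup>2 \<le> ?s * ((1 - (cmod (\<phi> z))\<^sup>2) / (cmod (\<phi> \<xi> - \<phi> z))\<^sup>2)"
      by (rule lft_julia[OF \<phi> \<xi> True z])
    then have "(1 - (cmod z)\<^sup>2) / (cmod (\<xi> - z))\<^sup>2 * (cmod (\<xi> - z))\<^sup>2 \<le>
        ?s * ((1 - (cmod (\<phi> z))\<^sup>2) / (cmod (\<phi> \<xi> - \<phi> z))\<^sup>2) * (cmod (\<xi> - z))\<^sup>2"
      by (rule mult_right_mono) simp
    then have "1 - (cmod z)\<^sup>2 \<le> (?s * (cmod (\<xi> - z))\<^sup>2 / (cmod (\<phi> \<xi> - \<phi> z))\<^sup>2) * (1 - (cmod (\<phi> z))\<^sup>2)"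
      using ne by (simp add: mult_ac)
    then have "boundary_ratio \<phi> z \<le> ?s * (cmod (\<xi> - z))\<^sup>2 / (cmod (\<phi> \<xi> - \<phi> z))\<^sup>2"
      using z1 by (simp add: boundary_ratio_def pos_divide_le_eq)
    also have "\<dots> = B z"
      by (simp add: B_def norm_divide power_divide norm_minus_commute)
    finally show ?thesis .
  qed
  with lim True show thesis using that by simp
next
  case False
  have lt: "cmod (\<phi> \<xi>) < 1" using False lft_in_cdisk[OF \<phi>, of \<xi>] \<xi> by simp
  have cont: "(\<phi> \<longlongrightarrow> \<phi> \<xi>) (at \<xi> within ball 0 1)"
  proof -
    have "isCont \<phi> \<xi>" using lft_has_deriv[OF \<phi>, of \<xi>] \<xi> by (intro DERIV_isCont[of \<phi> "deriv \<phi> \<xi>"]) simp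
    then show ?thesis unfolding isCont_def by (rule tendsto_within_subset) simp
  qed
  have "((\<lambda>z. boundary_ratio \<phi> z) \<longlongrightarrow> (1 - (cmod \<xi>)\<^sup>2) / (1 - (cmod (\<phi> \<xi>))\<^sup>2)) (at \<xi> within ball 0 1)"
    unfolding boundary_ratio_def using lt abs_square_less_1[of "cmod (\<phi> \<xi>)"] by (intro tendsto_intros cont) auto
  then show thesis using False \<xi> that[of "boundary_ratio \<phi>"] by simp
qed

section \<open>Composition operators\<close>

lemma comp_op_facts:
  assumes \<phi>: "lft_self_map \<phi>" and f: "f \<in> dirichlet_space \<alpha>"
  shows comp_op_holomorphic: "comp_op \<phi> f holomorphic_on ball 0 1"
    and comp_op_deriv: "cmod z < 1 \<Longrightarrow> deriv (comp_op \<phi> f) z = deriv f (\<phi> z) * deriv \<phi> z"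
    and comp_op_zero: "comp_op \<phi> f 0 = f (\<phi> 0)"
proof -
  have der: "(comp_op \<phi> f has_field_derivative deriv f (\<phi> z) * deriv \<phi> z) (at z)" if z: "z \<in> ball 0 1" for z
  proof (rule has_field_derivative_transform_within_open[OF _ open_ball z])
    show "((\<lambda>z. f (\<phi> z)) has_field_derivative deriv f (\<phi> z) * deriv \<phi> z) (at z)"
      using z lft_in_disk[OF \<phi>, of z]
      by (intro DERIV_chain2[OF dirichlet_has_deriv[OF f] lft_has_deriv[OF \<phi>]]) auto
  qed (simp add: comp_op_def)
  show "comp_op \<phi> f holomorphic_on ball 0 1"
    unfolding holomorphic_on_open[OF open_ball] using der by blast
  show "cmod z < 1 \<Longrightarrow> deriv (comp_op \<phi> f) z = deriv f (\<phi> z) * deriv \<phi> z"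
    using DERIV_imp_deriv[OF der[of z]] by simp
  show "comp_op \<phi> f 0 = f (\<phi> 0)" by (simp add: comp_op_def)
qed

text \<open>The integrand of the squared norm of \<open>f\<close> after the change of variables \<open>w = \<phi> z\<close>.\<close>

definition pullback_density :: "real \<Rightarrow> (complex \<Rightarrow> complex) \<Rightarrow> (complex \<Rightarrow> complex) \<Rightarrow> complex \<Rightarrow> real" where
  "pullback_density \<alpha> \<phi> f z =
     indicator (ball 0 1) z * (area_weight \<alpha> (\<phi> z) * (cmod (deriv f (\<phi> z) * deriv \<phi> z))\<^sup>2)"

lemma pullback_density_integral:
  assumes \<alpha>: "-1 < \<alpha>" and \<phi>: "lft_self_map \<phi>" and f: "f \<in> dirichlet_space \<alpha>"
  shows "integrable lborel (pullback_density \<alpha> \<phi> f)"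
    and "integral\<^sup>L lborel (pullback_density \<alpha> \<phi> f) \<le> (dnorm \<alpha> f)\<^sup>2"
proof -
  let ?F = "\<lambda>w. area_weight \<alpha> w * (cmod (deriv f w))\<^sup>2"
  let ?B = "ball (0::complex) 1"
  have F: "integrable lborel ?F" by (rule dirichlet_integrable[OF \<alpha> f])
  then have Fm: "?F \<in> borel_measurable borel" by (auto dest: borel_measurable_integrable)
  have op: "open (\<phi> ` ?B)" by (rule open_mapping_thm3[OF lft_holomorphic[OF \<phi>] open_ball lft_inj[OF \<phi>]])
  then have im: "\<phi> ` ?B \<in> sets borel" by simp
  have Fm': "set_borel_measurable borel (\<phi> ` ?B) ?F"
    unfolding set_borel_measurable_def by (rule borel_measurable_scaleR[OF borel_measurable_indicator[OF im] Fm])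
  have Fi: "set_integrable lborel (\<phi> ` ?B) ?F"
    unfolding set_integrable_def by (rule integrable_mult_indicator[OF _ F]) (use im in simp)
  note cv = holomorphic_change_of_variables[OF open_ball lft_holomorphic[OF \<phi>] lft_inj[OF \<phi>] Fm' Fi]
  have eq: "pullback_density \<alpha> \<phi> f z = indicator ?B z *\<^sub>R ((cmod (deriv \<phi> z))\<^sup>2 * ?F (\<phi> z))" for z
    by (simp add: pullback_density_def norm_mult power_mult_distrib mult_ac)
  show "integrable lborel (pullback_density \<alpha> \<phi> f)"
    using cv(1) unfolding set_integrable_def eq[abs_def] .
  have "integral\<^sup>L lborel (pullback_density \<alpha> \<phi> f) = (LINT w:\<phi> ` ?B|lborel. ?F w)"
    using cv(2) unfolding set_lebesgue_integral_def eq[abs_def] .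
  also have "\<dots> \<le> integral\<^sup>L lborel ?F"
    unfolding set_lebesgue_integral_def using Fi area_weight_nonneg[OF \<alpha>]
    by (intro integral_mono F) (auto simp: set_integrable_def indicator_def)
  also have "\<dots> \<le> (dnorm \<alpha> f)\<^sup>2"
    unfolding dirichlet_hnorm[OF \<alpha> f] by simp
  finally show "integral\<^sup>L lborel (pullback_density \<alpha> \<phi> f) \<le> (dnorm \<alpha> f)\<^sup>2" .
qed

lemma area_weight_boundary_ratio:
  assumes \<phi>: "lft_self_map \<phi>" and z: "cmod z < 1"
  shows "area_weight \<alpha> z = boundary_ratio \<phi> z powr \<alpha> * area_weight \<alpha> (\<phi> z)"
proof -
  have 1: "(cmod z)\<^sup>2 < 1" "(cmod (\<phi> z))\<^sup>2 < 1"
    using z lft_in_disk[OF \<phi> z] abs_square_less_1[of "cmod z"] abs_square_less_1[of "cmod (\<phi> z)"] by simp_all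
  then have "(1 - (cmod z)\<^sup>2) powr \<alpha> = boundary_ratio \<phi> z powr \<alpha> * (1 - (cmod (\<phi> z))\<^sup>2) powr \<alpha>"
    by (simp add: boundary_ratio_def powr_divide)
  then show ?thesis using z lft_in_disk[OF \<phi> z] by (simp add: area_weight_inside)
qed

lemma comp_op_density_le:
  assumes \<alpha>: "0 < \<alpha>" and \<phi>: "lft_self_map \<phi>" and f: "f \<in> dirichlet_space \<alpha>"
    and M: "\<And>z. cmod z < 1 \<Longrightarrow> boundary_ratio \<phi> z \<le> M"
  shows "area_weight \<alpha> z * (cmod (deriv (comp_op \<phi> f) z))\<^sup>2 \<le> M powr \<alpha> * pullback_density \<alpha> \<phi> f z"
proof (cases "cmod z < 1")
  case True
  have "boundary_ratio \<phi> z powr \<alpha> \<le> M powr \<alpha>"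
    using M[OF True] boundary_ratio_pos[OF \<phi> True] \<alpha> by (intro powr_mono2) auto
  then have "boundary_ratio \<phi> z powr \<alpha> * pullback_density \<alpha> \<phi> f z \<le> M powr \<alpha> * pullback_density \<alpha> \<phi> f z"
    by (rule mult_right_mono) (use \<alpha> area_weight_nonneg in \<open>simp add: pullback_density_def\<close>)
  moreover have "area_weight \<alpha> z * (cmod (deriv (comp_op \<phi> f) z))\<^sup>2 = boundary_ratio \<phi> z powr \<alpha> * pullback_density \<alpha> \<phi> f z"
    unfolding area_weight_boundary_ratio[OF \<phi> True, of \<alpha>] comp_op_deriv[OF \<phi> f True]
    using True by (simp add: pullback_density_def)
  ultimately show ?thesis by simp
qed (use \<alpha> in \<open>simp add: area_weight_outside pullback_density_def\<close>)

lemma comp_op_mem: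
  assumes \<alpha>: "0 < \<alpha>" and \<phi>: "lft_self_map \<phi>" and f: "f \<in> dirichlet_space \<alpha>"
  shows "comp_op \<phi> f \<in> dirichlet_space \<alpha>"
proof -
  have \<alpha>': "-1 < \<alpha>" using \<alpha> by simp
  obtain M where M: "\<And>z. cmod z < 1 \<Longrightarrow> boundary_ratio \<phi> z \<le> M"
    using boundary_ratio_bounded[OF \<phi>] by blast
  have cont: "continuous_on (ball 0 1) (\<lambda>z. (cmod (deriv (comp_op \<phi> f) z))\<^sup>2)"
    by (intro continuous_intros holomorphic_on_imp_continuous_on holomorphic_deriv comp_op_holomorphic[OF \<phi> f]) auto
  have "integrable lborel (\<lambda>z. area_weight \<alpha> z * (cmod (deriv (comp_op \<phi> f) z))\<^sup>2)"
  proof (rule Bochner_Integration.integrable_bound)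
    show "integrable lborel (\<lambda>z. M powr \<alpha> * pullback_density \<alpha> \<phi> f z)"
      by (intro integrable_mult_right pullback_density_integral[OF \<alpha>' \<phi> f])
    show "(\<lambda>z. area_weight \<alpha> z * (cmod (deriv (comp_op \<phi> f) z))\<^sup>2) \<in> borel_measurable lborel"
      using borel_measurable_area_weight[OF \<alpha>' cont] by simp
    show "AE z in lborel. norm (area_weight \<alpha> z * (cmod (deriv (comp_op \<phi> f) z))\<^sup>2) \<le> norm (M powr \<alpha> * pullback_density \<alpha> \<phi> f z)"
    proof (rule AE_I2)
      fix z
      have "0 \<le> area_weight \<alpha> z * (cmod (deriv (comp_op \<phi> f) z))\<^sup>2"
        using area_weight_nonneg[OF \<alpha>'] by simp
      moreover have "area_weight \<alpha> z * (cmod (deriv (comp_op \<phi> f) z))\<^sup>2 \<le> M powr \<alpha> * pullback_density \<alpha> \<phi> f z"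
        by (rule comp_op_density_le[OF \<alpha> \<phi> f M])
      ultimately show "norm (area_weight \<alpha> z * (cmod (deriv (comp_op \<phi> f) z))\<^sup>2) \<le> norm (M powr \<alpha> * pullback_density \<alpha> \<phi> f z)"
        unfolding real_norm_def by linarith
    qed
  qed
  then show ?thesis
    using comp_op_holomorphic[OF \<phi> f] by (simp add: dirichlet_space_iff[OF \<alpha>']) (simp add: comp_op_def)
qed

lemma comp_op_bounded:
  assumes \<alpha>: "0 < \<alpha>" and \<phi>: "lft_self_map \<phi>"
  shows "function_hilbert_space.bounded_op (dirichlet_space \<alpha>) (dirichlet_inner \<alpha>) (comp_op \<phi>)"
proof -
  interpret D: function_hilbert_space "dirichlet_space \<alpha>" "dirichlet_inner \<alpha>"
    by (rule dirichlet_hilbert_space[OF \<alpha>])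
  have \<alpha>': "-1 < \<alpha>" using \<alpha> by simp
  let ?N = "dnorm \<alpha>"
  obtain M where M: "\<And>z. cmod z < 1 \<Longrightarrow> boundary_ratio \<phi> z \<le> M"
    using boundary_ratio_bounded[OF \<phi>] by blast
  obtain C where C: "C > 0" "\<And>f z. f \<in> dirichlet_space \<alpha> \<Longrightarrow> cmod z \<le> cmod (\<phi> 0) \<Longrightarrow> cmod (f z) \<le> C * ?N f"
    by (rule dirichlet_point_bounds[OF \<alpha> norm_ge_zero lft_in_disk[OF \<phi>, of 0]]) (simp, rule that)
  have lin: "linear_op (dirichlet_space \<alpha>) (comp_op \<phi>)"
    using comp_op_mem[OF \<alpha> \<phi>] by (auto simp: linear_op_def comp_op_def fun_eq_iff)
  show ?thesis
  proof (rule D.bounded_opI(2)[OF lin])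
    fix f assume f: "f \<in> dirichlet_space \<alpha>" "?N f \<le> 1"
    have nn: "0 \<le> ?N f" by (rule D.hnorm_nonneg)
    have "cmod (f (\<phi> 0)) \<le> C * 1"
      using C(2)[OF f(1), of "\<phi> 0"] f(2) C(1) by (intro order_trans[OF C(2)[OF f(1)] mult_left_mono]) auto
    then have v: "(cmod (comp_op \<phi> f 0))\<^sup>2 \<le> C\<^sup>2"
      unfolding comp_op_zero[OF \<phi> f(1)] by (intro power_mono) auto
    have "(LINT z|lborel. area_weight \<alpha> z * (cmod (deriv (comp_op \<phi> f) z))\<^sup>2) \<le>
        (LINT z|lborel. M powr \<alpha> * pullback_density \<alpha> \<phi> f z)"
      by (intro integral_mono comp_op_density_le[OF \<alpha> \<phi> f(1) M] integrable_mult_right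
          pullback_density_integral[OF \<alpha>' \<phi> f(1)] dirichlet_integrable[OF \<alpha>' comp_op_mem[OF \<alpha> \<phi> f(1)]])
    also have "\<dots> = M powr \<alpha> * integral\<^sup>L lborel (pullback_density \<alpha> \<phi> f)" by simp
    also have "\<dots> \<le> M powr \<alpha> * 1"
      using pullback_density_integral(2)[OF \<alpha>' \<phi> f(1)] power_le_one[OF nn f(2), of 2] by (intro mult_left_mono) auto
    finally have "(?N (comp_op \<phi> f))\<^sup>2 \<le> C\<^sup>2 + M powr \<alpha>"
      unfolding dirichlet_hnorm[OF \<alpha>' comp_op_mem[OF \<alpha> \<phi> f(1)]] using v by linarith
    then show "?N (comp_op \<phi> f) \<le> sqrt (C\<^sup>2 + M powr \<alpha>)" by (rule real_le_rsqrt)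
  qed
qed

section \<open>The upper estimate\<close>

text \<open>Every point of the circle has a neighbourhood in which the quantity is less than \<open>q\<close>: the upper
  limits multiply, and the product is 0 unless both maps touch the circle there. By compactness these neighbourhoods
  cover an annulus.\<close>

lemma boundary_ratio_product_small:
  assumes \<alpha>: "0 < \<alpha>" and \<phi>: "lft_self_map \<phi>" and \<psi>: "lft_self_map \<psi>" and q: "q > 0"
    and contact: "\<And>\<xi>. \<xi> \<in> common_contact \<phi> \<psi> \<Longrightarrow> (1 / (cmod (deriv \<phi> \<xi>) * cmod (deriv \<psi> \<xi>))) powr (\<alpha> / 2) < q"
  obtains r where "0 \<le> r" "r < 1" "\<And>z. r < cmod z \<Longrightarrow> cmod z < 1 \<Longrightarrow> (boundary_ratio \<phi> z * boundary_ratio \<psi> z) powr (\<alpha> / 2) < q"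
proof -
  let ?R = "\<lambda>z. (boundary_ratio \<phi> z * boundary_ratio \<psi> z) powr (\<alpha> / 2)"
  have local: "\<exists>U. open U \<and> \<xi> \<in> U \<and> (\<forall>z\<in>U. cmod z < 1 \<longrightarrow> ?R z < q)" if \<xi>: "cmod \<xi> = 1" for \<xi>
  proof -
    define L where "L \<phi> = (if cmod (\<phi> \<xi>) = 1 then 1 / cmod (deriv \<phi> \<xi>) else 0)" for \<phi> :: "complex \<Rightarrow> complex"
    obtain A where A: "(A \<longlongrightarrow> L \<phi>) (at \<xi> within ball 0 1)" "\<And>z. cmod z < 1 \<Longrightarrow> boundary_ratio \<phi> z \<le> A z"
      unfolding L_def using boundary_ratio_upper_limit[OF \<phi> \<xi>] by blast
    obtain B where B: "(B \<longlongrightarrow> L \<psi>) (at \<xi> within ball 0 1)" "\<And>z. cmod z < 1 \<Longrightarrow> boundary_ratio \<psi> z \<le> B z"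
      unfolding L_def using boundary_ratio_upper_limit[OF \<psi> \<xi>] by blast
    have AB: "((\<lambda>z. A z * B z) \<longlongrightarrow> L \<phi> * L \<psi>) (at \<xi> within ball 0 1)"
      by (intro tendsto_intros A B)
    have ball: "\<forall>\<^sub>F z in at \<xi> within ball 0 1. cmod z < 1"
      by (auto simp: eventually_at_filter)
    have nn: "\<forall>\<^sub>F z in at \<xi> within ball 0 1. 0 \<le> A z * B z"
      using ball
    proof eventually_elim
      case (elim z)
      have "0 \<le> boundary_ratio \<phi> z" "0 \<le> boundary_ratio \<psi> z"
        using boundary_ratio_pos[OF \<phi> elim] boundary_ratio_pos[OF \<psi> elim] by simp_all
      then show ?case using A(2)[OF elim] B(2)[OF elim] by (intro mult_nonneg_nonneg) auto
    qed
    have lim: "((\<lambda>z. (A z * B z) powr (\<alpha> / 2)) \<longlongrightarrow> (L \<phi> * L \<psi>) powr (\<alpha> / 2)) (at \<xi> within ball 0 1)"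
      using \<alpha> nn by (intro tendsto_powr' AB tendsto_const) auto
    have "(L \<phi> * L \<psi>) powr (\<alpha> / 2) < q"
    proof (cases "\<xi> \<in> common_contact \<phi> \<psi>")
      case True
      then show ?thesis using contact[OF True] by (simp add: L_def common_contact_def)
    next
      case False
      then have eq: "L \<phi> * L \<psi> = 0" using \<xi> by (auto simp: L_def common_contact_def)
      show ?thesis unfolding eq using q by simp
    qed
    from order_tendstoD(2)[OF lim this] have "\<forall>\<^sub>F z in at \<xi> within ball 0 1. ?R z < q"
      using ball
    proof eventually_elim
      case (elim z)
      have "0 \<le> boundary_ratio \<phi> z" "0 \<le> boundary_ratio \<psi> z"
        using boundary_ratio_pos[OF \<phi> elim(2)] boundary_ratio_pos[OF \<psi> elim(2)] by simp_all
      then have "?R z \<le> (A z * B z) powr (\<alpha> / 2)"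
        using A(2)[OF elim(2)] B(2)[OF elim(2)] \<alpha> by (intro powr_mono2 mult_mono) auto
      then show ?case using elim(1) by linarith
    qed
    then obtain U where "open U" "\<xi> \<in> U" "\<forall>z\<in>U. z \<noteq> \<xi> \<longrightarrow> z \<in> ball 0 1 \<longrightarrow> ?R z < q"
      unfolding eventually_at_topological by blast
    then show ?thesis using \<xi> by (intro exI[of _ U]) auto
  qed
  define V where "V = \<Union>{U. open U \<and> (\<forall>z\<in>U. cmod z < 1 \<longrightarrow> ?R z < q)}"
  have V: "open V" "\<And>z. z \<in> V \<Longrightarrow> cmod z < 1 \<Longrightarrow> ?R z < q"
    by (auto simp: V_def)
  have sphere: "\<xi> \<in> V" if \<xi>: "cmod \<xi> = 1" for \<xi>
    using local[OF \<xi>] unfolding V_def by blast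
  have cpt: "compact (cball 0 1 - V)" by (intro compact_diff compact_cball V(1))
  show thesis
  proof (cases "cball 0 1 - V = {}")
    case True
    then have "z \<in> V" if "cmod z < 1" for z using that by auto
    then show thesis using V(2) by (intro that[of 0]) simp_all
  next
    case False
    obtain x where x: "x \<in> cball 0 1 - V" "\<And>y. y \<in> cball 0 1 - V \<Longrightarrow> cmod y \<le> cmod x"
      using continuous_attains_sup[OF cpt False continuous_on_norm[OF continuous_on_id]] by blast
    have "cmod x < 1" using x(1) sphere[of x] by (auto simp: order_le_less)
    moreover have "z \<in> V" if "cmod x < cmod z" "cmod z < 1" for z
      by (rule ccontr) (use x(2)[of z] that in auto)
    ultimately show thesis using V(2) by (intro that[of "cmod x"]) simp_all
  qed
qed

text \<open>On the annulus the weight at \<open>z\<close> is less than \<open>q\<close> times the geometric mean of the weights at \<open>\<phi> z\<close> and \<open>\<psi> z\<close>, and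
  the inequality between geometric and arithmetic means, with both norms at most 1, gives \<open>q\<close>. On the smaller
  disk and for the point values it is enough that the Taylor remainder and its derivative are uniformly small.\<close>

lemma comp_op_inner_bound:
  assumes \<alpha>: "0 < \<alpha>" and \<phi>: "lft_self_map \<phi>" and \<psi>: "lft_self_map \<psi>"
    and r: "0 \<le> r" "r < 1" and q: "q > 0"
    and small: "\<And>z. r < cmod z \<Longrightarrow> cmod z < 1 \<Longrightarrow> (boundary_ratio \<phi> z * boundary_ratio \<psi> z) powr (\<alpha> / 2) < q"
    and \<eta>: "\<eta> > 0"
  obtains n where "\<And>f g. f \<in> dirichlet_space \<alpha> \<Longrightarrow> g \<in> dirichlet_space \<alpha> \<Longrightarrow>
      dnorm \<alpha> f \<le> 1 \<Longrightarrow> dnorm \<alpha> g \<le> 1 \<Longrightarrow>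
      cmod (dirichlet_inner \<alpha> (comp_op \<phi> (\<lambda>x. f x - taylor_trunc n f x)) (comp_op \<psi> g)) \<le> q + \<eta>"
proof -
  interpret D: function_hilbert_space "dirichlet_space \<alpha>" "dirichlet_inner \<alpha>"
    by (rule dirichlet_hilbert_space[OF \<alpha>])
  have \<alpha>': "-1 < \<alpha>" using \<alpha> by simp
  let ?N = "dnorm \<alpha>" and ?H = "dirichlet_space \<alpha>"
  obtain M where M: "M > 0" "\<And>z. cmod z < 1 \<Longrightarrow> boundary_ratio \<psi> z \<le> M"
    using boundary_ratio_bounded[OF \<psi>] by blast
  obtain L where L: "\<And>z. cmod z \<le> 1 \<Longrightarrow> cmod (deriv \<phi> z) \<le> L"
  proof -
    have "compact (deriv \<phi> ` cball 0 1)"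
      by (intro compact_continuous_image lft_deriv_continuous[OF \<phi>]) simp
    then have "bounded (deriv \<phi> ` cball 0 1)" by (rule compact_imp_bounded)
    then obtain B where "\<forall>x\<in>cball 0 1. cmod (deriv \<phi> x) \<le> B" by (auto simp: bounded_iff)
    then show thesis by (intro that[of B]) simp
  qed
  have L0: "L \<ge> 0" using L[of 0] norm_ge_zero[of "deriv \<phi> 0"] by (simp del: norm_ge_zero)
  obtain C where C: "C > 0" "\<And>f z. f \<in> ?H \<Longrightarrow> cmod z \<le> cmod (\<psi> 0) \<Longrightarrow> cmod (f z) \<le> C * ?N f"
    by (rule dirichlet_point_bounds[OF \<alpha> norm_ge_zero lft_in_disk[OF \<psi>, of 0]]) (simp, rule that)
  obtain r' where r': "0 \<le> r'" "r' < 1" "\<And>z. cmod z \<le> r \<Longrightarrow> cmod (\<phi> z) \<le> r'"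
  proof -
    have "continuous_on (cball 0 r) (\<lambda>z. cmod (\<phi> z))"
      using r by (intro continuous_on_norm continuous_on_subset[OF lft_continuous[OF \<phi>]]) auto
    then obtain x where x: "x \<in> cball 0 r" "\<And>y. y \<in> cball 0 r \<Longrightarrow> cmod (\<phi> y) \<le> cmod (\<phi> x)"
      using continuous_attains_sup[of "cball (0::complex) r" "\<lambda>z. cmod (\<phi> z)"] r by auto
    show thesis
      by (rule that[of "cmod (\<phi> x)"]) (use x r lft_in_disk[OF \<phi>, of x] in auto)
  qed
  define A where "A = integral\<^sup>L lborel (area_weight \<alpha>)"
  have A0: "A \<ge> 0" unfolding A_def using area_weight_nonneg[OF \<alpha>'] by (intro Bochner_Integration.integral_nonneg)
  \<comment> \<open>Bound for the contribution of the inner disk and of the point values, per unit of the size \<open>e\<close> of the remainder.\<close>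
  define K where "K = C + L * (A + M powr \<alpha>)"
  have K0: "K \<ge> 0" using C L0 A0 by (simp add: K_def)
  define e where "e = \<eta> / (K + 1)"
  have e0: "e > 0" using \<eta> K0 by (simp add: e_def)
  have eK: "e * K \<le> \<eta>"
    using \<eta> K0 by (simp add: e_def pos_divide_le_eq mult_left_mono)
  obtain n where n: "\<And>f z. f \<in> ?H \<Longrightarrow> ?N f \<le> 1 \<Longrightarrow> cmod z \<le> r' \<Longrightarrow>
      cmod (f z - taylor_trunc n f z) \<le> e \<and> cmod (deriv (\<lambda>x. f x - taylor_trunc n f x) z) \<le> e"
    by (rule taylor_remainder_small[OF \<alpha> r'(1,2) e0]) (rule that)
  show thesis
  proof (rule that[of n])
    fix f g assume f: "f \<in> ?H" and g: "g \<in> ?H" and f1: "?N f \<le> 1" and g1: "?N g \<le> 1"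
    define h where "h = (\<lambda>x. f x - taylor_trunc n f x)"
    have h: "h \<in> ?H" unfolding h_def by (intro D.diff_mem f taylor_trunc_mem[OF \<alpha>])
    have h1: "?N h \<le> 1" unfolding h_def using taylor_remainder_norm_le[OF \<alpha> f, of n] f1 by linarith
    note Ch = comp_op_mem[OF \<alpha> \<phi> h] and Cg = comp_op_mem[OF \<alpha> \<psi> g]
    let ?u = "deriv (comp_op \<phi> h)" and ?v = "deriv (comp_op \<psi> g)"
    let ?P = "pullback_density \<alpha> \<phi> h" and ?Q = "pullback_density \<alpha> \<psi> g"
    let ?V = "\<lambda>z. area_weight \<alpha> z * (cmod (?v z))\<^sup>2"
    \<comment> \<open>The first summand accounts for the annulus, the second for the inner disk.\<close>
    have point: "norm (area_weight \<alpha> z *\<^sub>R (?u z * cnj (?v z))) \<le>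
        q / 2 * (?P z + ?Q z) + e * L / 2 * (area_weight \<alpha> z + ?V z)" for z
    proof (cases "cmod z < 1")
      case z: True
      have P0: "0 \<le> ?P z" "0 \<le> ?Q z" "0 \<le> area_weight \<alpha> z" "0 \<le> ?V z"
        using area_weight_nonneg[OF \<alpha>'] by (auto simp: pullback_density_def)
      have lhs: "norm (area_weight \<alpha> z *\<^sub>R (?u z * cnj (?v z))) = area_weight \<alpha> z * (cmod (?u z) * cmod (?v z))"
        using P0(3) by (simp add: norm_mult)
      show ?thesis
      proof (cases "cmod z \<le> r")
        case True
        have "cmod (\<phi> z) \<le> r'" by (rule r'(3)[OF True])
        then have "cmod (deriv h (\<phi> z)) \<le> e" unfolding h_def using n[OF f f1] by blast
        then have "cmod (?u z) \<le> e * L"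
          unfolding comp_op_deriv[OF \<phi> h z] norm_mult using L[of z] z e0 by (intro mult_mono) auto
        moreover have "cmod (?v z) \<le> (1 + (cmod (?v z))\<^sup>2) / 2"
          using zero_le_power2[of "cmod (?v z) - 1"] by (simp add: power2_diff)
        ultimately have "cmod (?u z) * cmod (?v z) \<le> (e * L) * ((1 + (cmod (?v z))\<^sup>2) / 2)"
          using e0 L0 by (intro mult_mono) auto
        then have "area_weight \<alpha> z * (cmod (?u z) * cmod (?v z)) \<le> area_weight \<alpha> z * ((e * L) * ((1 + (cmod (?v z))\<^sup>2) / 2))"
          using P0(3) by (rule mult_left_mono)
        also have "\<dots> = e * L / 2 * (area_weight \<alpha> z + ?V z)" by (simp add: algebra_simps)
        also have "\<dots> \<le> q / 2 * (?P z + ?Q z) + e * L / 2 * (area_weight \<alpha> z + ?V z)"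
          using q P0 by simp
        finally show ?thesis unfolding lhs .
      next
        case False
        let ?a = "area_weight \<alpha> (\<phi> z)" and ?b = "area_weight \<alpha> (\<psi> z)"
        let ?rp = "boundary_ratio \<phi> z" and ?rs = "boundary_ratio \<psi> z"
        have r0: "0 < ?rp" "0 < ?rs" using boundary_ratio_pos[OF \<phi> z] boundary_ratio_pos[OF \<psi> z] by auto
        have ab: "0 \<le> ?a" "0 \<le> ?b" using area_weight_nonneg[OF \<alpha>'] by auto
        have PQ: "?P z = (sqrt ?a * cmod (?u z))\<^sup>2" "?Q z = (sqrt ?b * cmod (?v z))\<^sup>2"
          unfolding comp_op_deriv[OF \<phi> h z] comp_op_deriv[OF \<psi> g z]
          using z ab by (simp_all add: pullback_density_def power_mult_distrib)
        have "(area_weight \<alpha> z)\<^sup>2 = ((?rp * ?rs) powr (\<alpha> / 2) * (sqrt ?a * sqrt ?b))\<^sup>2"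
        proof -
          have "((?rp * ?rs) powr (\<alpha> / 2))\<^sup>2 = ?rp powr \<alpha> * ?rs powr \<alpha>"
            using r0 by (simp add: powr_mult power_mult_distrib flip: powr_numeral powr_realpow)
               (simp add: powr_powr)
          then have "((?rp * ?rs) powr (\<alpha> / 2) * (sqrt ?a * sqrt ?b))\<^sup>2 = (?rp powr \<alpha> * ?a) * (?rs powr \<alpha> * ?b)"
            using ab by (simp add: power_mult_distrib)
          also have "\<dots> = area_weight \<alpha> z * area_weight \<alpha> z"
            unfolding area_weight_boundary_ratio[OF \<phi> z, symmetric] area_weight_boundary_ratio[OF \<psi> z, symmetric] ..
          finally show ?thesis by (simp add: power2_eq_square)
        qed
        then have W: "area_weight \<alpha> z = (?rp * ?rs) powr (\<alpha> / 2) * (sqrt ?a * sqrt ?b)"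
          using P0(3) ab by (simp add: power2_eq_iff_nonneg)
        have "area_weight \<alpha> z * (cmod (?u z) * cmod (?v z)) =
            (?rp * ?rs) powr (\<alpha> / 2) * ((sqrt ?a * cmod (?u z)) * (sqrt ?b * cmod (?v z)))"
          unfolding W by (simp add: mult_ac)
        also have "\<dots> \<le> q * (((sqrt ?a * cmod (?u z))\<^sup>2 + (sqrt ?b * cmod (?v z))\<^sup>2) / 2)"
        proof (rule mult_mono)
          show "(?rp * ?rs) powr (\<alpha> / 2) \<le> q" using small[of z] False z by simp
          show "(sqrt ?a * cmod (?u z)) * (sqrt ?b * cmod (?v z)) \<le> ((sqrt ?a * cmod (?u z))\<^sup>2 + (sqrt ?b * cmod (?v z))\<^sup>2) / 2"
            using sum_squares_bound[of "sqrt ?a * cmod (?u z)" "sqrt ?b * cmod (?v z)"] by simp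
        qed (use q ab in auto)
        also have "\<dots> = q / 2 * (?P z + ?Q z)" unfolding PQ by simp
        also have "\<dots> \<le> q / 2 * (?P z + ?Q z) + e * L / 2 * (area_weight \<alpha> z + ?V z)"
          using e0 L0 P0 by simp
        finally show ?thesis unfolding lhs .
      qed
    qed (simp add: area_weight_outside pullback_density_def)
    have V_le: "integral\<^sup>L lborel ?V \<le> M powr \<alpha>"
    proof -
      have "integral\<^sup>L lborel ?V \<le> (LINT z|lborel. M powr \<alpha> * ?Q z)"
        by (intro integral_mono comp_op_density_le[OF \<alpha> \<psi> g M(2)] integrable_mult_right
            pullback_density_integral(1)[OF \<alpha>' \<psi> g] dirichlet_integrable[OF \<alpha>' Cg])
      also have "\<dots> = M powr \<alpha> * integral\<^sup>L lborel ?Q" by simp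
      also have "\<dots> \<le> M powr \<alpha> * 1"
        using pullback_density_integral(2)[OF \<alpha>' \<psi> g] power_le_one[OF D.hnorm_nonneg g1, of 2]
        by (intro mult_left_mono) auto
      finally show ?thesis by simp
    qed
    note ints = pullback_density_integral(1)[OF \<alpha>' \<phi> h] pullback_density_integral(1)[OF \<alpha>' \<psi> g]
      integrable_area_weight[OF \<alpha>] dirichlet_integrable[OF \<alpha>' Cg]
    have "cmod (LINT z|lborel. area_weight \<alpha> z *\<^sub>R (?u z * cnj (?v z))) \<le>
        (LINT z|lborel. norm (area_weight \<alpha> z *\<^sub>R (?u z * cnj (?v z))))"
      by (rule integral_norm_bound)
    also have "\<dots> \<le> (LINT z|lborel. q / 2 * (?P z + ?Q z) + e * L / 2 * (area_weight \<alpha> z + ?V z))"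
      by (intro integral_mono integrable_norm dirichlet_inner_lborel(2)[OF \<alpha>' Ch Cg] point
          Bochner_Integration.integrable_add integrable_mult_right ints)
    also have "\<dots> = q / 2 * (integral\<^sup>L lborel ?P + integral\<^sup>L lborel ?Q) + e * L / 2 * (A + integral\<^sup>L lborel ?V)"
      using ints by (simp add: A_def)
    also have "\<dots> \<le> q / 2 * (1 + 1) + e * L / 2 * (A + M powr \<alpha>)"
    proof (intro add_mono mult_left_mono)
      show "integral\<^sup>L lborel ?P \<le> 1"
        using pullback_density_integral(2)[OF \<alpha>' \<phi> h] power_le_one[OF D.hnorm_nonneg h1, of 2] by linarith
      show "integral\<^sup>L lborel ?Q \<le> 1"
        using pullback_density_integral(2)[OF \<alpha>' \<psi> g] power_le_one[OF D.hnorm_nonneg g1, of 2] by linarith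
    qed (use V_le q e0 L0 in auto)
    also have "\<dots> \<le> q + e * (L * (A + M powr \<alpha>))"
    proof -
      define X where "X = e * (L * (A + M powr \<alpha>))"
      have "0 \<le> X" using e0 L0 A0 by (simp add: X_def)
      moreover have "q / 2 * (1 + 1) + e * L / 2 * (A + M powr \<alpha>) = q + X / 2" by (simp add: X_def)
      ultimately show ?thesis unfolding X_def[symmetric] by simp
    qed
    finally have int: "cmod (LINT z|lborel. area_weight \<alpha> z *\<^sub>R (?u z * cnj (?v z))) \<le> q + e * (L * (A + M powr \<alpha>))" .
    have "cmod (h (\<phi> 0)) \<le> e"
      unfolding h_def using n[OF f f1, of "\<phi> 0"] r'(3)[of 0] r(1) by simp
    moreover have "cmod (g (\<psi> 0)) \<le> C * 1"
      using g1 C(1) by (intro order_trans[OF C(2)[OF g order_refl]] mult_left_mono) auto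
    ultimately have "cmod (h (\<phi> 0) * cnj (g (\<psi> 0))) \<le> e * (C * 1)"
      unfolding norm_mult complex_mod_cnj using e0 by (intro mult_mono) auto
    then have "cmod (dirichlet_inner \<alpha> (comp_op \<phi> h) (comp_op \<psi> g)) \<le> e * (C * 1) + (q + e * (L * (A + M powr \<alpha>)))"
      unfolding dirichlet_inner_lborel(1)[OF \<alpha>' Ch Cg] comp_op_zero[OF \<phi> h] comp_op_zero[OF \<psi> g]
      using int by (intro norm_triangle_mono)
    also have "\<dots> = q + e * K" by (simp add: K_def algebra_simps)
    also have "\<dots> \<le> q + \<eta>" using eK by simp
    finally show "cmod (dirichlet_inner \<alpha> (comp_op \<phi> (\<lambda>x. f x - taylor_trunc n f x)) (comp_op \<psi> g)) \<le> q + \<eta>"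
      unfolding h_def .
  qed
qed

context
  fixes \<alpha> :: real and \<phi> \<psi> :: "complex \<Rightarrow> complex"
  assumes \<alpha>: "0 < \<alpha>" and \<phi>: "lft_self_map \<phi>" and \<psi>: "lft_self_map \<psi>"
begin

interpretation D: function_hilbert_space "dirichlet_space \<alpha>" "dirichlet_inner \<alpha>"
  by (rule dirichlet_hilbert_space[OF \<alpha>])

lemma adjoint_comp_op_bounded:
  "function_hilbert_space.bounded_op (dirichlet_space \<alpha>) (dirichlet_inner \<alpha>)
     (hilbert_adjoint (dirichlet_space \<alpha>) (dirichlet_inner \<alpha>) (comp_op \<psi>) \<circ> comp_op \<phi>)"
  by (intro D.bounded_op_compose D.bounded_op_adjoint comp_op_bounded \<alpha> \<phi> \<psi>)

lemma inner_adjoint_comp_op: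
  assumes f: "f \<in> dirichlet_space \<alpha>" and g: "g \<in> dirichlet_space \<alpha>"
  shows "dirichlet_inner \<alpha> ((hilbert_adjoint (dirichlet_space \<alpha>) (dirichlet_inner \<alpha>) (comp_op \<psi>) \<circ> comp_op \<phi>) f) g
    = dirichlet_inner \<alpha> (comp_op \<phi> f) (comp_op \<psi> g)"
proof -
  note b = comp_op_bounded[OF \<alpha> \<psi>] and m = comp_op_mem[OF \<alpha> \<phi> f] comp_op_mem[OF \<alpha> \<psi> g]
  have "dirichlet_inner \<alpha> (hilbert_adjoint (dirichlet_space \<alpha>) (dirichlet_inner \<alpha>) (comp_op \<psi>) (comp_op \<phi> f)) g
      = cnj (dirichlet_inner \<alpha> g (hilbert_adjoint (dirichlet_space \<alpha>) (dirichlet_inner \<alpha>) (comp_op \<psi>) (comp_op \<phi> f)))"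
    by (rule D.ip_cnj[OF g D.hilbert_adjoint_mem[OF b m(1)]])
  also have "\<dots> = cnj (dirichlet_inner \<alpha> (comp_op \<psi> g) (comp_op \<phi> f))"
    by (simp only: D.ip_hilbert_adjoint[OF b m(1) g])
  also have "\<dots> = dirichlet_inner \<alpha> (comp_op \<phi> f) (comp_op \<psi> g)"
    using D.ip_cnj[OF m] by simp
  finally show ?thesis by simp
qed

text \<open>Taylor truncation followed by the operator has finite rank, hence is compact, and the difference is
  estimated through the sesquilinear form.\<close>

lemma ess_norm_upper:
  assumes q: "q > 0"
    and contact: "\<And>\<xi>. \<xi> \<in> common_contact \<phi> \<psi> \<Longrightarrow> (1 / (cmod (deriv \<phi> \<xi>) * cmod (deriv \<psi> \<xi>))) powr (\<alpha> / 2) < q"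
  shows "ess_norm (dirichlet_space \<alpha>) (dirichlet_inner \<alpha>)
     (hilbert_adjoint (dirichlet_space \<alpha>) (dirichlet_inner \<alpha>) (comp_op \<psi>) \<circ> comp_op \<phi>) \<le> q"
proof (rule field_le_epsilon)
  fix \<eta> :: real assume \<eta>: "\<eta> > 0"
  let ?T = "hilbert_adjoint (dirichlet_space \<alpha>) (dirichlet_inner \<alpha>) (comp_op \<psi>) \<circ> comp_op \<phi>"
  let ?N = "dnorm \<alpha>" and ?H = "dirichlet_space \<alpha>"
  have T: "linear_op ?H ?T" by (rule D.bounded_op_linear[OF adjoint_comp_op_bounded])
  obtain r where r: "0 \<le> r" "r < 1" "\<And>z. r < cmod z \<Longrightarrow> cmod z < 1 \<Longrightarrow> (boundary_ratio \<phi> z * boundary_ratio \<psi> z) powr (\<alpha> / 2) < q"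
    by (rule boundary_ratio_product_small[OF \<alpha> \<phi> \<psi> q contact]) (assumption, rule that)
  obtain n where n: "\<And>f g. f \<in> ?H \<Longrightarrow> g \<in> ?H \<Longrightarrow> ?N f \<le> 1 \<Longrightarrow> ?N g \<le> 1 \<Longrightarrow>
      cmod (dirichlet_inner \<alpha> (comp_op \<phi> (\<lambda>x. f x - taylor_trunc n f x)) (comp_op \<psi> g)) \<le> q + \<eta>"
    by (rule comp_op_inner_bound[OF \<alpha> \<phi> \<psi> r(1,2) q r(3) \<eta>]) (assumption, assumption, rule that)
  define K where "K f = ?T (taylor_trunc n f)" for f
  note mono = disk_monomial_mem[OF \<alpha>] and tr = taylor_trunc_mem[OF \<alpha>]
  have K_rep: "K f = (\<lambda>x. \<Sum>k<n. taylor_coeff k f * ?T (disk_monomial k) x)" for f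
    unfolding K_def taylor_trunc_def
    using D.linear_op_sum[OF T, of "{..<n}" disk_monomial "\<lambda>k. taylor_coeff k f"] mono by simp
  have "linear_op ?H K"
    unfolding linear_op_def
  proof (intro conjI ballI allI image_subsetI)
    show "K f \<in> ?H" for f unfolding K_def by (rule D.linear_op_mem[OF T tr])
    show "K (\<lambda>x. a * f x + b * g x) = (\<lambda>x. a * K f x + b * K g x)" if "f \<in> ?H" "g \<in> ?H" for f g a b
      unfolding K_rep taylor_coeff_lin[OF dirichlet_holomorphic[OF that(1)] dirichlet_holomorphic[OF that(2)]]
      by (simp add: distrib_right sum.distrib sum_distrib_left mult.assoc)
  qed
  moreover have "\<exists>B. \<forall>f. f \<in> ?H \<longrightarrow> ?N f \<le> 1 \<longrightarrow> cmod (taylor_coeff k f) \<le> B" for k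
    using taylor_coeff_bounded[OF \<alpha>, of k] by metis
  then obtain B where B: "\<And>k f. f \<in> ?H \<Longrightarrow> ?N f \<le> 1 \<Longrightarrow> cmod (taylor_coeff k f) \<le> B k" by metis
  ultimately have K: "compact_op ?H (dirichlet_inner \<alpha>) K"
    using K_rep by (intro D.compact_op_finite_rank[of K n "\<lambda>k. ?T (disk_monomial k)" taylor_coeff B])
      (auto intro: D.linear_op_mem[OF T mono, unfolded o_def])
  show "ess_norm ?H (dirichlet_inner \<alpha>) ?T \<le> q + \<eta>"
  proof (rule D.ess_norm_le[OF adjoint_comp_op_bounded K])
    fix f assume f: "f \<in> ?H" "?N f \<le> 1"
    have d: "(\<lambda>x. f x - taylor_trunc n f x) \<in> ?H" by (intro D.diff_mem f tr)
    have "(\<lambda>x. ?T f x - K f x) = ?T (\<lambda>x. f x - taylor_trunc n f x)"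
      unfolding K_def by (rule D.linear_op_diff[OF T f(1) tr, symmetric])
    moreover have "?N (?T (\<lambda>x. f x - taylor_trunc n f x)) \<le> q + \<eta>"
    proof (rule D.hnorm_le_dual[OF D.linear_op_mem[OF T d]])
      fix g assume g: "g \<in> ?H" "?N g \<le> 1"
      show "cmod (dirichlet_inner \<alpha> (?T (\<lambda>x. f x - taylor_trunc n f x)) g) \<le> q + \<eta>"
        unfolding inner_adjoint_comp_op[OF d g(1)] by (rule n[OF f(1) g(1) f(2) g(2)])
    qed
    ultimately show "?N (\<lambda>x. ?T f x - K f x) \<le> q + \<eta>" by simp
  qed
qed

end

section \<open>Peak functions at a boundary point\<close>

text \<open>The function is dominated by the series of \<open>(n + 1)\<^sup>-\<^sup>4\<close> times indicators of disks of radius \<open>n + 1\<close>, whose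
  integral is the sum of \<open>\<pi> / (n + 1)\<^sup>2\<close>.\<close>

lemma integrable_inverse_fourth_power: "integrable lborel (\<lambda>w::complex. 1 / (1 + cmod w) ^ 4)"
proof (rule integrableI_bounded)
  show "(\<lambda>w::complex. 1 / (1 + cmod w) ^ 4) \<in> borel_measurable lborel" by measurable
  have le: "ennreal (norm (1 / (1 + cmod w) ^ 4)) \<le> (\<Sum>n. ennreal (1 / real (Suc n) ^ 4) * indicator (ball 0 (real (Suc n))) w)" for w :: complex
  proof -
    define n where "n = nat \<lfloor>cmod w\<rfloor>"
    have "real n = of_int \<lfloor>cmod w\<rfloor>" by (simp add: n_def)
    then have n: "real n \<le> cmod w" "cmod w < real (Suc n)"
      using of_int_floor_le[of "cmod w"] real_of_int_floor_add_one_gt[of "cmod w"] unfolding of_nat_Suc by linarith+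
    have "real (Suc n) ^ 4 \<le> (1 + cmod w) ^ 4" using n by (intro power_mono) auto
    then have "1 / (1 + cmod w) ^ 4 \<le> 1 / real (Suc n) ^ 4" by (intro frac_le) auto
    then have "ennreal (norm (1 / (1 + cmod w) ^ 4)) \<le> ennreal (1 / real (Suc n) ^ 4)"
      by (intro ennreal_leI) simp
    also have "\<dots> = (\<Sum>k\<in>{n}. ennreal (1 / real (Suc k) ^ 4) * indicator (ball 0 (real (Suc k))) w)"
      using n by simp
    also have "\<dots> \<le> (\<Sum>k. ennreal (1 / real (Suc k) ^ 4) * indicator (ball 0 (real (Suc k))) w)"
      by (intro sum_le_suminf) auto
    finally show ?thesis .
  qed
  have "(\<integral>\<^sup>+w. ennreal (norm (1 / (1 + cmod w) ^ 4)) \<partial>lborel) \<le>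
      (\<integral>\<^sup>+(w::complex). (\<Sum>n. ennreal (1 / real (Suc n) ^ 4) * indicator (ball 0 (real (Suc n))) w) \<partial>lborel)"
    by (intro nn_integral_mono le)
  also have "\<dots> = (\<Sum>n. \<integral>\<^sup>+(w::complex). ennreal (1 / real (Suc n) ^ 4) * indicator (ball 0 (real (Suc n))) w \<partial>lborel)"
    by (intro nn_integral_suminf borel_measurable_times_ennreal borel_measurable_const borel_measurable_indicator) auto
  also have "\<dots> = (\<Sum>n. ennreal (pi * (1 / real (Suc n) ^ 2)))"
  proof (intro suminf_cong)
    fix n
    have "(\<integral>\<^sup>+(w::complex). ennreal (1 / real (Suc n) ^ 4) * indicator (ball 0 (real (Suc n))) w \<partial>lborel) =
        ennreal (1 / real (Suc n) ^ 4) * emeasure lborel (ball (0::complex) (real (Suc n)))"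
      by (rule nn_integral_cmult_indicator) simp
    also have "emeasure lborel (ball (0::complex) (real (Suc n))) = ennreal (pi * real (Suc n) ^ 2)"
      by (simp add: emeasure_ball unit_ball_vol_2)
    also have "ennreal (1 / real (Suc n) ^ 4) * ennreal (pi * real (Suc n) ^ 2) = ennreal (1 / real (Suc n) ^ 4 * (pi * real (Suc n) ^ 2))"
      by (rule ennreal_mult[symmetric]) auto
    also have "1 / real (Suc n) ^ 4 * (pi * real (Suc n) ^ 2) = pi * (1 / real (Suc n) ^ 2)"
      by (simp add: power4_eq_xxxx power2_eq_square)
    finally show "(\<integral>\<^sup>+(w::complex). ennreal (1 / real (Suc n) ^ 4) * indicator (ball 0 (real (Suc n))) w \<partial>lborel) = ennreal (pi * (1 / real (Suc n) ^ 2))" .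
  qed
  also have "\<dots> < \<infinity>"
  proof -
    have "summable (\<lambda>n. 1 / real (Suc n) ^ 2)"
      using inverse_power_summable[of 2, where ?'a = real] summable_Suc_iff[of "\<lambda>n. inverse (real n ^ 2)"]
      by (simp add: inverse_eq_divide)
    then have "summable (\<lambda>n. pi * (1 / real (Suc n) ^ 2))" by (rule summable_mult)
    then have "(\<Sum>n. ennreal (pi * (1 / real (Suc n) ^ 2))) \<noteq> top"
      by (rule ennreal_suminf_neq_top) auto
    then show ?thesis by (simp add: less_top)
  qed
  finally show "(\<integral>\<^sup>+(w::complex). ennreal (norm (1 / (1 + cmod w) ^ 4)) \<partial>lborel) < \<infinity>" .
qed

lemma norm_one_plus_ge:
  assumes "0 \<le> Re u"
  shows "1 \<le> cmod (1 + u)" "cmod u \<le> cmod (1 + u)"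
proof -
  have "1\<^sup>2 \<le> (cmod (1 + u))\<^sup>2"
    using assms unfolding cmod_power2 by (simp add: power2_eq_square algebra_simps)
  then show "1 \<le> cmod (1 + u)" by (rule power2_le_imp_le) simp
  have "(cmod u)\<^sup>2 \<le> (cmod (1 + u))\<^sup>2"
    using assms unfolding cmod_power2 by (simp add: power2_eq_square algebra_simps)
  then show "cmod u \<le> cmod (1 + u)" by (rule power2_le_imp_le) simp
qed

definition peak_den :: "real \<Rightarrow> complex \<Rightarrow> complex \<Rightarrow> complex" where
  "peak_den \<delta> \<mu> z = 1 + (1 - cnj \<mu> * z) / of_real \<delta>"

text \<open>The antiderivative of \<open>1 / peak_den \<delta> \<mu> z ^ Suc p\<close>: a function whose derivative is concentrated near the
  boundary point \<open>\<mu>\<close> at the scale \<open>\<delta>\<close>.\<close>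

definition peak :: "nat \<Rightarrow> real \<Rightarrow> complex \<Rightarrow> complex \<Rightarrow> complex" where
  "peak p \<delta> \<mu> z = (if z \<in> ball 0 1 then \<mu> * of_real \<delta> / (of_nat p * peak_den \<delta> \<mu> z ^ p) else 0)"

lemma one_minus_cnj_unit:
  assumes "cmod \<mu> = 1"
  shows "1 - cnj \<mu> * z = - cnj \<mu> * (z - \<mu>)" "cmod (1 - cnj \<mu> * z) = cmod (z - \<mu>)"
proof -
  have "cnj \<mu> * \<mu> = 1" using complex_norm_square[of \<mu>] assms by (simp add: mult.commute)
  then show *: "1 - cnj \<mu> * z = - cnj \<mu> * (z - \<mu>)" by (simp add: algebra_simps)
  show "cmod (1 - cnj \<mu> * z) = cmod (z - \<mu>)" unfolding * norm_mult using assms by simp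
qed

lemma peak_den_ge:
  assumes \<mu>: "cmod \<mu> = 1" and z: "cmod z \<le> 1" and \<delta>: "\<delta> > 0"
  shows "1 \<le> cmod (peak_den \<delta> \<mu> z)" "cmod (z - \<mu>) / \<delta> \<le> cmod (peak_den \<delta> \<mu> z)" "peak_den \<delta> \<mu> z \<noteq> 0"
proof -
  have "Re (cnj \<mu> * z) \<le> cmod (cnj \<mu> * z)" by (rule complex_Re_le_cmod)
  also have "\<dots> \<le> 1" using \<mu> z by (simp add: norm_mult)
  finally have re: "0 \<le> Re ((1 - cnj \<mu> * z) / of_real \<delta>)" using \<delta> by (simp add: Re_divide_of_real)
  show 1: "1 \<le> cmod (peak_den \<delta> \<mu> z)" unfolding peak_den_def by (rule norm_one_plus_ge[OF re])
  have "cmod ((1 - cnj \<mu> * z) / of_real \<delta>) = cmod (z - \<mu>) / \<delta>"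
    using \<delta> by (simp add: norm_divide one_minus_cnj_unit(2)[OF \<mu>])
  then show "cmod (z - \<mu>) / \<delta> \<le> cmod (peak_den \<delta> \<mu> z)"
    unfolding peak_den_def using norm_one_plus_ge(2)[OF re] by simp
  show "peak_den \<delta> \<mu> z \<noteq> 0" using 1 by auto
qed

lemma peak_has_deriv:
  assumes \<mu>: "cmod \<mu> = 1" and z: "z \<in> ball 0 1" and \<delta>: "\<delta> > 0" and p: "p > 0"
  shows "(peak p \<delta> \<mu> has_field_derivative 1 / peak_den \<delta> \<mu> z ^ Suc p) (at z)"
proof (rule has_field_derivative_transform_within_open[OF _ open_ball z])
  let ?X = "peak_den \<delta> \<mu>"
  have X0: "?X z \<noteq> 0" by (rule peak_den_ge(3)[OF \<mu> _ \<delta>]) (use z in simp)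
  have dX: "(?X has_field_derivative - cnj \<mu> / of_real \<delta>) (at z)"
    unfolding peak_den_def using \<delta> by (auto intro!: derivative_eq_intros)
  have "cnj \<mu> * \<mu> = 1" using complex_norm_square[of \<mu>] \<mu> by (simp add: mult.commute)
  have "((\<lambda>z. \<mu> * of_real \<delta> / of_nat p * inverse (?X z ^ p)) has_field_derivative
      \<mu> * of_real \<delta> / of_nat p * (- (inverse (?X z ^ p) * (of_nat p * ((- cnj \<mu> / of_real \<delta>) * ?X z ^ (p - Suc 0))) * inverse (?X z ^ p)))) (at z)"
    by (intro DERIV_cmult DERIV_inverse' DERIV_power dX) (use X0 in simp)
  moreover have "\<mu> * of_real \<delta> / of_nat p * (- (inverse (?X z ^ p) * (of_nat p * ((- cnj \<mu> / of_real \<delta>) * ?X z ^ (p - Suc 0))) * inverse (?X z ^ p)))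
      = (cnj \<mu> * \<mu>) / ?X z ^ Suc p"
  proof -
    obtain k where k: "p = Suc k" using p by (cases p) auto
    show ?thesis using X0 \<delta> unfolding k by (simp add: field_simps del: of_nat_Suc)
  qed
  ultimately show "((\<lambda>z. \<mu> * of_real \<delta> / of_nat p * inverse (?X z ^ p)) has_field_derivative 1 / ?X z ^ Suc p) (at z)"
    using \<open>cnj \<mu> * \<mu> = 1\<close> by simp
qed (simp add: peak_def divide_inverse)

lemma peak_facts:
  assumes \<mu>: "cmod \<mu> = 1" and \<delta>: "\<delta> > 0" and p: "p > 0"
  shows peak_deriv: "cmod z < 1 \<Longrightarrow> deriv (peak p \<delta> \<mu>) z = 1 / peak_den \<delta> \<mu> z ^ Suc p"
    and peak_mem: "0 < \<alpha> \<Longrightarrow> peak p \<delta> \<mu> \<in> dirichlet_space \<alpha>"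
proof -
  show d: "deriv (peak p \<delta> \<mu>) z = 1 / peak_den \<delta> \<mu> z ^ Suc p" if "cmod z < 1" for z
    using that by (intro DERIV_imp_deriv peak_has_deriv \<mu> \<delta> p) simp
  assume \<alpha>: "0 < \<alpha>"
  show "peak p \<delta> \<mu> \<in> dirichlet_space \<alpha>"
  proof (rule dirichlet_mem_bounded_deriv[OF \<alpha>])
    show "peak p \<delta> \<mu> holomorphic_on ball 0 1"
      unfolding holomorphic_on_open[OF open_ball] using peak_has_deriv[OF \<mu> _ \<delta> p] by blast
    show "peak p \<delta> \<mu> z = 0" if "z \<notin> ball 0 1" for z using that by (simp add: peak_def)
    fix z :: complex assume z: "z \<in> ball 0 1"
    have "1 \<le> cmod (peak_den \<delta> \<mu> z) ^ Suc p"
      using peak_den_ge(1)[OF \<mu> _ \<delta>, of z] z by (intro one_le_power) simp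
    then show "cmod (deriv (peak p \<delta> \<mu>) z) \<le> 1"
      using z by (simp only: d mem_ball_0 norm_divide norm_power norm_one) (simp add: divide_le_eq)
  qed
qed

lemma peak_value_le:
  assumes \<mu>: "cmod \<mu> = 1" and z: "cmod z < 1" and p: "p > 0"
  shows "\<exists>C. \<forall>\<delta>>0. cmod (peak p \<delta> \<mu> z) \<le> C * \<delta> ^ Suc p"
proof (intro exI allI impI)
  fix \<delta> :: real assume \<delta>: "\<delta> > 0"
  let ?d = "cmod (z - \<mu>)"
  have d: "?d > 0" using \<mu> z by auto
  have Xpos: "0 < cmod (peak_den \<delta> \<mu> z)" using peak_den_ge(3)[OF \<mu> _ \<delta>, of z] z by simp
  have "(?d / \<delta>) ^ p \<le> cmod (peak_den \<delta> \<mu> z) ^ p"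
    using peak_den_ge(2)[OF \<mu> _ \<delta>, of z] z d \<delta> by (intro power_mono) auto
  then have "\<delta> / (real p * cmod (peak_den \<delta> \<mu> z) ^ p) \<le> \<delta> / (real p * (?d / \<delta>) ^ p)"
    using d \<delta> p Xpos by (intro divide_left_mono mult_left_mono mult_pos_pos zero_less_power) auto
  also have "\<dots> = 1 / (real p * ?d ^ p) * \<delta> ^ Suc p"
    using d \<delta> by (simp add: power_divide field_simps)
  finally show "cmod (peak p \<delta> \<mu> z) \<le> 1 / (real p * ?d ^ p) * \<delta> ^ Suc p"
    using z \<mu> \<delta> by (simp add: peak_def norm_mult norm_divide norm_power)
qed

text \<open>The squared norm of the limit profile \<open>(1 + w)\<^sup>-\<^sup>m\<close> in the right half-plane; the maximum restricts the integral to
  the half-plane because \<open>0 powr \<alpha> = 0\<close>.\<close>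

definition half_plane_mass :: "real \<Rightarrow> nat \<Rightarrow> real" where
  "half_plane_mass \<alpha> m = (LINT w|lborel. max 0 (2 * Re w) powr \<alpha> / cmod (1 + w) ^ (2 * m))"

lemma weight_power_bound:
  fixes x :: real
  assumes "x \<ge> 0" and m: "\<alpha> + 4 \<le> 2 * real m" and "0 \<le> y" "y \<le> 2 * x" and \<alpha>: "0 < \<alpha>"
  shows "y powr \<alpha> / (1 + x) ^ (2 * m) \<le> 2 powr \<alpha> * (1 / (1 + x) ^ 4)"
proof -
  have "y powr \<alpha> \<le> (2 * (1 + x)) powr \<alpha>" using assms by (intro powr_mono2) auto
  also have "\<dots> = 2 powr \<alpha> * (1 + x) powr \<alpha>" using assms by (subst powr_mult) auto
  finally have "y powr \<alpha> * (1 + x) ^ 4 \<le> 2 powr \<alpha> * ((1 + x) powr \<alpha> * (1 + x) ^ 4)"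
    using assms by (simp add: mult_right_mono mult.assoc[symmetric])
  also have "(1 + x) powr \<alpha> * (1 + x) ^ 4 = (1 + x) powr (\<alpha> + 4)"
    using assms by (simp add: powr_add)
  also have "\<dots> \<le> (1 + x) powr (real (2 * m))" using assms by (intro powr_mono) auto
  also have "\<dots> = (1 + x) ^ (2 * m)" using assms by (intro powr_realpow) auto
  finally have "y powr \<alpha> * (1 + x) ^ 4 \<le> 2 powr \<alpha> * (1 + x) ^ (2 * m)" by simp
  then show ?thesis using assms by (simp add: divide_le_eq le_divide_eq)
qed

lemma half_plane_integrable:
  assumes \<alpha>: "0 < \<alpha>" and m: "\<alpha> + 4 \<le> 2 * real m"
  shows "integrable lborel (\<lambda>w. max 0 (2 * Re w) powr \<alpha> / cmod (1 + w) ^ (2 * m))"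
proof -
  let ?j = "\<lambda>w. max 0 (2 * Re w) powr \<alpha> / cmod (1 + w) ^ (2 * m)"
  have jm: "?j \<in> borel_measurable lborel"
    by (intro borel_measurable_divide powr_real_measurable borel_measurable_power borel_measurable_max) auto
  show ?thesis
  proof (rule Bochner_Integration.integrable_bound)
    show "integrable lborel (\<lambda>w. 4 ^ m * (2 powr \<alpha> * (1 / (1 + cmod w) ^ 4)))"
      by (intro integrable_mult_right integrable_inverse_fourth_power)
    show "AE w in lborel. norm (?j w) \<le> norm (4 ^ m * (2 powr \<alpha> * (1 / (1 + cmod w) ^ 4)))"
    proof (rule AE_I2)
      fix w :: complex
      show "norm (?j w) \<le> norm (4 ^ m * (2 powr \<alpha> * (1 / (1 + cmod w) ^ 4)))"
      proof (cases "Re w \<ge> 0")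
        case True
        have "(1 + cmod w) / 2 \<le> cmod (1 + w)" using norm_one_plus_ge[OF True] by simp
        then have "((1 + cmod w) / 2) ^ (2 * m) \<le> cmod (1 + w) ^ (2 * m)" by (intro power_mono) auto
        then have "?j w \<le> max 0 (2 * Re w) powr \<alpha> / ((1 + cmod w) / 2) ^ (2 * m)"
          by (intro divide_left_mono mult_pos_pos) (auto intro!: zero_less_power add_pos_nonneg intro: less_le_trans[OF zero_less_one norm_one_plus_ge(1)[OF True]])
        also have "\<dots> = 4 ^ m * (max 0 (2 * Re w) powr \<alpha> / (1 + cmod w) ^ (2 * m))"
          by (simp add: power_divide power_mult)
        also have "\<dots> \<le> 4 ^ m * (2 powr \<alpha> * (1 / (1 + cmod w) ^ 4))"
          using complex_Re_le_cmod[of w] by (intro mult_left_mono weight_power_bound m \<alpha>) auto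
        finally show ?thesis by simp
      qed (use \<alpha> in simp)
    qed
  qed (rule jm)
qed

lemma half_plane_mass_pos:
  assumes \<alpha>: "0 < \<alpha>" and m: "\<alpha> + 4 \<le> 2 * real m"
  shows "half_plane_mass \<alpha> m > 0"
proof -
  let ?j = "\<lambda>w. max 0 (2 * Re w) powr \<alpha> / cmod (1 + w) ^ (2 * m)"
  note int = half_plane_integrable[OF \<alpha> m]
  have le: "(1 / 4 ^ (2 * m)) * indicator (ball 2 1) w \<le> ?j w" for w
  proof (cases "w \<in> ball 2 1")
    case True
    then have n: "cmod (2 - w) < 1" by (simp add: dist_norm)
    then have re: "1 < Re w" using complex_Re_le_cmod[of "2 - w"] by simp
    have "cmod (1 + w) \<le> 4" using n norm_triangle_ineq4[of 3 "2 - w"] by simp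
    then have "cmod (1 + w) ^ (2 * m) \<le> 4 ^ (2 * m)" by (intro power_mono) auto
    moreover have "1 \<le> max 0 (2 * Re w) powr \<alpha>" using re \<alpha> by (intro ge_one_powr_ge_zero) auto
    moreover have "0 < cmod (1 + w) ^ (2 * m)" using re by (intro zero_less_power) (auto simp: complex_eq_iff)
    ultimately have "1 / 4 ^ (2 * m) \<le> ?j w" by (intro frac_le) auto
    then show ?thesis using True by simp
  qed simp
  have "0 < (1 / 4 ^ (2 * m)) * measure lborel (ball (2::complex) 1)"
    using content_ball[of 1 "2::complex"] by (simp add: unit_ball_vol_2)
  also have "\<dots> = (LINT w|lborel. (1 / 4 ^ (2 * m)) * indicator (ball (2::complex) 1) w)" by simp
  also have "\<dots> \<le> integral\<^sup>L lborel ?j"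
    using emeasure_lborel_ball_finite[of "2::complex" 1]
    by (intro integral_mono int le integrable_mult_right) (simp add: integrable_indicator_iff)
  finally show ?thesis by (simp add: half_plane_mass_def)
qed

text \<open>In the coordinate \<open>z = \<xi> (1 - \<epsilon> w)\<close> one has \<open>1 - |z|\<^sup>2 = \<epsilon> (2 Re w - \<epsilon> |w|\<^sup>2)\<close>.\<close>

lemma scaled_area_weight:
  assumes \<xi>: "cmod \<xi> = 1" and \<epsilon>: "\<epsilon> > 0"
  shows "\<epsilon> powr (-\<alpha>) * area_weight \<alpha> (\<xi> + (- \<xi> * of_real \<epsilon>) * w) =
    (1 + \<alpha>) / pi * max 0 (2 * Re w - \<epsilon> * (cmod w)\<^sup>2) powr \<alpha>"
proof -
  let ?z = "\<xi> + (- \<xi> * of_real \<epsilon>) * w" and ?y = "2 * Re w - \<epsilon> * (cmod w)\<^sup>2"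
  have "cmod ?z = cmod (\<xi> * (1 - of_real \<epsilon> * w))" by (simp add: algebra_simps)
  also have "\<dots> = cmod (1 - of_real \<epsilon> * w)" using \<xi> by (simp add: norm_mult)
  finally have "1 - (cmod ?z)\<^sup>2 = 1 - (cmod (1 - of_real \<epsilon> * w))\<^sup>2" by simp
  also have "\<dots> = \<epsilon> * ?y"
    unfolding cmod_power2 by (simp add: power2_eq_square algebra_simps)
  finally have y: "1 - (cmod ?z)\<^sup>2 = \<epsilon> * ?y" .
  have iff: "cmod ?z < 1 \<longleftrightarrow> 0 < ?y"
    using abs_square_less_1[of "cmod ?z"] y \<epsilon> zero_less_mult_iff[of \<epsilon> ?y] by auto
  show ?thesis
  proof (cases "0 < ?y")
    case True
    have "area_weight \<alpha> ?z = (1 + \<alpha>) / pi * (\<epsilon> powr \<alpha> * ?y powr \<alpha>)"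
      using True iff y \<epsilon> by (simp add: area_weight_inside powr_mult)
    moreover have "\<epsilon> powr (-\<alpha>) * \<epsilon> powr \<alpha> = 1" using \<epsilon> by (simp flip: powr_add)
    moreover have "\<epsilon> powr (-\<alpha>) * ((1 + \<alpha>) / pi * (\<epsilon> powr \<alpha> * ?y powr \<alpha>)) =
        (\<epsilon> powr (-\<alpha>) * \<epsilon> powr \<alpha>) * ((1 + \<alpha>) / pi * ?y powr \<alpha>)"
      by (simp only: mult_ac)
    ultimately show ?thesis using True by (simp only: max_absorb2 less_imp_le mult_1_left)
  next
    case False
    then show ?thesis using iff by (simp add: area_weight_outside)
  qed
qed

text \<open>A lower bound that is uniform in \<open>\<epsilon>\<close>; in the rescaled coordinate it reads \<open>c (1 + |w|)\<close> and supplies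
  the integrable majorant.\<close>

lemma peak_den_contact_lower:
  assumes \<phi>: "lft_self_map \<phi>" and \<xi>: "cmod \<xi> = 1" "cmod (\<phi> \<xi>) = 1" and s: "s > 0"
  obtains c where "c > 0"
    "\<And>\<epsilon> z. \<epsilon> > 0 \<Longrightarrow> cmod z \<le> 1 \<Longrightarrow> c * (1 + cmod (z - \<xi>) / \<epsilon>) \<le> cmod (peak_den (s * \<epsilon>) (\<phi> \<xi>) (\<phi> z))"
proof -
  obtain k where k: "k > 0" "\<And>z w. cmod z \<le> 1 \<Longrightarrow> cmod w \<le> 1 \<Longrightarrow> k * cmod (z - w) \<le> cmod (\<phi> z - \<phi> w)"
    using lft_expansion[OF \<phi>] by blast
  define c where "c = min 1 (k / s) / 2"
  have c: "c > 0" "2 * c \<le> 1" "2 * c \<le> k / s" using k s by (auto simp: c_def)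
  have "c * (1 + cmod (z - \<xi>) / \<epsilon>) \<le> cmod (peak_den (s * \<epsilon>) (\<phi> \<xi>) (\<phi> z))" if \<epsilon>: "\<epsilon> > 0" and z: "cmod z \<le> 1" for \<epsilon> z
  proof -
    let ?X = "cmod (peak_den (s * \<epsilon>) (\<phi> \<xi>) (\<phi> z))"
    note X = peak_den_ge[OF \<xi>(2) lft_in_cdisk[OF \<phi> z] mult_pos_pos[OF s \<epsilon>]]
    have "2 * c * (cmod (z - \<xi>) / \<epsilon>) \<le> k / s * (cmod (z - \<xi>) / \<epsilon>)"
      using c \<epsilon> by (intro mult_right_mono) auto
    also have "\<dots> = k * cmod (z - \<xi>) / (s * \<epsilon>)" by simp
    also have "\<dots> \<le> cmod (\<phi> z - \<phi> \<xi>) / (s * \<epsilon>)"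
      using k(2)[OF z, of \<xi>] \<xi> s \<epsilon> by (intro divide_right_mono) auto
    also have "\<dots> \<le> ?X" by (rule X(2))
    finally have 1: "2 * c * (cmod (z - \<xi>) / \<epsilon>) \<le> ?X" .
    have "2 * c \<le> ?X" using c X(1) by linarith
    with 1 show ?thesis by (simp add: distrib_left)
  qed
  with c show thesis using that by blast
qed

text \<open>Substitute \<open>z = \<xi> (1 - \<epsilon> w)\<close> and use dominated convergence. For \<open>\<phi>\<close> and \<open>\<psi>\<close> it gives the form
  on peak functions, and with the identity in place of both maps it gives their norms. The condition on \<open>m\<close> makes the
  majorant \<open>(1 + |w|)\<^sup>\<alpha>\<^sup>-\<^sup>2\<^sup>m\<close> integrable.\<close>

lemma peak_scaling_limit:
  assumes \<alpha>: "0 < \<alpha>" and \<phi>: "lft_self_map \<phi>" and \<psi>: "lft_self_map \<psi>"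
    and \<xi>: "cmod \<xi> = 1" "cmod (\<phi> \<xi>) = 1" "cmod (\<psi> \<xi>) = 1"
    and m: "\<alpha> + 4 \<le> 2 * real m"
    and \<epsilon>: "\<And>n. \<epsilon> n > 0" "\<epsilon> \<longlonglongrightarrow> 0"
  defines "P \<equiv> \<lambda>\<phi> n z. deriv \<phi> z / peak_den (cmod (deriv \<phi> \<xi>) * \<epsilon> n) (\<phi> \<xi>) (\<phi> z) ^ m"
  shows "(\<lambda>n. (1 / \<epsilon> n powr (2 + \<alpha>)) *\<^sub>R (LINT z|lborel. area_weight \<alpha> z *\<^sub>R (P \<phi> n z * cnj (P \<psi> n z))))
    \<longlonglongrightarrow> of_real ((1 + \<alpha>) / pi * half_plane_mass \<alpha> m) * (deriv \<phi> \<xi> * cnj (deriv \<psi> \<xi>))"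
proof -
  have \<alpha>': "-1 < \<alpha>" using \<alpha> by simp
  define Z where "Z n w = \<xi> + (- \<xi> * of_real (\<epsilon> n)) * w" for n w
  define A where "A n w = (1 + \<alpha>) / pi * max 0 (2 * Re w - \<epsilon> n * (cmod w)\<^sup>2) powr \<alpha>" for n w
  define F where "F n z = area_weight \<alpha> z *\<^sub>R (P \<phi> n z * cnj (P \<psi> n z))" for n z
  define G where "G n w = A n w *\<^sub>R (P \<phi> n (Z n w) * cnj (P \<psi> n (Z n w)))" for n w
  define G0 where "G0 w = ((1 + \<alpha>) / pi * (max 0 (2 * Re w) powr \<alpha> / cmod (1 + w) ^ (2 * m))) *\<^sub>R (deriv \<phi> \<xi> * cnj (deriv \<psi> \<xi>))" for w
  have \<xi>0: "\<xi> \<noteq> 0" using \<xi> by auto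
  have A: "\<epsilon> n powr (-\<alpha>) * area_weight \<alpha> (Z n w) = A n w" for n w
    unfolding Z_def A_def by (rule scaled_area_weight[OF \<xi>(1) \<epsilon>(1)])
  have A_outside: "A n w = 0" if "\<not> cmod (Z n w) < 1" for n w
    using A[of n w] area_weight_outside[OF that, of \<alpha>] by simp
  have Z_diff: "Z n w - \<xi> = - (\<xi> * of_real (\<epsilon> n) * w)" for n w by (simp add: Z_def)
  have Z_norm: "cmod (Z n w - \<xi>) / \<epsilon> n = cmod w" for n w
    unfolding Z_diff using \<xi>(1) \<epsilon>(1)[of n] by (simp add: norm_mult)
  have contP: "continuous_on (ball 0 1) (P \<theta> n)" if \<theta>: "lft_self_map \<theta>" "cmod (\<theta> \<xi>) = 1" for \<theta> n
  proof -
    have d: "continuous_on (ball 0 1) (deriv \<theta>)" "continuous_on (ball 0 1) \<theta>"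
      by (rule continuous_on_subset[OF lft_deriv_continuous[OF \<theta>(1)]], force)
         (rule continuous_on_subset[OF lft_continuous[OF \<theta>(1)]], force)
    have s: "cmod (deriv \<theta> \<xi>) * \<epsilon> n > 0" using lft_deriv_nonzero[OF \<theta>(1), of \<xi>] \<xi>(1) \<epsilon>(1) by simp
    have "peak_den (cmod (deriv \<theta> \<xi>) * \<epsilon> n) (\<theta> \<xi>) (\<theta> z) ^ m \<noteq> 0" if "z \<in> ball 0 1" for z
      using peak_den_ge(3)[OF \<theta>(2) lft_in_cdisk[OF \<theta>(1)] s, of z] that by simp
    moreover have "continuous_on (ball 0 1) (\<lambda>z. peak_den (cmod (deriv \<theta> \<xi>) * \<epsilon> n) (\<theta> \<xi>) (\<theta> z) ^ m)"
      unfolding peak_den_def by (intro continuous_intros d) (use s in auto)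
    ultimately show ?thesis unfolding P_def by (intro continuous_on_divide d) auto
  qed
  have Fm: "F n \<in> borel_measurable borel" for n
    unfolding F_def by (intro borel_measurable_area_weight[OF \<alpha>'] continuous_intros contP \<phi> \<psi> \<xi>)
  have c0: "- \<xi> * of_real (\<epsilon> n) \<noteq> 0" for n using \<xi>0 \<epsilon>(1)[of n] by simp
  have G_eq: "(\<lambda>w. \<epsilon> n powr (-\<alpha>) *\<^sub>R F n (Z n w)) = G n" for n
  proof (rule ext)
    show "\<epsilon> n powr (-\<alpha>) *\<^sub>R F n (Z n w) = G n w" for w
      unfolding F_def G_def scaleR_scaleR A ..
  qed
  have Gm: "G n \<in> borel_measurable borel" for n
  proof -
    have "(\<lambda>w. \<epsilon> n powr (-\<alpha>) *\<^sub>R F n (Z n w)) \<in> borel_measurable borel"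
      unfolding Z_def by (intro borel_measurable_scaleR measurable_compose[OF _ Fm]) auto
    then show ?thesis unfolding G_eq .
  qed
  have change: "(1 / \<epsilon> n powr (2 + \<alpha>)) *\<^sub>R integral\<^sup>L lborel (F n) = integral\<^sup>L lborel (G n)" for n
  proof -
    have "integral\<^sup>L lborel (F n) = (cmod (- \<xi> * of_real (\<epsilon> n)))\<^sup>2 *\<^sub>R (LINT w|lborel. F n (Z n w))"
      unfolding Z_def by (rule lborel_integral_complex_affine(1)[OF c0 Fm])
    also have "(cmod (- \<xi> * of_real (\<epsilon> n)))\<^sup>2 = (\<epsilon> n)\<^sup>2"
      using \<xi>(1) by (simp add: norm_mult)
    finally have "(1 / \<epsilon> n powr (2 + \<alpha>)) *\<^sub>R integral\<^sup>L lborel (F n) = ((\<epsilon> n)\<^sup>2 / \<epsilon> n powr (2 + \<alpha>)) *\<^sub>R (LINT w|lborel. F n (Z n w))"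
      by simp
    also have "(\<epsilon> n)\<^sup>2 / \<epsilon> n powr (2 + \<alpha>) = \<epsilon> n powr (-\<alpha>)"
      using \<epsilon>(1)[of n] by (simp add: powr_add powr_minus field_simps)
    also have "\<epsilon> n powr (-\<alpha>) *\<^sub>R (LINT w|lborel. F n (Z n w)) = (LINT w|lborel. \<epsilon> n powr (-\<alpha>) *\<^sub>R F n (Z n w))"
      by (rule integral_scaleR_right[symmetric])
    finally show ?thesis unfolding G_eq .
  qed
  \<comment> \<open>Pointwise, the rescaled denominators tend to \<open>1 + w\<close>: the tangential derivative \<open>\<theta>' \<xi>\<close> equals \<open>s \<theta> \<xi> / \<xi>\<close>.\<close>
  have P_lim: "(\<lambda>n. P \<theta> n (Z n w)) \<longlonglongrightarrow> deriv \<theta> \<xi> / (1 + w) ^ m"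
    if \<theta>: "lft_self_map \<theta>" "cmod (\<theta> \<xi>) = 1" and w: "Re w > 0" for \<theta> w
  proof -
    let ?s = "cmod (deriv \<theta> \<xi>)"
    have s: "?s > 0" using lft_deriv_nonzero[OF \<theta>(1), of \<xi>] \<xi>(1) by simp
    have w0: "w \<noteq> 0" "1 + w \<noteq> 0" using w by (auto simp: complex_eq_iff)
    have Z_lim: "(\<lambda>n. Z n w) \<longlonglongrightarrow> \<xi>"
    proof -
      have "(\<lambda>n. \<xi> + (- \<xi> * of_real (\<epsilon> n)) * w) \<longlonglongrightarrow> \<xi> + (- \<xi> * of_real 0) * w"
        by (intro tendsto_intros \<epsilon>(2))
      then show ?thesis by (simp add: Z_def)
    qed
    have Z_ne: "Z n w \<noteq> \<xi>" for n
      using Z_diff[of n w] \<xi>0 \<epsilon>(1)[of n] w0 by auto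
    have "(\<lambda>n. 2 * Re w - \<epsilon> n * (cmod w)\<^sup>2) \<longlonglongrightarrow> 2 * Re w - 0 * (cmod w)\<^sup>2"
      by (intro tendsto_intros \<epsilon>(2))
    then have "\<forall>\<^sub>F n in sequentially. 0 < 2 * Re w - \<epsilon> n * (cmod w)\<^sup>2"
      by (rule order_tendstoD(1)) (use w in simp)
    then have Z_in: "\<forall>\<^sub>F n in sequentially. Z n w \<in> cball 0 1"
    proof eventually_elim
      case (elim n)
      then have "A n w \<noteq> 0" using \<alpha> by (simp add: A_def)
      then show ?case using A_outside[of n w] by (cases "cmod (Z n w) < 1") auto
    qed
    have d_lim: "(\<lambda>n. deriv \<theta> (Z n w)) \<longlonglongrightarrow> deriv \<theta> \<xi>"
      by (rule continuous_on_tendsto_compose[OF lft_deriv_continuous[OF \<theta>(1)] Z_lim _ Z_in]) (use \<xi>(1) in simp)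
    have "((\<lambda>z. (\<theta> z - \<theta> \<xi>) / (z - \<xi>)) \<longlongrightarrow> deriv \<theta> \<xi>) (at \<xi>)"
      using lft_has_deriv[OF \<theta>(1), of \<xi>] \<xi>(1) by (simp add: has_field_derivative_iff)
    then have q_lim: "(\<lambda>n. (\<theta> (Z n w) - \<theta> \<xi>) / (Z n w - \<xi>)) \<longlonglongrightarrow> deriv \<theta> \<xi>"
      by (rule filterlim_compose) (use Z_lim Z_ne in \<open>auto simp: filterlim_at\<close>)
    have den: "peak_den (?s * \<epsilon> n) (\<theta> \<xi>) (\<theta> (Z n w)) =
        1 + cnj (\<theta> \<xi>) * \<xi> * w * ((\<theta> (Z n w) - \<theta> \<xi>) / (Z n w - \<xi>)) / of_real ?s" for n
    proof -
      have "\<theta> (Z n w) - \<theta> \<xi> = (\<theta> (Z n w) - \<theta> \<xi>) / (Z n w - \<xi>) * (- (\<xi> * of_real (\<epsilon> n) * w))"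
        unfolding Z_diff[symmetric] using Z_ne[of n] by simp
      then have "1 - cnj (\<theta> \<xi>) * \<theta> (Z n w) = - cnj (\<theta> \<xi>) * ((\<theta> (Z n w) - \<theta> \<xi>) / (Z n w - \<xi>) * (- (\<xi> * of_real (\<epsilon> n) * w)))"
        using one_minus_cnj_unit(1)[OF \<theta>(2), of "\<theta> (Z n w)"] by (simp only:)
      then have "(1 - cnj (\<theta> \<xi>) * \<theta> (Z n w)) / of_real (?s * \<epsilon> n) =
          cnj (\<theta> \<xi>) * \<xi> * w * ((\<theta> (Z n w) - \<theta> \<xi>) / (Z n w - \<xi>)) / of_real ?s"
        using s \<epsilon>(1)[of n] by (simp only: of_real_mult) (simp add: mult_ac)
      then show ?thesis unfolding peak_den_def by (simp only:)
    qed
    have "(\<lambda>n. peak_den (?s * \<epsilon> n) (\<theta> \<xi>) (\<theta> (Z n w))) \<longlonglongrightarrow> 1 + cnj (\<theta> \<xi>) * \<xi> * w * deriv \<theta> \<xi> / of_real ?s"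
      unfolding den by (intro tendsto_intros q_lim) (use s in simp)
    also have "cnj (\<theta> \<xi>) * \<xi> * w * deriv \<theta> \<xi> / of_real ?s = (cnj (\<theta> \<xi>) * \<theta> \<xi>) * w"
      by (subst lft_contact_deriv[OF \<theta>(1) \<xi>(1) \<theta>(2)]) (use s \<xi>0 in \<open>simp add: field_simps\<close>)
    also have "cnj (\<theta> \<xi>) * \<theta> \<xi> = 1"
      using complex_norm_square[of "\<theta> \<xi>"] \<theta>(2) by (simp add: mult.commute)
    finally have "(\<lambda>n. peak_den (?s * \<epsilon> n) (\<theta> \<xi>) (\<theta> (Z n w))) \<longlonglongrightarrow> 1 + w" by simp
    then show ?thesis unfolding P_def by (intro tendsto_intros d_lim) (use w0 in auto)
  qed
  have G_lim: "(\<lambda>n. G n w) \<longlonglongrightarrow> G0 w" for w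
  proof (cases "Re w > 0")
    case True
    have "(\<lambda>n. max 0 (2 * Re w - \<epsilon> n * (cmod w)\<^sup>2)) \<longlonglongrightarrow> max 0 (2 * Re w - 0 * (cmod w)\<^sup>2)"
      by (intro tendsto_intros \<epsilon>(2))
    then have "A' \<longlonglongrightarrow> (1 + \<alpha>) / pi * max 0 (2 * Re w - 0 * (cmod w)\<^sup>2) powr \<alpha>" if "A' = (\<lambda>n. A n w)" for A'
      unfolding that A_def using \<alpha> by (intro tendsto_mult tendsto_const tendsto_powr') auto
    from this[OF refl] have A_lim: "(\<lambda>n. A n w) \<longlonglongrightarrow> (1 + \<alpha>) / pi * max 0 (2 * Re w) powr \<alpha>" by simp
    have "(\<lambda>n. G n w) \<longlonglongrightarrow> ((1 + \<alpha>) / pi * max 0 (2 * Re w) powr \<alpha>) *\<^sub>R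
        (deriv \<phi> \<xi> / (1 + w) ^ m * cnj (deriv \<psi> \<xi> / (1 + w) ^ m))"
      unfolding G_def by (intro tendsto_intros A_lim P_lim \<phi> \<psi> \<xi> True)
    also have "deriv \<phi> \<xi> / (1 + w) ^ m * cnj (deriv \<psi> \<xi> / (1 + w) ^ m) =
        (1 / cmod (1 + w) ^ (2 * m)) *\<^sub>R (deriv \<phi> \<xi> * cnj (deriv \<psi> \<xi>))"
    proof -
      have "(1 + w) ^ m * cnj ((1 + w) ^ m) = of_real (cmod (1 + w) ^ (2 * m))"
        unfolding complex_norm_square[symmetric] by (simp add: norm_power power_mult mult.commute flip: power_mult)
      then show ?thesis by (simp add: scaleR_conv_of_real field_simps)
    qed
    finally show ?thesis by (simp add: G0_def mult_ac)
  next
    case False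
    then have "2 * Re w - \<epsilon> n * (cmod w)\<^sup>2 \<le> 0" for n
      using mult_nonneg_nonneg[OF less_imp_le[OF \<epsilon>(1)[of n]] zero_le_power2[of "cmod w"]] by linarith
    then have "A n w = 0" for n by (simp add: A_def max_absorb1)
    then have "G n w = 0" for n by (simp add: G_def)
    moreover have "G0 w = 0" using False by (simp add: G0_def max_absorb1)
    ultimately show ?thesis by simp
  qed
  have P_bound: "\<exists>K>0. \<forall>n w. cmod (Z n w) < 1 \<longrightarrow> cmod (P \<theta> n (Z n w)) \<le> K / (1 + cmod w) ^ m"
    if \<theta>: "lft_self_map \<theta>" "cmod (\<theta> \<xi>) = 1" for \<theta>
  proof -
    let ?s = "cmod (deriv \<theta> \<xi>)"
    have s: "?s > 0" using lft_deriv_nonzero[OF \<theta>(1), of \<xi>] \<xi>(1) by simp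
    obtain c where c: "c > 0" "\<And>\<epsilon> z. \<epsilon> > 0 \<Longrightarrow> cmod z \<le> 1 \<Longrightarrow> c * (1 + cmod (z - \<xi>) / \<epsilon>) \<le> cmod (peak_den (?s * \<epsilon>) (\<theta> \<xi>) (\<theta> z))"
      by (rule peak_den_contact_lower[OF \<theta>(1) \<xi>(1) \<theta>(2) s]) (rule that)
    have "compact (deriv \<theta> ` cball 0 1)"
      by (intro compact_continuous_image lft_deriv_continuous[OF \<theta>(1)]) simp
    then obtain B where B: "\<forall>x\<in>cball 0 1. cmod (deriv \<theta> x) \<le> B"
      using compact_imp_bounded by (force simp: bounded_iff)
    have "?s \<le> B" using B \<xi>(1) by simp
    then have B0: "B > 0" using s by linarith
    show ?thesis
    proof (intro exI[of _ "B / c ^ m"] conjI allI impI)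
      show "0 < B / c ^ m" using B0 c by simp
      fix n w assume z: "cmod (Z n w) < 1"
      let ?X = "cmod (peak_den (?s * \<epsilon> n) (\<theta> \<xi>) (\<theta> (Z n w)))"
      have "c * (1 + cmod w) \<le> ?X" using c(2)[OF \<epsilon>(1)[of n], of "Z n w"] z by (simp add: Z_norm)
      then have "(c * (1 + cmod w)) ^ m \<le> ?X ^ m" using c by (intro power_mono) auto
      moreover have "0 < (c * (1 + cmod w)) ^ m" using c by (intro zero_less_power mult_pos_pos add_pos_nonneg) auto
      moreover have "cmod (deriv \<theta> (Z n w)) \<le> B" using B z by simp
      ultimately have "cmod (deriv \<theta> (Z n w)) / ?X ^ m \<le> B / (c * (1 + cmod w)) ^ m"
        using B0 by (intro frac_le) auto
      then show "cmod (P \<theta> n (Z n w)) \<le> B / c ^ m / (1 + cmod w) ^ m"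
        by (simp add: P_def norm_divide norm_power power_mult_distrib)
    qed
  qed
  obtain K1 where K1: "K1 > 0" "\<And>n w. cmod (Z n w) < 1 \<Longrightarrow> cmod (P \<phi> n (Z n w)) \<le> K1 / (1 + cmod w) ^ m"
    using P_bound[OF \<phi> \<xi>(2)] by blast
  obtain K2 where K2: "K2 > 0" "\<And>n w. cmod (Z n w) < 1 \<Longrightarrow> cmod (P \<psi> n (Z n w)) \<le> K2 / (1 + cmod w) ^ m"
    using P_bound[OF \<psi> \<xi>(3)] by blast
  define K where "K = (1 + \<alpha>) / pi * 2 powr \<alpha> * (K1 * K2)"
  have G_bound: "norm (G n w) \<le> K * (1 / (1 + cmod w) ^ 4)" for n w
  proof (cases "cmod (Z n w) < 1")
    case True
    let ?y = "max 0 (2 * Re w - \<epsilon> n * (cmod w)\<^sup>2)"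
    have y: "0 \<le> ?y" "?y \<le> 2 * cmod w"
      using complex_Re_le_cmod[of w] mult_nonneg_nonneg[OF less_imp_le[OF \<epsilon>(1)[of n]] zero_le_power2[of "cmod w"]] norm_ge_zero[of w]
      by (auto simp: max_def)
    have "norm (G n w) = A n w * (cmod (P \<phi> n (Z n w)) * cmod (P \<psi> n (Z n w)))"
      using \<alpha> by (simp add: G_def A_def norm_mult)
    also have "\<dots> \<le> A n w * (K1 / (1 + cmod w) ^ m * (K2 / (1 + cmod w) ^ m))"
      using \<alpha> K1 K2 True by (intro mult_left_mono mult_mono) (auto simp: A_def)
    also have "\<dots> = (1 + \<alpha>) / pi * (K1 * K2) * (?y powr \<alpha> / (1 + cmod w) ^ (2 * m))"
    proof -
      have aux: "a * y * (K1 / Y * (K2 / Y)) = a * (K1 * K2) * (y / (Y * Y))" for a y Y :: real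
        by (simp add: divide_inverse mult_ac inverse_mult_distrib)
      show ?thesis unfolding A_def mult_2 power_add aux ..
    qed
    also have "\<dots> \<le> (1 + \<alpha>) / pi * (K1 * K2) * (2 powr \<alpha> * (1 / (1 + cmod w) ^ 4))"
      using \<alpha> K1 K2 by (intro mult_left_mono weight_power_bound m y) auto
    also have "\<dots> = K * (1 / (1 + cmod w) ^ 4)" by (simp add: K_def)
    finally show ?thesis .
  next
    case False
    then show ?thesis using A_outside[OF False] \<alpha> K1 K2 by (simp add: G_def K_def)
  qed
  have "(\<lambda>n. integral\<^sup>L lborel (G n)) \<longlonglongrightarrow> integral\<^sup>L lborel G0"
  proof (rule integral_dominated_convergence[where w = "\<lambda>w. K * (1 / (1 + cmod w) ^ 4)"])
    show "integrable lborel (\<lambda>w::complex. K * (1 / (1 + cmod w) ^ 4))"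
      by (intro integrable_mult_right integrable_inverse_fourth_power)
    show "G0 \<in> borel_measurable lborel"
      by (rule borel_measurable_LIMSEQ_metric[of G]) (use Gm G_lim in auto)
    show "G n \<in> borel_measurable lborel" for n using Gm by simp
    show "AE w in lborel. (\<lambda>n. G n w) \<longlonglongrightarrow> G0 w" using G_lim by simp
    show "AE w in lborel. norm (G n w) \<le> K * (1 / (1 + cmod w) ^ 4)" for n using G_bound by simp
  qed
  also have "integral\<^sup>L lborel G0 = ((1 + \<alpha>) / pi * half_plane_mass \<alpha> m) *\<^sub>R (deriv \<phi> \<xi> * cnj (deriv \<psi> \<xi>))"
  proof -
    have "integral\<^sup>L lborel G0 = (LINT w|lborel. (1 + \<alpha>) / pi * (max 0 (2 * Re w) powr \<alpha> / cmod (1 + w) ^ (2 * m))) *\<^sub>R (deriv \<phi> \<xi> * cnj (deriv \<psi> \<xi>))"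
      unfolding G0_def
      using lft_deriv_nonzero[OF \<phi>, of \<xi>] lft_deriv_nonzero[OF \<psi>, of \<xi>] \<xi>(1)
      by (intro integral_scaleR_left integrable_mult_right half_plane_integrable \<alpha> m)
    also have "(LINT w|lborel. (1 + \<alpha>) / pi * (max 0 (2 * Re w) powr \<alpha> / cmod (1 + w) ^ (2 * m))) = (1 + \<alpha>) / pi * half_plane_mass \<alpha> m"
      unfolding half_plane_mass_def by (rule integral_mult_right_zero)
    finally show ?thesis .
  qed
  finally have "(\<lambda>n. integral\<^sup>L lborel (G n)) \<longlonglongrightarrow> of_real ((1 + \<alpha>) / pi * half_plane_mass \<alpha> m) * (deriv \<phi> \<xi> * cnj (deriv \<psi> \<xi>))"
    unfolding scaleR_conv_of_real .
  then show ?thesis unfolding change[symmetric] unfolding F_def .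
qed

section \<open>The lower estimate\<close>

lemma power_over_powr_tendsto_0:
  assumes \<delta>: "\<And>n. \<delta> n > (0::real)" "\<delta> \<longlonglongrightarrow> 0" and b: "b < real k"
  shows "(\<lambda>n. \<delta> n ^ k * \<delta> n powr (- b)) \<longlonglongrightarrow> 0"
proof -
  have "(\<lambda>n. \<delta> n powr (real k - b)) \<longlonglongrightarrow> 0"
    by (rule tendsto_zero_powrI[OF \<delta>(2) tendsto_const]) (use b \<delta>(1) in \<open>auto intro!: always_eventually less_imp_le\<close>)
  moreover have "\<delta> n powr (real k - b) = \<delta> n ^ k * \<delta> n powr (- b)" for n
    using \<delta>(1)[of n] powr_add[of "\<delta> n" "real k" "- b"] by (simp add: powr_realpow)
  ultimately show ?thesis by simp
qed

text \<open>Peaks rescaled so that their norms converge to a positive limit as \<open>\<delta>\<close> tends to 0.\<close>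

definition npeak :: "real \<Rightarrow> nat \<Rightarrow> real \<Rightarrow> complex \<Rightarrow> complex \<Rightarrow> complex" where
  "npeak \<alpha> p \<delta> \<mu> = (\<lambda>z. of_real (\<delta> powr (- ((2 + \<alpha>) / 2))) * peak p \<delta> \<mu> z)"

lemma lft_self_map_ident: "lft_self_map (\<lambda>z. z)"
  unfolding lft_self_map_def by (intro exI[of _ 1] exI[of _ 0]) auto

context
  fixes \<alpha> :: real and p :: nat and \<mu> :: complex and \<delta> :: "nat \<Rightarrow> real"
  assumes \<alpha>: "0 < \<alpha>" and p: "\<alpha> + 4 \<le> real p" and \<mu>: "cmod \<mu> = 1"
    and \<delta>: "\<And>n. \<delta> n > 0" "\<delta> \<longlonglongrightarrow> 0"
begin

interpretation D: function_hilbert_space "dirichlet_space \<alpha>" "dirichlet_inner \<alpha>"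
  by (rule dirichlet_hilbert_space[OF \<alpha>])

lemma npeak_mem: "npeak \<alpha> p (\<delta> n) \<mu> \<in> dirichlet_space \<alpha>"
  unfolding npeak_def using p \<alpha> by (intro D.scale_mem peak_mem \<mu> \<delta> \<alpha>) auto

lemma npeak_deriv:
  assumes "cmod z < 1"
  shows "deriv (npeak \<alpha> p (\<delta> n) \<mu>) z = of_real (\<delta> n powr (- ((2 + \<alpha>) / 2))) * (1 / peak_den (\<delta> n) \<mu> z ^ Suc p)"
proof -
  have p0: "p > 0" using p \<alpha> by (cases p) auto
  have "(npeak \<alpha> p (\<delta> n) \<mu> has_field_derivative of_real (\<delta> n powr (- ((2 + \<alpha>) / 2))) * (1 / peak_den (\<delta> n) \<mu> z ^ Suc p)) (at z)"
    unfolding npeak_def by (intro DERIV_cmult peak_has_deriv \<mu> \<delta> p0) (use assms in simp)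
  then show ?thesis by (rule DERIV_imp_deriv)
qed

lemma npeak_value_lim:
  assumes z: "cmod z < 1"
  shows "(\<lambda>n. npeak \<alpha> p (\<delta> n) \<mu> z) \<longlonglongrightarrow> 0"
proof -
  have p0: "p > 0" using p \<alpha> by (cases p) auto
  obtain C where C: "\<And>\<delta>. \<delta> > 0 \<Longrightarrow> cmod (peak p \<delta> \<mu> z) \<le> C * \<delta> ^ Suc p"
    using peak_value_le[OF \<mu> z p0] by blast
  show ?thesis
  proof (rule Lim_null_comparison)
    have "cmod (npeak \<alpha> p (\<delta> n) \<mu> z) \<le> C * (\<delta> n ^ Suc p * \<delta> n powr (- ((2 + \<alpha>) / 2)))" for n
    proof -
      have "cmod (npeak \<alpha> p (\<delta> n) \<mu> z) = \<delta> n powr (- ((2 + \<alpha>) / 2)) * cmod (peak p (\<delta> n) \<mu> z)"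
        by (simp add: npeak_def norm_mult)
      also have "\<dots> \<le> \<delta> n powr (- ((2 + \<alpha>) / 2)) * (C * \<delta> n ^ Suc p)"
        by (intro mult_left_mono C \<delta>) simp
      finally show ?thesis by (simp only: mult_ac)
    qed
    then show "\<forall>\<^sub>F n in sequentially. norm (npeak \<alpha> p (\<delta> n) \<mu> z) \<le> C * (\<delta> n ^ Suc p * \<delta> n powr (- ((2 + \<alpha>) / 2)))"
      by (intro always_eventually allI)
    show "(\<lambda>n. C * (\<delta> n ^ Suc p * \<delta> n powr (- ((2 + \<alpha>) / 2)))) \<longlonglongrightarrow> 0"
      using p \<alpha> by (intro tendsto_mult_right_zero power_over_powr_tendsto_0 \<delta>) (auto simp: field_simps)
  qed
qed

lemma npeak_norm_lim:
  "(\<lambda>n. dnorm \<alpha> (npeak \<alpha> p (\<delta> n) \<mu>)) \<longlonglongrightarrow> sqrt ((1 + \<alpha>) / pi * half_plane_mass \<alpha> (Suc p))"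
proof -
  have \<alpha>': "-1 < \<alpha>" using \<alpha> by simp
  let ?c = "(1 + \<alpha>) / pi * half_plane_mass \<alpha> (Suc p)"
  let ?N = "dnorm \<alpha>"
  let ?f = "\<lambda>n. npeak \<alpha> p (\<delta> n) \<mu>"
  let ?k = "\<lambda>n z. 1 / peak_den (\<delta> n) \<mu> z ^ Suc p"
  have "(\<lambda>n. (1 / \<delta> n powr (2 + \<alpha>)) *\<^sub>R (LINT z|lborel. area_weight \<alpha> z *\<^sub>R (?k n z * cnj (?k n z)))) \<longlonglongrightarrow> of_real ?c"
    using peak_scaling_limit[OF \<alpha> lft_self_map_ident lft_self_map_ident \<mu> \<mu> \<mu>, of "Suc p" \<delta>] p \<delta> by simp
  from tendsto_Re[OF this]
  have lim: "(\<lambda>n. (1 / \<delta> n powr (2 + \<alpha>)) * Re (LINT z|lborel. area_weight \<alpha> z *\<^sub>R (?k n z * cnj (?k n z)))) \<longlonglongrightarrow> ?c"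
    by (simp only: scaleR_complex.sel Re_complex_of_real)
  have sq: "(?N (?f n))\<^sup>2 = (cmod (?f n 0))\<^sup>2 + (1 / \<delta> n powr (2 + \<alpha>)) * Re (LINT z|lborel. area_weight \<alpha> z *\<^sub>R (?k n z * cnj (?k n z)))" for n
  proof -
    have "area_weight \<alpha> z * (cmod (deriv (?f n) z))\<^sup>2 = (1 / \<delta> n powr (2 + \<alpha>)) * (area_weight \<alpha> z * (cmod (?k n z))\<^sup>2)" for z
    proof (cases "cmod z < 1")
      case True
      have "(\<delta> n powr (- ((2 + \<alpha>) / 2)))\<^sup>2 = \<delta> n powr (- (2 + \<alpha>))"
        by (simp add: power2_eq_square flip: powr_add)
      also have "\<dots> = 1 / \<delta> n powr (2 + \<alpha>)" by (simp only: powr_minus_divide)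
      finally show ?thesis unfolding npeak_deriv[OF True] norm_mult power_mult_distrib by simp
    qed (simp add: area_weight_outside)
    then have "(?N (?f n))\<^sup>2 = (cmod (?f n 0))\<^sup>2 + (LINT z|lborel. (1 / \<delta> n powr (2 + \<alpha>)) * (area_weight \<alpha> z * (cmod (?k n z))\<^sup>2))"
      unfolding dirichlet_hnorm[OF \<alpha>' npeak_mem] by (simp only:)
    also have "(LINT z|lborel. (1 / \<delta> n powr (2 + \<alpha>)) * (area_weight \<alpha> z * (cmod (?k n z))\<^sup>2)) =
        (1 / \<delta> n powr (2 + \<alpha>)) * (LINT z|lborel. area_weight \<alpha> z * (cmod (?k n z))\<^sup>2)"
      by (rule integral_mult_right_zero)
    also have "(LINT z|lborel. area_weight \<alpha> z * (cmod (?k n z))\<^sup>2) = Re (LINT z|lborel. area_weight \<alpha> z *\<^sub>R (?k n z * cnj (?k n z)))"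
    proof -
      have "area_weight \<alpha> z *\<^sub>R (?k n z * cnj (?k n z)) = complex_of_real (area_weight \<alpha> z * (cmod (?k n z))\<^sup>2)" for z
        unfolding complex_norm_square[symmetric] scaleR_conv_of_real of_real_mult ..
      then show ?thesis by (simp only: integral_complex_of_real Re_complex_of_real)
    qed
    finally show ?thesis .
  qed
  have "(\<lambda>n. (cmod (?f n 0))\<^sup>2) \<longlonglongrightarrow> (cmod 0)\<^sup>2"
    by (intro tendsto_intros npeak_value_lim) simp
  from tendsto_add[OF this lim] have "(\<lambda>n. (?N (?f n))\<^sup>2) \<longlonglongrightarrow> ?c" unfolding sq by simp
  from tendsto_real_sqrt[OF this] show ?thesis using D.hnorm_nonneg by simp
qed

text \<open>Near \<open>\<mu>\<close> the norms of the peaks stay bounded while \<open>h'\<close> has little mass; away from \<open>\<mu>\<close>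
  the peaks tend uniformly to 0.\<close>

lemma npeak_weakly_null:
  assumes h: "h \<in> dirichlet_space \<alpha>"
  shows "(\<lambda>n. dirichlet_inner \<alpha> h (npeak \<alpha> p (\<delta> n) \<mu>)) \<longlonglongrightarrow> 0"
proof -
  have \<alpha>': "-1 < \<alpha>" using \<alpha> by simp
  let ?N = "dnorm \<alpha>"
  let ?f = "\<lambda>n. npeak \<alpha> p (\<delta> n) \<mu>"
  let ?H = "\<lambda>z. area_weight \<alpha> z * (cmod (deriv h z))\<^sup>2"
  let ?F = "\<lambda>n z. area_weight \<alpha> z * (cmod (deriv (?f n) z))\<^sup>2"
  let ?J = "\<lambda>n z. area_weight \<alpha> z *\<^sub>R (deriv h z * cnj (deriv (?f n) z))"
  have Hint: "integrable lborel ?H" by (rule dirichlet_integrable[OF \<alpha>' h])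
  have Fint: "integrable lborel (?F n)" for n by (rule dirichlet_integrable[OF \<alpha>' npeak_mem])
  have w0: "0 \<le> area_weight \<alpha> z" for z by (rule area_weight_nonneg[OF \<alpha>'])
  obtain B where B: "B > 0" "\<And>n. (?N (?f n))\<^sup>2 \<le> B"
  proof -
    have "Bseq (\<lambda>n. ?N (?f n))" using npeak_norm_lim by (intro convergent_imp_Bseq) (auto simp: convergent_def)
    then obtain b where b: "b > 0" "\<And>n. norm (?N (?f n)) \<le> b" by (auto elim!: BseqE)
    have "(?N (?f n))\<^sup>2 \<le> b\<^sup>2" for n
      using b(2)[of n] D.hnorm_nonneg[of "?f n"] by (intro power_mono) auto
    then show thesis using b(1) by (intro that[of "b\<^sup>2"]) auto
  qed
  have F_le: "integral\<^sup>L lborel (?F n) \<le> B" for n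
    using B(2)[of n] zero_le_power2[of "cmod (?f n 0)"] unfolding dirichlet_hnorm[OF \<alpha>' npeak_mem] by linarith
  define a where "a n = \<delta> n ^ Suc p * \<delta> n powr (- ((2 + \<alpha>) / 2))" for n
  have a_lim: "a \<longlonglongrightarrow> 0"
    unfolding a_def using p \<alpha> by (intro power_over_powr_tendsto_0 \<delta>) (auto simp: field_simps)
  \<comment> \<open>The mass of \<open>h'\<close> near the boundary point \<open>\<mu>\<close> is small by dominated convergence.\<close>
  define I where "I i = (LINT z|lborel. indicator (ball \<mu> (1 / real (Suc i))) z * ?H z)" for i
  have I_lim: "I \<longlonglongrightarrow> 0"
  proof -
    have "I \<longlonglongrightarrow> integral\<^sup>L lborel (\<lambda>z::complex. 0::real)"
      unfolding I_def
    proof (rule integral_dominated_convergence[where w = ?H])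
      show "AE z in lborel. (\<lambda>i. indicator (ball \<mu> (1 / real (Suc i))) z * ?H z) \<longlonglongrightarrow> 0"
      proof (rule AE_I2)
        fix z
        show "(\<lambda>i. indicator (ball \<mu> (1 / real (Suc i))) z * ?H z) \<longlonglongrightarrow> 0"
        proof (cases "z = \<mu>")
          case True
          then show ?thesis using \<mu> by (simp add: area_weight_outside)
        next
          case False
          have "(\<lambda>i. 1 / real (Suc i)) \<longlonglongrightarrow> 0"
            using LIMSEQ_inverse_real_of_nat by (simp add: inverse_eq_divide)
          then have "\<forall>\<^sub>F i in sequentially. 1 / real (Suc i) < dist \<mu> z"
            by (rule order_tendstoD(2)) (use False in simp)
          then have "\<forall>\<^sub>F i in sequentially. indicator (ball \<mu> (1 / real (Suc i))) z * ?H z = 0"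
            by eventually_elim simp
          then show ?thesis by (rule tendsto_eventually)
        qed
      qed
      show "AE z in lborel. norm (indicator (ball \<mu> (1 / real (Suc i))) z * ?H z) \<le> ?H z" for i
        using w0 by (intro AE_I2) (simp add: indicator_def)
      have Hm: "?H \<in> borel_measurable lborel" using Hint by (rule borel_measurable_integrable)
      show "(\<lambda>z. indicator (ball \<mu> (1 / real (Suc i))) z * ?H z) \<in> borel_measurable lborel" for i
        by (rule borel_measurable_times[OF borel_measurable_indicator Hm]) simp
    qed (use Hint in auto)
    then show ?thesis by simp
  qed
  have J_lim: "(\<lambda>n. integral\<^sup>L lborel (?J n)) \<longlonglongrightarrow> 0"
  proof (rule LIMSEQ_I)
    fix e' :: real assume e': "e' > 0"
    define e where "e = e' / 4"
    have e: "e > 0" using e' by (simp add: e_def)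
    \<comment> \<open>The weight in \<open>x y \<le> K x\<^sup>2 / 2 + y\<^sup>2 / (2 K)\<close>: large enough to absorb the bound \<open>B\<close> of the peaks.\<close>
    define K where "K = B / e"
    have K: "K > 0" using B e by (simp add: K_def)
    have "\<forall>\<^sub>F i in sequentially. I i < e / K" by (rule order_tendstoD(2)[OF I_lim]) (use e K in simp)
    then obtain i where i: "I i < e / K" by (auto simp: eventually_sequentially)
    define \<rho> where "\<rho> = 1 / real (Suc i)"
    have \<rho>: "\<rho> > 0" by (simp add: \<rho>_def)
    define A where "A = (LINT z|lborel. area_weight \<alpha> z + ?H z)"
    have ai: "integrable lborel (\<lambda>z. area_weight \<alpha> z + ?H z)"
      by (intro Bochner_Integration.integrable_add integrable_area_weight[OF \<alpha>] Hint)
    have "(\<lambda>n. a n / \<rho> ^ Suc p * A) \<longlonglongrightarrow> 0 / \<rho> ^ Suc p * A"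
      by (intro tendsto_intros a_lim) (use \<rho> in simp)
    then have "\<forall>\<^sub>F n in sequentially. a n / \<rho> ^ Suc p * A < e"
      by (rule order_tendstoD(2)) (use e in simp)
    then obtain n0 where n0: "\<And>n. n \<ge> n0 \<Longrightarrow> a n / \<rho> ^ Suc p * A < e" by (auto simp: eventually_sequentially)
    have point: "norm (?J n z) \<le> K / 2 * (indicator (ball \<mu> \<rho>) z * ?H z) + 1 / (2 * K) * ?F n z + a n / \<rho> ^ Suc p * (area_weight \<alpha> z + ?H z)" for n z
    proof (cases "cmod z < 1")
      case z: True
      let ?x = "cmod (deriv h z)" and ?y = "cmod (deriv (?f n) z)"
      have lhs: "norm (?J n z) = area_weight \<alpha> z * (?x * ?y)" using w0 by (simp add: norm_mult)
      have a0: "0 \<le> a n" using \<delta>(1)[of n] by (simp add: a_def)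
      show ?thesis
      proof (cases "z \<in> ball \<mu> \<rho>")
        case True
        have "?x * ?y \<le> K / 2 * ?x\<^sup>2 + 1 / (2 * K) * ?y\<^sup>2"
        proof -
          have "0 \<le> (K * ?x - ?y)\<^sup>2" by simp
          then have "2 * K * (?x * ?y) \<le> K\<^sup>2 * ?x\<^sup>2 + ?y\<^sup>2" by (simp add: power2_diff power_mult_distrib mult_ac)
          then have "2 * K * (?x * ?y) / (2 * K) \<le> (K\<^sup>2 * ?x\<^sup>2 + ?y\<^sup>2) / (2 * K)" using K by (intro divide_right_mono) auto
          then show ?thesis using K by (simp add: add_divide_distrib power2_eq_square)
        qed
        then have "area_weight \<alpha> z * (?x * ?y) \<le> area_weight \<alpha> z * (K / 2 * ?x\<^sup>2 + 1 / (2 * K) * ?y\<^sup>2)"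
          using w0 by (rule mult_left_mono)
        also have "\<dots> = K / 2 * (indicator (ball \<mu> \<rho>) z * ?H z) + 1 / (2 * K) * ?F n z"
          using True by (simp add: distrib_left mult_ac)
        also have "\<dots> \<le> \<dots> + a n / \<rho> ^ Suc p * (area_weight \<alpha> z + ?H z)"
          using a0 \<rho> w0[of z] by simp
        finally show ?thesis unfolding lhs .
      next
        case False
        have "\<rho> / \<delta> n \<le> cmod (z - \<mu>) / \<delta> n"
          using False \<delta>(1)[of n] by (intro divide_right_mono) (auto simp: dist_norm norm_minus_commute)
        also have "\<dots> \<le> cmod (peak_den (\<delta> n) \<mu> z)" by (rule peak_den_ge(2)[OF \<mu> _ \<delta>(1)]) (use z in simp)
        finally have "(\<rho> / \<delta> n) ^ Suc p \<le> cmod (peak_den (\<delta> n) \<mu> z) ^ Suc p"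
          using \<rho> \<delta>(1)[of n] by (intro power_mono) auto
        moreover have "0 < (\<rho> / \<delta> n) ^ Suc p" using \<rho> \<delta>(1)[of n] by (intro zero_less_power divide_pos_pos)
        ultimately have "1 / cmod (peak_den (\<delta> n) \<mu> z) ^ Suc p \<le> 1 / (\<rho> / \<delta> n) ^ Suc p"
          by (intro frac_le) auto
        then have "\<delta> n powr (- ((2 + \<alpha>) / 2)) * (1 / cmod (peak_den (\<delta> n) \<mu> z) ^ Suc p) \<le> \<delta> n powr (- ((2 + \<alpha>) / 2)) * (1 / (\<rho> / \<delta> n) ^ Suc p)"
          by (rule mult_left_mono) simp
        also have "\<dots> = a n / \<rho> ^ Suc p" unfolding a_def power_divide by simp
        finally have y: "?y \<le> a n / \<rho> ^ Suc p"
          unfolding npeak_deriv[OF z] by (simp add: norm_mult norm_divide norm_power)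
        have "2 * ?x \<le> 1 + ?x\<^sup>2" using zero_le_power2[of "?x - 1"] by (simp add: power2_diff)
        moreover have "0 \<le> ?x" by simp
        ultimately have "?x \<le> 1 + ?x\<^sup>2" by linarith
        then have "?x * ?y \<le> (1 + ?x\<^sup>2) * (a n / \<rho> ^ Suc p)"
          using y by (intro mult_mono) auto
        then have "area_weight \<alpha> z * (?x * ?y) \<le> area_weight \<alpha> z * ((1 + ?x\<^sup>2) * (a n / \<rho> ^ Suc p))"
          using w0 by (rule mult_left_mono)
        also have "\<dots> = a n / \<rho> ^ Suc p * (area_weight \<alpha> z + ?H z)" by (simp add: algebra_simps)
        also have "\<dots> \<le> K / 2 * (indicator (ball \<mu> \<rho>) z * ?H z) + 1 / (2 * K) * ?F n z + \<dots>"
          using K w0[of z] by simp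
        finally show ?thesis unfolding lhs .
      qed
    qed (simp add: area_weight_outside)
    have "norm (integral\<^sup>L lborel (?J n)) < e'" if n: "n \<ge> n0" for n
    proof -
      have ii: "integrable lborel (\<lambda>z. indicator (ball \<mu> \<rho>) z * ?H z)"
        using integrable_mult_indicator[of "ball \<mu> \<rho>" lborel ?H] Hint by simp
      have "norm (integral\<^sup>L lborel (?J n)) \<le> (LINT z|lborel. norm (?J n z))" by (rule integral_norm_bound)
      also have "\<dots> \<le> (LINT z|lborel. K / 2 * (indicator (ball \<mu> \<rho>) z * ?H z) + 1 / (2 * K) * ?F n z + a n / \<rho> ^ Suc p * (area_weight \<alpha> z + ?H z))"
        by (intro integral_mono integrable_norm dirichlet_inner_lborel(2)[OF \<alpha>' h npeak_mem] point
          Bochner_Integration.integrable_add integrable_mult_right ii Fint Hint integrable_area_weight[OF \<alpha>])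
      also have "\<dots> = K / 2 * I i + 1 / (2 * K) * integral\<^sup>L lborel (?F n) + a n / \<rho> ^ Suc p * A"
      proof -
        have "(LINT z|lborel. K / 2 * (indicator (ball \<mu> \<rho>) z * ?H z) + 1 / (2 * K) * ?F n z + a n / \<rho> ^ Suc p * (area_weight \<alpha> z + ?H z)) =
            (LINT z|lborel. K / 2 * (indicator (ball \<mu> \<rho>) z * ?H z)) + (LINT z|lborel. 1 / (2 * K) * ?F n z) +
            (LINT z|lborel. a n / \<rho> ^ Suc p * (area_weight \<alpha> z + ?H z))"
          by (subst Bochner_Integration.integral_add, intro Bochner_Integration.integrable_add integrable_mult_right ii Fint,
              rule integrable_mult_right[OF ai], subst Bochner_Integration.integral_add)
             (rule integrable_mult_right[OF ii], rule integrable_mult_right[OF Fint], rule refl)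
        then show ?thesis
          unfolding A_def I_def \<rho>_def[symmetric] by (simp only: integral_mult_right_zero)
      qed
      also have "\<dots> < e' "
      proof -
        have "K / 2 * I i \<le> K / 2 * (e / K)" using i K by (intro mult_left_mono) auto
        also have "\<dots> = e / 2" using K by simp
        finally have 1: "K / 2 * I i \<le> e / 2" .
        have "1 / (2 * K) * integral\<^sup>L lborel (?F n) \<le> 1 / (2 * K) * B" using F_le K by (intro mult_left_mono) auto
        also have "\<dots> = e / 2" using B e by (simp add: K_def)
        finally have 2: "1 / (2 * K) * integral\<^sup>L lborel (?F n) \<le> e / 2" .
        show ?thesis using 1 2 n0[OF n] e by (simp add: e_def)
      qed
      finally show ?thesis .
    qed
    then show "\<exists>no. \<forall>n\<ge>no. norm (integral\<^sup>L lborel (?J n) - 0) < e'" by auto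
  qed
  have "(\<lambda>n. h 0 * cnj (?f n 0) + integral\<^sup>L lborel (?J n)) \<longlonglongrightarrow> h 0 * cnj 0 + 0"
    by (intro tendsto_intros npeak_value_lim J_lim) simp
  then show ?thesis unfolding dirichlet_inner_lborel(1)[OF \<alpha>' h npeak_mem] by simp
qed

end

text \<open>The two families of peaks have scales in the ratio \<open>s : t\<close>, so that the compositions with \<open>\<phi>\<close> and \<open>\<psi>\<close>
  have the same limit profile at \<open>\<xi>\<close>.\<close>

lemma ess_norm_lower:
  assumes \<alpha>: "0 < \<alpha>" and \<phi>: "lft_self_map \<phi>" and \<psi>: "lft_self_map \<psi>" and contact: "\<xi> \<in> common_contact \<phi> \<psi>"
  shows "(cmod (deriv \<phi> \<xi>) * cmod (deriv \<psi> \<xi>)) powr (- (\<alpha> / 2)) \<le> ess_norm (dirichlet_space \<alpha>) (dirichlet_inner \<alpha>)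
     (hilbert_adjoint (dirichlet_space \<alpha>) (dirichlet_inner \<alpha>) (comp_op \<psi>) \<circ> comp_op \<phi>)"
proof -
  interpret D: function_hilbert_space "dirichlet_space \<alpha>" "dirichlet_inner \<alpha>"
    by (rule dirichlet_hilbert_space[OF \<alpha>])
  have \<alpha>': "-1 < \<alpha>" using \<alpha> by simp
  let ?T = "hilbert_adjoint (dirichlet_space \<alpha>) (dirichlet_inner \<alpha>) (comp_op \<psi>) \<circ> comp_op \<phi>"
  have \<xi>: "cmod \<xi> = 1" "cmod (\<phi> \<xi>) = 1" "cmod (\<psi> \<xi>) = 1" using contact by (auto simp: common_contact_def)
  define s where "s = cmod (deriv \<phi> \<xi>)"
  define t where "t = cmod (deriv \<psi> \<xi>)"
  have st: "s > 0" "t > 0" using lft_deriv_nonzero[OF \<phi>, of \<xi>] lft_deriv_nonzero[OF \<psi>, of \<xi>] \<xi> by (auto simp: s_def t_def)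
  \<comment> \<open>Any decay \<open>p \<ge> \<alpha> + 4\<close> makes the peaks integrable enough.\<close>
  define p where "p = nat \<lceil>\<alpha>\<rceil> + 4"
  have p: "\<alpha> + 4 \<le> real p" using real_nat_ceiling_ge[of \<alpha>] by (simp add: p_def)
  define c where "c = (1 + \<alpha>) / pi * half_plane_mass \<alpha> (Suc p)"
  have c: "c > 0" using half_plane_mass_pos[OF \<alpha>, of "Suc p"] p \<alpha> by (simp add: c_def)
  define \<epsilon> where "\<epsilon> n = 1 / real (Suc n)" for n
  have \<epsilon>: "\<epsilon> n > 0" "\<epsilon> \<longlonglongrightarrow> 0" for n
    using LIMSEQ_inverse_real_of_nat by (simp_all add: \<epsilon>_def[abs_def] inverse_eq_divide)
  have s\<epsilon>: "s * \<epsilon> n > 0" "(\<lambda>n. s * \<epsilon> n) \<longlonglongrightarrow> 0" and t\<epsilon>: "t * \<epsilon> n > 0" "(\<lambda>n. t * \<epsilon> n) \<longlonglongrightarrow> 0" for n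
    using st \<epsilon> tendsto_mult_right_zero[OF \<epsilon>(2)] by auto
  let ?f = "\<lambda>n. npeak \<alpha> p (s * \<epsilon> n) (\<phi> \<xi>)" and ?g = "\<lambda>n. npeak \<alpha> p (t * \<epsilon> n) (\<psi> \<xi>)"
  have f: "?f n \<in> dirichlet_space \<alpha>" and g: "?g n \<in> dirichlet_space \<alpha>" for n
    by (rule npeak_mem[OF \<alpha> p \<xi>(2) s\<epsilon>], rule npeak_mem[OF \<alpha> p \<xi>(3) t\<epsilon>])
  note Cf = comp_op_mem[OF \<alpha> \<phi> f] and Cg = comp_op_mem[OF \<alpha> \<psi> g]
  define P where "P = (\<lambda>\<phi> n z. deriv \<phi> z / peak_den (cmod (deriv \<phi> \<xi>) * \<epsilon> n) (\<phi> \<xi>) (\<phi> z) ^ Suc p)"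
  define b where "b = (2 + \<alpha>) / 2"
  have coeff: "(s * \<epsilon> n) powr (- b) * (t * \<epsilon> n) powr (- b) = (s * t) powr (- b) * (1 / \<epsilon> n powr (2 + \<alpha>))" for n
  proof -
    have "\<epsilon> n powr (- b) * \<epsilon> n powr (- b) = 1 / \<epsilon> n powr (2 + \<alpha>)"
      by (simp add: b_def powr_minus_divide flip: powr_add)
    then show ?thesis using st \<epsilon>(1)[of n] by (simp add: powr_mult mult_ac)
  qed
  have inner: "dirichlet_inner \<alpha> (?T (?f n)) (?g n) = ?f n (\<phi> 0) * cnj (?g n (\<psi> 0)) +
      of_real ((s * t) powr (- b)) * ((1 / \<epsilon> n powr (2 + \<alpha>)) *\<^sub>R (LINT z|lborel. area_weight \<alpha> z *\<^sub>R (P \<phi> n z * cnj (P \<psi> n z))))" for n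
  proof -
    have "area_weight \<alpha> z *\<^sub>R (deriv (comp_op \<phi> (?f n)) z * cnj (deriv (comp_op \<psi> (?g n)) z)) =
        of_real ((s * \<epsilon> n) powr (- b) * (t * \<epsilon> n) powr (- b)) * (area_weight \<alpha> z *\<^sub>R (P \<phi> n z * cnj (P \<psi> n z)))" for z
    proof (cases "cmod z < 1")
      case True
      have "deriv (comp_op \<phi> (?f n)) z = of_real ((s * \<epsilon> n) powr (- b)) * P \<phi> n z"
        unfolding comp_op_deriv[OF \<phi> f True] npeak_deriv[OF \<alpha> p \<xi>(2) s\<epsilon> lft_in_disk[OF \<phi> True]]
        by (simp add: P_def s_def b_def)
      moreover have "deriv (comp_op \<psi> (?g n)) z = of_real ((t * \<epsilon> n) powr (- b)) * P \<psi> n z"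
        unfolding comp_op_deriv[OF \<psi> g True] npeak_deriv[OF \<alpha> p \<xi>(3) t\<epsilon> lft_in_disk[OF \<psi> True]]
        by (simp add: P_def t_def b_def)
      ultimately show ?thesis by (simp add: scaleR_conv_of_real mult_ac)
    qed (simp add: area_weight_outside)
    then have "(LINT z|lborel. area_weight \<alpha> z *\<^sub>R (deriv (comp_op \<phi> (?f n)) z * cnj (deriv (comp_op \<psi> (?g n)) z))) =
        of_real ((s * \<epsilon> n) powr (- b) * (t * \<epsilon> n) powr (- b)) * (LINT z|lborel. area_weight \<alpha> z *\<^sub>R (P \<phi> n z * cnj (P \<psi> n z)))"
      by (simp only: integral_mult_right_zero)
    then show ?thesis
      unfolding inner_adjoint_comp_op[OF \<alpha> \<phi> \<psi> f g] dirichlet_inner_lborel(1)[OF \<alpha>' Cf Cg] comp_op_zero[OF \<phi> f] comp_op_zero[OF \<psi> g] coeff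
      by (simp add: scaleR_conv_of_real)
  qed
  have lim: "(\<lambda>n. (1 / \<epsilon> n powr (2 + \<alpha>)) *\<^sub>R (LINT z|lborel. area_weight \<alpha> z *\<^sub>R (P \<phi> n z * cnj (P \<psi> n z))))
      \<longlonglongrightarrow> of_real c * (deriv \<phi> \<xi> * cnj (deriv \<psi> \<xi>))"
    unfolding P_def c_def using p \<alpha> by (intro peak_scaling_limit[OF \<alpha> \<phi> \<psi> \<xi> _ \<epsilon>]) simp
  have "(\<lambda>n. dirichlet_inner \<alpha> (?T (?f n)) (?g n)) \<longlonglongrightarrow> 0 * cnj 0 + of_real ((s * t) powr (- b)) * (of_real c * (deriv \<phi> \<xi> * cnj (deriv \<psi> \<xi>)))"
    unfolding inner
    by (intro tendsto_intros lim npeak_value_lim[OF \<alpha> p \<xi>(2) s\<epsilon>] npeak_value_lim[OF \<alpha> p \<xi>(3) t\<epsilon>] lft_in_disk[OF \<phi>] lft_in_disk[OF \<psi>]) auto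
  from tendsto_norm[OF this]
  have "(\<lambda>n. cmod (dirichlet_inner \<alpha> (?T (?f n)) (?g n))) \<longlonglongrightarrow> (s * t) powr (- b) * (c * (s * t))"
    using c by (simp add: norm_mult s_def t_def)
  then have "(s * t) powr (- b) * (c * (s * t)) / (sqrt c * sqrt c) \<le> ess_norm (dirichlet_space \<alpha>) (dirichlet_inner \<alpha>) ?T"
    using c
    by (intro D.ess_norm_ge[OF adjoint_comp_op_bounded[OF \<alpha> \<phi> \<psi>] f g
        npeak_norm_lim[OF \<alpha> p \<xi>(2) s\<epsilon>, folded c_def] _ npeak_norm_lim[OF \<alpha> p \<xi>(3) t\<epsilon>, folded c_def] _
        npeak_weakly_null[OF \<alpha> p \<xi>(3) t\<epsilon>]]) auto
  also have "(s * t) powr (- b) * (c * (s * t)) / (sqrt c * sqrt c) = (s * t) powr (- b) * (s * t)"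
    using c by simp
  also have "\<dots> = (s * t) powr (- b) * (s * t) powr 1" using st by simp
  also have "\<dots> = (s * t) powr (- b + 1)" by (rule powr_add[symmetric])
  also have "- b + 1 = - (\<alpha> / 2)" by (simp add: b_def field_simps)
  finally show ?thesis unfolding s_def t_def .
qed

section \<open>The essential norm\<close>

theorem theorem5p11:
  fixes \<alpha> :: real and \<phi> \<psi> :: "complex \<Rightarrow> complex"
  assumes "\<alpha> > 0"
    and "lft_self_map \<phi>"
    and "lft_self_map \<psi>"
  shows "(ess_norm (dirichlet_space \<alpha>) (dirichlet_inner \<alpha>)
            (hilbert_adjoint (dirichlet_space \<alpha>) (dirichlet_inner \<alpha>) (comp_op \<psi>) \<circ> comp_op \<phi>))\<^sup>2 =
         (if common_contact \<phi> \<psi> = {} then 0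
          else (GREATEST m. m \<in> (\<lambda>\<zeta>. (cmod (deriv \<phi> \<zeta>) * cmod (deriv \<psi> \<zeta>)) powr (- \<alpha>))
                  ` common_contact \<phi> \<psi>))"
proof -
  note \<alpha> = assms(1) and \<phi> = assms(2) and \<psi> = assms(3)
  interpret D: function_hilbert_space "dirichlet_space \<alpha>" "dirichlet_inner \<alpha>"
    by (rule dirichlet_hilbert_space[OF \<alpha>])
  define E where "E = ess_norm (dirichlet_space \<alpha>) (dirichlet_inner \<alpha>)
    (hilbert_adjoint (dirichlet_space \<alpha>) (dirichlet_inner \<alpha>) (comp_op \<psi>) \<circ> comp_op \<phi>)"
  define d where "d \<zeta> = cmod (deriv \<phi> \<zeta>) * cmod (deriv \<psi> \<zeta>)" for \<zeta>
  have E0: "0 \<le> E" unfolding E_def by (rule D.ess_norm_nonneg[OF adjoint_comp_op_bounded[OF \<alpha> \<phi> \<psi>]])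
  have d_pos: "0 < d \<zeta>" if "\<zeta> \<in> common_contact \<phi> \<psi>" for \<zeta>
    using that lft_deriv_nonzero[OF \<phi>, of \<zeta>] lft_deriv_nonzero[OF \<psi>, of \<zeta>] by (simp add: d_def common_contact_def)
  have inv: "(1 / x) powr (\<alpha> / 2) = x powr (- (\<alpha> / 2))" if "x > 0" for x :: real
    using that by (simp add: powr_divide powr_minus_divide)
  have upper: "E \<le> q" if "q > 0" "\<And>\<zeta>. \<zeta> \<in> common_contact \<phi> \<psi> \<Longrightarrow> d \<zeta> powr (- (\<alpha> / 2)) < q" for q
    unfolding E_def using that d_pos inv by (intro ess_norm_upper[OF \<alpha> \<phi> \<psi>]) (simp_all add: d_def)
  show ?thesis
  proof (cases "common_contact \<phi> \<psi> = {}")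
    case True
    have "E \<le> 0 + e" if "e > 0" for e using upper[of e] that True by simp
    then have "E \<le> 0" by (rule field_le_epsilon)
    then show ?thesis using E0 True by (simp flip: E_def)
  next
    case False
    \<comment> \<open>Compactness of the contact set makes the maximum exist.\<close>
    have closed: "compact (common_contact \<phi> \<psi>)"
    proof -
      have "closed {\<zeta> \<in> sphere 0 1. cmod (\<theta> \<zeta>) = 1}" if "lft_self_map \<theta>" for \<theta>
        by (intro continuous_closed_preimage_constant continuous_on_norm closed_sphere
            continuous_on_subset[OF lft_continuous[OF that]]) auto
      from closed_Int[OF this[OF \<phi>] this[OF \<psi>]] have "closed (common_contact \<phi> \<psi>)"
        by (rule back_subst[of closed]) (auto simp: common_contact_def)
      then have "compact (sphere 0 1 \<inter> common_contact \<phi> \<psi>)" by (intro compact_Int_closed) simp_all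
      then show ?thesis by (rule back_subst[of compact]) (auto simp: common_contact_def)
    qed
    have "continuous_on (common_contact \<phi> \<psi>) d"
      unfolding d_def
      by (intro continuous_intros continuous_on_subset[OF lft_deriv_continuous[OF \<phi>]] continuous_on_subset[OF lft_deriv_continuous[OF \<psi>]])
         (auto simp: common_contact_def)
    then obtain \<xi> where \<xi>: "\<xi> \<in> common_contact \<phi> \<psi>" "\<And>\<zeta>. \<zeta> \<in> common_contact \<phi> \<psi> \<Longrightarrow> d \<xi> \<le> d \<zeta>"
      using continuous_attains_inf[OF closed False] by blast
    have mono: "d \<zeta> powr (- a) \<le> d \<xi> powr (- a)" if "\<zeta> \<in> common_contact \<phi> \<psi>" "a > 0" for \<zeta> a
      using d_pos[OF \<xi>(1)] \<xi>(2)[OF that(1)] that(2) by (intro powr_mono2') auto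
    have "E = d \<xi> powr (- (\<alpha> / 2))"
    proof (rule antisym)
      have "E \<le> d \<xi> powr (- (\<alpha> / 2)) + e" if "e > 0" for e
      proof (rule upper)
        show "0 < d \<xi> powr (- (\<alpha> / 2)) + e" using that by (simp add: add_nonneg_pos)
        show "d \<zeta> powr (- (\<alpha> / 2)) < d \<xi> powr (- (\<alpha> / 2)) + e" if "\<zeta> \<in> common_contact \<phi> \<psi>" for \<zeta>
          using mono[OF that, of "\<alpha> / 2"] \<alpha> \<open>e > 0\<close> by simp
      qed
      then show "E \<le> d \<xi> powr (- (\<alpha> / 2))" by (rule field_le_epsilon)
      show "d \<xi> powr (- (\<alpha> / 2)) \<le> E"
        unfolding E_def d_def by (rule ess_norm_lower[OF \<alpha> \<phi> \<psi> \<xi>(1)])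
    qed
    then have "E\<^sup>2 = d \<xi> powr (- \<alpha>)" by (simp add: power2_eq_square flip: powr_add)
    also have "\<dots> = (GREATEST m. m \<in> (\<lambda>\<zeta>. d \<zeta> powr (- \<alpha>)) ` common_contact \<phi> \<psi>)"
      using \<xi>(1) mono[OF _ \<alpha>] by (intro Greatest_equality[symmetric]) auto
    finally show ?thesis using False by (simp only: E_def d_def if_False)
  qed
qed

end
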